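(* Let $n\ge 7$ be an integer and let $G$ be a non-separating planar graph with exactly $2n-3$ vertices. Then the complement $\overline{G}$ of $G$ contains the complete graph $K_n$ as a minor.
   Context: All graphs are finite, simple and undirected. A planar graph $G$ is non-separating planar if there exists a planar embedding of $G$ in $\mathbb{R}^2$ such that for every cycle $C\subseteq G$, the vertices of $G\setminus C$ are not separated by $C$, i.e. they do not lie some in the region enclosed by $C$ and some in the exterior of that region. The complement $\overline{G}$ has the same vertex set as $G$, with two distinct vertices adjacent in $\overline{G}$ iff they are not adjacent in $G$. $H$ is a minor of $G$ if a graph isomorphic to $H$ can be obtained from $G$ by vertex deletions, edge deletions and edge contractions. *)

theory Defs
  imports "HOL-Analysis.Analysis" "HOL-Library.Ramsey"
begin

text \<open>
  A graph is a pair of a vertex set and an edge set; edges are two-element sets of vertices.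
\<close>

type_synonym 'a graph = "'a set \<times> 'a set set"

definition simple_graph :: "'a graph \<Rightarrow> bool" where
  "simple_graph G \<longleftrightarrow> finite (fst G) \<and> snd G \<subseteq> nsets (fst G) 2"

definition complement_graph :: "'a graph \<Rightarrow> 'a graph" where
  "complement_graph G = (fst G, nsets (fst G) 2 - snd G)"

definition complete_graph :: "nat \<Rightarrow> nat graph" where
  "complete_graph n = ({..<n}, nsets {..<n} 2)"

definition graph_isomorphic :: "'a graph \<Rightarrow> 'b graph \<Rightarrow> bool" where
  "graph_isomorphic G H \<longleftrightarrow>
     (\<exists>f. bij_betw f (fst G) (fst H) \<and> snd H = (\<lambda>e. f ` e) ` snd G)"

text \<open>
  Contracting the edge \<open>{u, v}\<close> merges \<open>v\<close> into \<open>u\<close>. Only the contracted edge would become a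
  loop, and it is removed; parallel edges coincide because edges are sets.
\<close>

inductive minor_step :: "'a graph \<Rightarrow> 'a graph \<Rightarrow> bool" where
  delete_vertex: "v \<in> V \<Longrightarrow> minor_step (V, E) (V - {v}, {e \<in> E. v \<notin> e})"
| delete_edge: "e \<in> E \<Longrightarrow> minor_step (V, E) (V, E - {e})"
| contract_edge: "{u, v} \<in> E \<Longrightarrow> u \<noteq> v \<Longrightarrow>
    minor_step (V, E)
      (V - {v}, (\<lambda>e. (\<lambda>x. if x = v then u else x) ` e) ` (E - {{u, v}}))"

definition is_minor :: "'b graph \<Rightarrow> 'a graph \<Rightarrow> bool" where
  "is_minor H G \<longleftrightarrow> (\<exists>G'. minor_step\<^sup>*\<^sup>* G G' \<and> graph_isomorphic G' H)"

text \<open>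
  A cycle is given by the list of its vertices in cyclic order.
\<close>

definition cycle_edges :: "'a list \<Rightarrow> 'a set set" where
  "cycle_edges p = {{p ! i, p ! (Suc i mod length p)} | i. i < length p}"

definition is_cycle :: "'a graph \<Rightarrow> 'a list \<Rightarrow> bool" where
  "is_cycle G p \<longleftrightarrow>
     length p \<ge> 3 \<and> distinct p \<and> set p \<subseteq> fst G \<and> cycle_edges p \<subseteq> snd G"

text \<open>
  The map \<open>\<phi>\<close> places the vertices, and \<open>\<gamma> e\<close> is the arc, parametrised over \<open>{0..1}\<close>, that draws
  the edge \<open>e\<close>. Arcs contain no vertices besides their endpoints, and two of them meet only
  in common endpoints.
\<close>

definition graph_embedding ::
    "'a graph \<Rightarrow> ('a \<Rightarrow> 'p::topological_space) \<Rightarrow> ('a set \<Rightarrow> real \<Rightarrow> 'p) \<Rightarrow> bool" where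
  "graph_embedding G \<phi> \<gamma> \<longleftrightarrow>
     inj_on \<phi> (fst G) \<and>
     (\<forall>e \<in> snd G. arc (\<gamma> e) \<and> {pathstart (\<gamma> e), pathfinish (\<gamma> e)} = \<phi> ` e \<and>
        path_image (\<gamma> e) \<inter> \<phi> ` fst G = \<phi> ` e) \<and>
     (\<forall>e \<in> snd G. \<forall>f \<in> snd G. e \<noteq> f \<longrightarrow>
        path_image (\<gamma> e) \<inter> path_image (\<gamma> f) \<subseteq> \<phi> ` (e \<inter> f))"

definition cycle_image :: "('a set \<Rightarrow> real \<Rightarrow> 'p::topological_space) \<Rightarrow> 'a list \<Rightarrow> 'p set" where
  "cycle_image \<gamma> p = (\<Union>e \<in> cycle_edges p. path_image (\<gamma> e))"

text \<open>
  \<open>inside\<close> and \<open>outside\<close> are the bounded and the unbounded part of the complement of the closed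
  curve that draws the cycle, that is, its enclosed region and its exterior.
\<close>

definition cycle_separates ::
    "'a graph \<Rightarrow> ('a \<Rightarrow> 'p::real_normed_vector) \<Rightarrow> ('a set \<Rightarrow> real \<Rightarrow> 'p) \<Rightarrow> 'a list \<Rightarrow> bool" where
  "cycle_separates G \<phi> \<gamma> p \<longleftrightarrow>
     (\<exists>u \<in> fst G - set p. \<exists>v \<in> fst G - set p.
        \<phi> u \<in> inside (cycle_image \<gamma> p) \<and> \<phi> v \<in> outside (cycle_image \<gamma> p))"

definition nonseparating_planar :: "'a graph \<Rightarrow> bool" where
  "nonseparating_planar G \<longleftrightarrow>
     (\<exists>(\<phi> :: 'a \<Rightarrow> real ^ 2) \<gamma>. graph_embedding G \<phi> \<gamma> \<and>
        (\<forall>p. is_cycle G p \<longrightarrow> \<not> cycle_separates G \<phi> \<gamma> p))"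

end

theory Submission
  imports Defs "HOL-Complex_Analysis.Winding_Numbers"
begin

text \<open>
  A family of \<open>n\<close> disjoint independent sets of \<open>G\<close>, any two of which are joined by a non-edge of \<open>G\<close>,
  contracts to \<open>K\<^sub>n\<close> in the complement; apart from a few single vertices, pairs of vertices suffice.

  In the plane, a point off a theta is separated from exactly one of its three open arcs by the cycle
  formed by the other two. Hence in a non-separating drawing every theta with three subdivided sides
  spans all vertices and its branch vertices are not adjacent, and there is no \<open>K\<^sub>4\<close>. If such a theta
  exists, its chords are so restricted that deleting two vertices leaves a subgraph of a path, for
  which a family of \<open>n\<close> sets is immediate.

  Otherwise \<open>G\<close> is outerplanar: its vertices can be arranged in a circle such that no two edges cross.
  Two vertices without common neighbours form a set that is compatible with all others, which
  reduces \<open>n\<close> by one. If no such pair exists, a vertex is adjacent to all others, and deleting it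
  leaves a subgraph of a path. For the base case \<open>n = 7\<close>, any noncrossing graph on 11 points has a triangle
  (of potential edges) that cuts off arcs of length at most 5; the remaining dissections are settled by
  an explicit case distinction.
\<close>

section \<open>Theta graphs in the plane\<close>

text \<open>The three facts taken from a drawing correspond to forbidden configurations: a vertex
  disjoint from a K_{2,3} (\<open>theta_spans\<close>), K_{1,1,3} (\<open>theta_no_edge\<close>),
  and a vertex disjoint from a K_4 (\<open>no_K4\<close>). Everything after them is combinatorial.
  The difficulty is one of counting. With sets of size at most two, \<open>n\<close> of them fit
  into \<open>2 * n - 3\<close> vertices only if at least three are single vertices. A pair costs
  two vertices and gains one set, so adding pairs preserves this balance. A path is so sparse that
  it affords the loss of two more vertices, which is why both reductions to a path may delete two
  vertices. The induction cannot start below 7: its counting step finds a vertex of degree 5 from 13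
  points on, but only degree 4 on 11 points, which is too little for the domination argument. Hence
  the finite check for 11 points. It enumerates dissections rather than graphs, by treating all
  points of one cell as mutually adjacent.\<close>

lemma inside_iff_connected:
  fixes S C :: "'b::real_normed_vector set"
  assumes "connected S" "S \<inter> C = {}" "x \<in> S" "y \<in> S"
  shows "x \<in> inside C \<longleftrightarrow> y \<in> inside C"
proof -
  have "connected_component (- C) x y"
    using assms unfolding connected_component_def by blast
  then show ?thesis
    using inside_same_component connected_component_sym by metis
qed

text \<open>The winding numbers of the three closed curves add up to zero, and each of them is
  nonzero exactly inside its curve.\<close>

lemma even_inside_theta:
  fixes c1 c2 c3 :: "real \<Rightarrow> complex"
  assumes "arc c1" "pathstart c1 = a" "pathfinish c1 = b"
    and "arc c2" "pathstart c2 = a" "pathfinish c2 = b"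
    and "arc c3" "pathstart c3 = a" "pathfinish c3 = b"
    and "path_image c1 \<inter> path_image c2 \<subseteq> {a,b}"
    and "path_image c1 \<inter> path_image c3 \<subseteq> {a,b}"
    and "path_image c2 \<inter> path_image c3 \<subseteq> {a,b}"
    and w: "w \<notin> path_image c1" "w \<notin> path_image c2" "w \<notin> path_image c3"
  shows "(w \<in> inside (path_image c1 \<union> path_image c2)) =
     ((w \<in> inside (path_image c1 \<union> path_image c3)) \<noteq> (w \<in> inside (path_image c2 \<union> path_image c3)))"
proof -
  have wind: "(winding_number c w - winding_number d w) \<in> {-1,0,1} \<and>
      (w \<in> inside (path_image c \<union> path_image d) \<longleftrightarrow> winding_number c w - winding_number d w \<noteq> 0)"
    if "arc c" "pathstart c = a" "pathfinish c = b" "arc d" "pathstart d = a" "pathfinish d = b"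
      and "path_image c \<inter> path_image d \<subseteq> {a,b}" "w \<notin> path_image c" "w \<notin> path_image d" for c d
  proof -
    let ?g = "c +++ reversepath d"
    have sp: "simple_path ?g"
      using that by (subst simple_path_join_loop_eq) (auto simp: arc_reversepath)
    have im: "path_image ?g = path_image c \<union> path_image d"
      using that by (simp add: path_image_join)
    have loop: "pathfinish ?g = pathstart ?g" using that by simp
    have wn: "winding_number ?g w = winding_number c w - winding_number d w"
      using that by (simp add: winding_number_join winding_number_reversepath arc_imp_path)
    have notin: "w \<notin> path_image ?g" using im that by auto
    have "winding_number ?g w \<in> {-1,0,1}"
      using simple_closed_path_winding_number_cases[OF sp loop notin] .
    moreover have "w \<in> inside (path_image ?g) \<longleftrightarrow> winding_number ?g w \<noteq> 0"
    proof
      assume "w \<in> inside (path_image ?g)"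
      then show "winding_number ?g w \<noteq> 0"
        using simple_closed_path_norm_winding_number_inside[OF sp] by force
    next
      assume "winding_number ?g w \<noteq> 0"
      then show "w \<in> inside (path_image ?g)"
        using winding_number_zero_in_outside[OF simple_path_imp_path[OF sp] loop] notin
          inside_Un_outside by blast
    qed
    ultimately show ?thesis by (simp add: wn im)
  qed
  define x y z where "x = winding_number c1 w" and "y = winding_number c2 w" and "z = winding_number c3 w"
  have h: "x - y \<in> {-1,0,1}" "x - z \<in> {-1,0,1}" "y - z \<in> {-1,0,1}"
    "w \<in> inside (path_image c1 \<union> path_image c2) \<longleftrightarrow> x - y \<noteq> 0"
    "w \<in> inside (path_image c1 \<union> path_image c3) \<longleftrightarrow> x - z \<noteq> 0"
    "w \<in> inside (path_image c2 \<union> path_image c3) \<longleftrightarrow> y - z \<noteq> 0"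
    using wind[of c1 c2] wind[of c1 c3] wind[of c2 c3] assms by (auto simp: x_def y_def z_def)
  \<comment> \<open>All three differences lie in {-1,0,1}. If \<open>x - z\<close> and
    \<open>y - z\<close> are both nonzero, then \<open>x - y\<close> is 0 or \<plusminus>2, and
    \<plusminus>2 is excluded; so the identity reads as an exclusive or.\<close>
  have "x - z = (x - y) + (y - z)" by simp
  then show ?thesis using h by (auto simp: complex_eq_iff)
qed

text \<open>Only applied to points off \<open>C\<close>, where not being inside means being
  outside.\<close>

definition separated_by :: "'p::real_normed_vector set \<Rightarrow> 'p \<Rightarrow> 'p \<Rightarrow> bool" where
  "separated_by C x y \<longleftrightarrow> (x \<in> inside C) \<noteq> (y \<in> inside C)"

definition theta_arcs :: "'p::topological_space \<Rightarrow> 'p \<Rightarrow> (real \<Rightarrow> 'p) \<Rightarrow> (real \<Rightarrow> 'p) \<Rightarrow> (real \<Rightarrow> 'p) \<Rightarrow> bool" where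
  "theta_arcs a b c1 c2 c3 \<longleftrightarrow> 
     (\<forall>c \<in> {c1,c2,c3}. arc c \<and> pathstart c = a \<and> pathfinish c = b) \<and>
     path_image c1 \<inter> path_image c2 \<subseteq> {a,b} \<and> path_image c1 \<inter> path_image c3 \<subseteq> {a,b} \<and>
     path_image c2 \<inter> path_image c3 \<subseteq> {a,b}"

lemma theta_arcs_perm:
  assumes "theta_arcs a b c1 c2 c3"
  shows "theta_arcs a b c1 c3 c2" "theta_arcs a b c2 c3 c1"
  using assms unfolding theta_arcs_def by (auto simp: Int_commute)

text \<open>If no arc enters the inside of the other two, then the inside of \<open>c1\<close> and
  \<open>c2\<close> is a connected set that avoids all three arcs. By
  \<open>even_inside_theta\<close> it lies within the inside of another pair, say of
  \<open>c1\<close> and \<open>c3\<close>. Its frontier contains \<open>c2\<close>, so inner points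
  of \<open>c2\<close> lie in the closure of that region, although they are neither inside it nor on
  its boundary.\<close>

lemma exists_inner_arc:
  fixes c1 c2 c3 :: "real \<Rightarrow> complex"
  assumes th: "theta_arcs a b c1 c2 c3"
  shows "path_image c1 \<inter> inside (path_image c2 \<union> path_image c3) \<noteq> {} \<or>
    path_image c2 \<inter> inside (path_image c1 \<union> path_image c3) \<noteq> {} \<or>
    path_image c3 \<inter> inside (path_image c1 \<union> path_image c2) \<noteq> {}"
proof (rule ccontr)
  let ?p = path_image
  assume "\<not> ?thesis"
  then have no1: "?p c1 \<inter> inside (?p c2 \<union> ?p c3) = {}"
    and no2: "?p c2 \<inter> inside (?p c1 \<union> ?p c3) = {}"
    and no3: "?p c3 \<inter> inside (?p c1 \<union> ?p c2) = {}" by simp_all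
  have arcs: "arc c" "pathstart c = a" "pathfinish c = b" if "c \<in> {c1,c2,c3}" for c
    using th that unfolding theta_arcs_def by auto
  have ints: "?p c1 \<inter> ?p c2 \<subseteq> {a,b}" "?p c1 \<inter> ?p c3 \<subseteq> {a,b}" "?p c2 \<inter> ?p c3 \<subseteq> {a,b}"
    using th unfolding theta_arcs_def by auto
  have jordan: "inside (?p c \<union> ?p d) \<noteq> {} \<and> connected (inside (?p c \<union> ?p d)) \<and>
      frontier (inside (?p c \<union> ?p d)) = ?p c \<union> ?p d"
    if "c \<in> {c1,c2,c3}" "d \<in> {c1,c2,c3}" "?p c \<inter> ?p d \<subseteq> {a,b}" for c d
  proof -
    have "simple_path (c +++ reversepath d)"
      using arcs[OF that(1)] arcs[OF that(2)] that(3)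
      by (subst simple_path_join_loop_eq) (auto simp: arc_reversepath)
    then show ?thesis
      using Jordan_inside_outside[of "c +++ reversepath d"] arcs[OF that(1)] arcs[OF that(2)]
      by (simp add: path_image_join)
  qed
  have core: False 
    if c: "c \<in> {c1,c2,c3}" "d \<in> {c1,c2,c3}" "e \<in> {c1,c2,c3}" "?p d \<inter> ?p e \<subseteq> {a,b}"
      "?p c \<inter> ?p d \<subseteq> {a,b}" "?p c \<inter> ?p e \<subseteq> {a,b}"
      and no: "?p c \<inter> inside (?p d \<union> ?p e) = {}"
      and sub: "inside (?p c \<union> ?p d) \<subseteq> inside (?p d \<union> ?p e)" for c d e
  proof -
    obtain x where x: "x \<in> ?p c" "x \<notin> {a,b}"
      using nonempty_simple_path_endless[OF arc_imp_simple_path[OF arcs(1)[OF c(1)]]] arcs[OF c(1)]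
      by auto
    have "x \<in> closure (inside (?p c \<union> ?p d))"
      using jordan[OF c(1,2) c(5)] x(1) by (simp add: closure_Un_frontier)
    then have "x \<in> closure (inside (?p d \<union> ?p e))"
      using sub closure_mono by blast
    then have "x \<in> inside (?p d \<union> ?p e) \<union> (?p d \<union> ?p e)"
      using jordan[OF c(2,3) c(4)] by (simp add: closure_Un_frontier)
    then show False using x c(5,6) no by blast
  qed
  obtain z where z: "z \<in> inside (?p c1 \<union> ?p c2)"
    using jordan[of c1 c2] ints by auto
  have disj: "inside (?p c1 \<union> ?p c2) \<inter> (?p c1 \<union> ?p c2 \<union> ?p c3) = {}"
    using no3 inside_no_overlap[of "?p c1 \<union> ?p c2"] by blast
  have con: "connected (inside (?p c1 \<union> ?p c2))"
    using jordan[of c1 c2] ints by auto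
  have "z \<notin> ?p c1" "z \<notin> ?p c2" "z \<notin> ?p c3" using z disj by blast+
  then have "z \<in> inside (?p c1 \<union> ?p c3) \<or> z \<in> inside (?p c2 \<union> ?p c3)"
    using even_inside_theta[of c1 a b c2 c3 z] arcs ints z by auto
  then show False
  proof
    assume "z \<in> inside (?p c1 \<union> ?p c3)"
    then have "inside (?p c1 \<union> ?p c2) \<subseteq> inside (?p c1 \<union> ?p c3)"
      using inside_iff_connected[OF con, of "?p c1 \<union> ?p c3" z] z disj by blast
    then show False
      using core[of c2 c1 c3] no2 ints by (simp add: Un_commute Int_commute)
  next
    assume "z \<in> inside (?p c2 \<union> ?p c3)"
    then have "inside (?p c1 \<union> ?p c2) \<subseteq> inside (?p c2 \<union> ?p c3)"
      using inside_iff_connected[OF con, of "?p c2 \<union> ?p c3" z] z disj by blast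
    then show False
      using core[of c1 c2 c3] no1 ints by (simp add: Un_commute Int_commute)
  qed
qed

text \<open>The arc \<open>c3\<close> splits the inside of \<open>c1\<close> and \<open>c2\<close>
  into two regions. Here \<open>x3\<close> is always inside the outer curve, while \<open>x1\<close>
  and \<open>x2\<close> are in neither region. If \<open>w\<close> is outside, only
  \<open>x3\<close> is separated from it; if \<open>w\<close> is in one of the regions, only the
  point of the arc opposite to that region is.\<close>

lemma theta_inner_case:
  fixes c1 c2 c3 :: "real \<Rightarrow> complex"
  assumes th: "theta_arcs a b c1 c2 c3"
    and inner: "path_image c3 \<inter> inside (path_image c1 \<union> path_image c2) \<noteq> {}"
    and x1: "x1 \<in> path_image c1 - {a,b}" and x2: "x2 \<in> path_image c2 - {a,b}"
    and x3: "x3 \<in> path_image c3 - {a,b}"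
    and w: "w \<notin> path_image c1 \<union> path_image c2 \<union> path_image c3"
  defines "s1 \<equiv> separated_by (path_image c2 \<union> path_image c3) x1 w"
    and "s2 \<equiv> separated_by (path_image c1 \<union> path_image c3) x2 w"
    and "s3 \<equiv> separated_by (path_image c1 \<union> path_image c2) x3 w"
  shows "(s1 \<and> \<not> s2 \<and> \<not> s3) \<or> (\<not> s1 \<and> s2 \<and> \<not> s3) \<or> (\<not> s1 \<and> \<not> s2 \<and> s3)"
proof -
  let ?p = path_image
  have arcs: "arc c" "pathstart c = a" "pathfinish c = b" if "c \<in> {c1,c2,c3}" for c
    using th that unfolding theta_arcs_def by auto
  have ab: "a \<noteq> b" using arcs[of c1] arc_distinct_ends by fastforce
  have mem: "a \<in> ?p c" "b \<in> ?p c" if "c \<in> {c1,c2,c3}" for c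
    using arcs[OF that] pathstart_in_path_image pathfinish_in_path_image by blast+
  have ints: "?p c1 \<inter> ?p c2 = {a,b}" "?p c1 \<inter> ?p c3 = {a,b}" "?p c2 \<inter> ?p c3 = {a,b}"
    using th mem unfolding theta_arcs_def by auto
  have sp: "simple_path c" if "c \<in> {c1,c2,c3}" for c
    using arcs(1)[OF that] by (rule arc_imp_simple_path)
  have "inside(?p c1 \<union> ?p c3) \<inter> inside(?p c2 \<union> ?p c3) = {} \<and>
     inside(?p c1 \<union> ?p c3) \<union> inside(?p c2 \<union> ?p c3) \<union> (?p c3 - {a,b}) = inside(?p c1 \<union> ?p c2)"
    by (rule split_inside_simple_closed_curve[of c1 a b c2 c3])
      (use sp arcs ab ints inner in simp_all)
  then have d: "inside(?p c1 \<union> ?p c3) \<inter> inside(?p c2 \<union> ?p c3) = {}"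
     "inside(?p c1 \<union> ?p c3) \<union> inside(?p c2 \<union> ?p c3) \<union> (?p c3 - {a,b}) = inside(?p c1 \<union> ?p c2)"
    by simp_all
  have "x3 \<in> inside (?p c1 \<union> ?p c2)" using d x3 by blast
  moreover have "x1 \<notin> inside (?p c2 \<union> ?p c3)" "x2 \<notin> inside (?p c1 \<union> ?p c3)"
    using d x1 x2 inside_no_overlap[of "?p c1 \<union> ?p c2"] by blast+
  moreover have "w \<in> inside (?p c1 \<union> ?p c2) \<longleftrightarrow>
      w \<in> inside (?p c1 \<union> ?p c3) \<or> w \<in> inside (?p c2 \<union> ?p c3)"
    using d(2) w by blast
  moreover have "\<not> (w \<in> inside (?p c1 \<union> ?p c3) \<and> w \<in> inside (?p c2 \<union> ?p c3))"
    using d(1) by blast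
  ultimately show ?thesis
    unfolding s1_def s2_def s3_def separated_by_def by argo
qed

lemma theta_separation_complex:
  fixes c1 c2 c3 :: "real \<Rightarrow> complex"
  assumes th: "theta_arcs a b c1 c2 c3"
    and x1: "x1 \<in> path_image c1 - {a,b}" and x2: "x2 \<in> path_image c2 - {a,b}"
    and x3: "x3 \<in> path_image c3 - {a,b}"
    and w: "w \<notin> path_image c1 \<union> path_image c2 \<union> path_image c3"
  defines "s1 \<equiv> separated_by (path_image c2 \<union> path_image c3) x1 w"
    and "s2 \<equiv> separated_by (path_image c1 \<union> path_image c3) x2 w"
    and "s3 \<equiv> separated_by (path_image c1 \<union> path_image c2) x3 w"
  shows "(s1 \<and> \<not> s2 \<and> \<not> s3) \<or> (\<not> s1 \<and> s2 \<and> \<not> s3) \<or> (\<not> s1 \<and> \<not> s2 \<and> s3)"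
proof -
  note comm = Un_commute[of "path_image c2" "path_image c1"] Un_commute[of "path_image c3" "path_image c1"]
    Un_commute[of "path_image c3" "path_image c2"]
  have ww: "w \<notin> path_image c2 \<union> path_image c3 \<union> path_image c1"
    "w \<notin> path_image c1 \<union> path_image c3 \<union> path_image c2" using w by auto
  show ?thesis
    using exists_inner_arc[OF th]
  proof (elim disjE)
    assume "path_image c1 \<inter> inside (path_image c2 \<union> path_image c3) \<noteq> {}"
    from theta_inner_case[OF theta_arcs_perm(2)[OF th] this x2 x3 x1 ww(1)]
    show ?thesis unfolding s1_def s2_def s3_def comm by argo
  next
    assume "path_image c2 \<inter> inside (path_image c1 \<union> path_image c3) \<noteq> {}"
    from theta_inner_case[OF theta_arcs_perm(1)[OF th] this x1 x3 x2 ww(2)]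
    show ?thesis unfolding s1_def s2_def s3_def comm by argo
  next
    assume "path_image c3 \<inter> inside (path_image c1 \<union> path_image c2) \<noteq> {}"
    from theta_inner_case[OF th this x1 x2 x3 w]
    show ?thesis unfolding s1_def s2_def s3_def by argo
  qed
qed

section \<open>Transfer of separation from the complex plane to \<open>real^2\<close>\<close>

definition plane_to_complex :: "real^2 \<Rightarrow> complex" where
  "plane_to_complex v = Complex (v $ 1) (v $ 2)"

lemma linear_plane_to_complex: "linear plane_to_complex"
  by (rule linearI) (auto simp: plane_to_complex_def complex_eq_iff)

lemma inj_plane_to_complex: "inj plane_to_complex"
  by (rule injI) (auto simp: plane_to_complex_def vec_eq_iff exhaust_2 forall_2)

lemma surj_plane_to_complex: "surj plane_to_complex"
proof (rule surjI)
  show "plane_to_complex (vector [Re z, Im z]) = z" for z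
    by (simp add: plane_to_complex_def complex_eq_iff)
qed

text \<open>A linear bijection and its inverse are both continuous and bounded, so components of the
  complement correspond to each other, and so do the bounded ones.\<close>

lemma inside_linear_image:
  fixes f :: "'b::euclidean_space \<Rightarrow> 'c::euclidean_space"
  assumes lin: "linear f" and inj: "inj f" and surj: "surj f"
  shows "inside (f ` S) = f ` inside S"
proof -
  obtain g where g: "linear g" "g \<circ> f = id" "f \<circ> g = id"
    using linear_injective_left_inverse[OF lin inj] surj
    by (metis comp_assoc comp_id fun.map_id surj_iff)
  have comp: "-(f ` S) = f ` (- S)" using inj surj by (simp add: bij_image_Compl_eq bij_def)
  have cc: "connected_component_set (f ` T) (f x) = f ` connected_component_set T x" 
    if x: "x \<in> T" for T x
  proof
    show "f ` connected_component_set T x \<subseteq> connected_component_set (f ` T) (f x)"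
      using x by (intro connected_component_maximal)
        (auto intro!: connected_continuous_image linear_continuous_on simp: linear_conv_bounded_linear[symmetric] lin connected_component_in dest: connected_component_in)
    have "g ` connected_component_set (f ` T) (f x) \<subseteq> connected_component_set T x"
    proof (rule connected_component_maximal)
      show "x \<in> g ` connected_component_set (f ` T) (f x)"
        using x g by (auto simp: image_iff o_def id_def fun_eq_iff intro!: exI[of _ "f x"])
      show "connected (g ` connected_component_set (f ` T) (f x))"
        by (auto intro!: connected_continuous_image linear_continuous_on simp: linear_conv_bounded_linear[symmetric] g)
      show "g ` connected_component_set (f ` T) (f x) \<subseteq> T"
        using g connected_component_subset[of "f ` T" "f x"] by (force simp: o_def id_def fun_eq_iff)
    qed
    then have "f ` g ` connected_component_set (f ` T) (f x) \<subseteq> f ` connected_component_set T x"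
      by (rule image_mono)
    then show "connected_component_set (f ` T) (f x) \<subseteq> f ` connected_component_set T x"
      by (simp add: image_comp g)
  qed
  have bd: "bounded (f ` T) \<longleftrightarrow> bounded T" for T
    using bounded_linear_image[of T f] bounded_linear_image[of "f ` T" g] g lin
    by (auto simp: linear_conv_bounded_linear[symmetric] image_comp)
  have *: "f x \<in> inside (f ` S) \<longleftrightarrow> x \<in> inside S" for x
  proof (cases "x \<in> S")
    case False
    then have "f x \<notin> f ` S" using inj by (auto dest: injD)
    then show ?thesis using False cc[of x "-S"] bd by (simp add: inside_def comp)
  qed (auto simp: inside_def)
  have "y \<in> inside (f ` S) \<longleftrightarrow> y \<in> f ` inside S" for y
  proof -
    obtain x where "y = f x" using surj by (metis surjD)
    then show ?thesis using * inj by (simp add: inj_image_mem_iff)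
  qed
  then show ?thesis by blast
qed

lemma theta_separation:
  fixes c1 c2 c3 :: "real \<Rightarrow> real^2"
  assumes th: "theta_arcs a b c1 c2 c3"
    and x1: "x1 \<in> path_image c1 - {a,b}" and x2: "x2 \<in> path_image c2 - {a,b}"
    and x3: "x3 \<in> path_image c3 - {a,b}"
    and w: "w \<notin> path_image c1 \<union> path_image c2 \<union> path_image c3"
  defines "s1 \<equiv> separated_by (path_image c2 \<union> path_image c3) x1 w"
    and "s2 \<equiv> separated_by (path_image c1 \<union> path_image c3) x2 w"
    and "s3 \<equiv> separated_by (path_image c1 \<union> path_image c2) x3 w"
  shows "(s1 \<and> \<not> s2 \<and> \<not> s3) \<or> (\<not> s1 \<and> s2 \<and> \<not> s3) \<or> (\<not> s1 \<and> \<not> s2 \<and> s3)"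
proof -
  let ?f = plane_to_complex
  have f: "linear ?f" "inj ?f" "surj ?f"
    by (rule linear_plane_to_complex inj_plane_to_complex surj_plane_to_complex)+
  have im: "path_image (?f \<circ> c) = ?f ` path_image c" for c
    by (rule path_image_compose)
  have ins: "?f x \<in> inside (?f ` S) \<longleftrightarrow> x \<in> inside S" for x S
    using inside_linear_image[OF f] f(2) by (simp add: inj_image_mem_iff)
  have sep: "separated_by (?f ` S) (?f x) (?f y) = separated_by S x y" for S x y
    by (simp add: separated_by_def ins)
  have sub: "?f ` A \<inter> ?f ` B \<subseteq> {?f a, ?f b}" if "A \<inter> B \<subseteq> {a,b}" for A B
    using that f(2) by (metis image_Int image_empty image_insert image_mono)
  have "theta_arcs (?f a) (?f b) (?f \<circ> c1) (?f \<circ> c2) (?f \<circ> c3)"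
    using th f unfolding theta_arcs_def
    by (simp add: arc_linear_image_eq im pathstart_compose pathfinish_compose sub)
  from theta_separation_complex[OF this, of "?f x1" "?f x2" "?f x3" "?f w"]
  show ?thesis unfolding s1_def s2_def s3_def
    using x1 x2 x3 w f(2) by (simp add: im image_Un[symmetric] sep inj_image_mem_iff inj_eq)
qed

text \<open>The lists hold the inner vertices of the three sides; an empty list stands for the edge
  from \<open>a\<close> to \<open>b\<close>. A side is called subdivided below if its list is
  nonempty. The relation is arbitrary, because the same notion serves the drawings and the
  combinatorial part.\<close>

definition theta :: "('a \<Rightarrow> 'a \<Rightarrow> bool) \<Rightarrow> 'a \<Rightarrow> 'a \<Rightarrow> 'a list \<Rightarrow> 'a list \<Rightarrow> 'a list \<Rightarrow> bool" where
  "theta E a b P Q R \<longleftrightarrow> distinct (a # b # P @ Q @ R) \<and>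
     successively E (a # P @ [b]) \<and> successively E (a # Q @ [b]) \<and> successively E (a # R @ [b])"

lemma theta_rotate: "theta E a b P Q R \<Longrightarrow> theta E a b Q R P"
  by (auto simp: theta_def)

lemma theta_swap: "theta E a b P Q R \<Longrightarrow> theta E a b Q P R"
  by (auto simp: theta_def)

section \<open>Drawings without separating cycles\<close>

fun walk_edges :: "'a list \<Rightarrow> 'a set set" where
  "walk_edges (x # y # xs) = insert {x, y} (walk_edges (y # xs))"
| "walk_edges _ = {}"

lemma walk_edges_append: "walk_edges (xs @ y # ys) = walk_edges (xs @ [y]) \<union> walk_edges (y # ys)"
  by (induction xs rule: walk_edges.induct) auto

lemma walk_edges_rev: "walk_edges (rev xs) = walk_edges xs"
proof (induction xs rule: walk_edges.induct)
  case (1 x y xs)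
  then show ?case
    using walk_edges_append[of "rev xs" y "[x]"] by (auto simp: insert_commute)
qed auto

lemma walk_edges_conv_nth: "walk_edges xs = {{xs ! i, xs ! Suc i} | i. Suc i < length xs}"
proof (induction xs rule: walk_edges.induct)
  case (1 x y xs)
  have "{{(x # y # xs) ! i, (x # y # xs) ! Suc i} | i. Suc i < length (x # y # xs)} =
      insert {x, y} {{(y # xs) ! i, (y # xs) ! Suc i} | i. Suc i < length (y # xs)}"
    (is "?L = insert _ ?R")
  proof
    show "?L \<subseteq> insert {x, y} ?R"
    proof
      fix e assume "e \<in> ?L"
      then obtain i where i: "e = {(x # y # xs) ! i, (x # y # xs) ! Suc i}" "Suc i < length (x # y # xs)"
        by blast
      then show "e \<in> insert {x, y} ?R" by (cases i) auto
    qed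
    have "{x, y} \<in> ?L" by (intro CollectI exI[of _ 0]) simp
    moreover have "?R \<subseteq> ?L"
    proof
      fix e assume "e \<in> ?R"
      then obtain i where "e = {(y # xs) ! i, (y # xs) ! Suc i}" "Suc i < length (y # xs)"
        by blast
      then show "e \<in> ?L" by (intro CollectI exI[of _ "Suc i"]) simp
    qed
    ultimately show "insert {x, y} ?R \<subseteq> ?L" by simp
  qed
  then show ?case using 1 by simp
qed auto

lemma cycle_edges_conv_walk:
  assumes "p \<noteq> []"
  shows "cycle_edges p = walk_edges (p @ [hd p])"
proof -
  have "{p ! i, p ! (Suc i mod length p)} = {(p @ [hd p]) ! i, (p @ [hd p]) ! Suc i}"
    if "i < length p" for i
    using that assms by (cases "Suc i = length p") (auto simp: nth_append hd_conv_nth)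
  then show ?thesis
    unfolding cycle_edges_def walk_edges_conv_nth by auto
qed

text \<open>Out along \<open>P\<close> and back along \<open>Q\<close>: this presents two sides of a
  theta as a cycle list, the form in which non-separation is given.\<close>

lemma cycle_edges_two_walks:
  "cycle_edges (a # P @ b # rev Q) = walk_edges (a # P @ [b]) \<union> walk_edges (a # Q @ [b])"
proof -
  have "cycle_edges (a # P @ b # rev Q) = walk_edges ((a # P) @ b # (rev Q @ [a]))"
    by (simp add: cycle_edges_conv_walk)
  also have "\<dots> = walk_edges (a # P @ [b]) \<union> walk_edges (b # rev Q @ [a])"
    by (subst walk_edges_append) simp
  also have "walk_edges (b # rev Q @ [a]) = walk_edges (a # Q @ [b])"
    using walk_edges_rev[of "a # Q @ [b]"] by simp
  finally show ?thesis .
qed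

lemma Union_walk_edges: "length xs \<ge> 2 \<Longrightarrow> \<Union> (walk_edges xs) = set xs"
proof (induction xs rule: walk_edges.induct)
  case (1 x y xs)
  then show ?case by (cases xs) auto
qed auto

lemma walk_edges_subset_iff: "walk_edges xs \<subseteq> E \<longleftrightarrow> successively (\<lambda>x y. {x, y} \<in> E) xs"
  by (induction xs rule: walk_edges.induct) auto

lemma ends_notin_walk_edges:
  assumes "distinct (a # b # P)" "P \<noteq> []"
  shows "{a, b} \<notin> walk_edges (a # P @ [b])"
proof -
  obtain p P' where P: "P = p # P'" using assms by (cases P) auto
  have "length (p # P' @ [b]) \<ge> 2" by simp
  then have "\<Union> (walk_edges (p # P' @ [b])) = set (p # P' @ [b])" by (rule Union_walk_edges)
  then have "a \<notin> \<Union> (walk_edges (p # P' @ [b]))" using assms P by auto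
  then have "{a, b} \<notin> walk_edges (p # P' @ [b])" by blast
  then show ?thesis using assms P by (auto simp: doubleton_eq_iff)
qed

lemma connected_arc_minus_start:
  fixes c :: "real \<Rightarrow> 'p::t2_space"
  assumes "arc c"
  shows "connected (path_image c - {pathstart c})"
proof -
  have inj: "inj_on c {0..1}" and cont: "continuous_on {0..1} c"
    using assms by (auto simp: arc_def path_def)
  have "path_image c - {pathstart c} = c ` {0<..1}"
  proof
    show "path_image c - {pathstart c} \<subseteq> c ` {0<..1}"
    proof
      fix x assume "x \<in> path_image c - {pathstart c}"
      then obtain t where t: "t \<in> {0..1}" "x = c t" "x \<noteq> c 0"
        unfolding path_image_def pathstart_def by blast
      moreover have "t \<noteq> 0" using t by auto
      ultimately show "x \<in> c ` {0<..1}" by (auto intro!: imageI)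
    qed
    show "c ` {0<..1} \<subseteq> path_image c - {pathstart c}"
      using inj_onD[OF inj, of _ 0] by (fastforce simp: path_image_def pathstart_def)
  qed
  moreover have "connected (c ` {0<..1})"
    by (rule connected_continuous_image[OF continuous_on_subset[OF cont]]) auto
  ultimately show ?thesis by simp
qed

section \<open>Consequences of non-separation for a fixed drawing\<close>

locale plane_graph =
  fixes V :: "'a set" and E :: "'a set set" and \<phi> :: "'a \<Rightarrow> real^2" and \<gamma>
  assumes simple: "simple_graph (V, E)"
    and emb: "graph_embedding (V, E) \<phi> \<gamma>"
    and nonsep: "\<And>p. is_cycle (V, E) p \<Longrightarrow> \<not> cycle_separates (V, E) \<phi> \<gamma> p"
begin

definition "drawing A = (\<Union>e\<in>A. path_image (\<gamma> e))"

definition "adj x y \<longleftrightarrow> {x, y} \<in> E"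

abbreviation "side a b P \<equiv> drawing (walk_edges (a # P @ [b]))"

lemma drawing_Un: "drawing (A \<union> B) = drawing A \<union> drawing B"
  by (simp add: drawing_def)

lemma edgeE:
  assumes "e \<in> E" obtains x y where "e = {x, y}" "x \<in> V" "y \<in> V" "x \<noteq> y"
  using assms simple nsets2_E[of e V] by (auto simp: simple_graph_def)

lemma edge_subset: "e \<in> E \<Longrightarrow> e \<subseteq> V"
  by (elim edgeE) auto

lemma adj_sym: "adj x y \<Longrightarrow> adj y x"
  by (simp add: adj_def insert_commute)

lemma adjD: "adj x y \<Longrightarrow> x \<in> V \<and> y \<in> V \<and> x \<noteq> y"
  unfolding adj_def by (elim edgeE) (auto simp: doubleton_eq_iff)

lemma walk_edges_subset: "walk_edges xs \<subseteq> E \<longleftrightarrow> successively adj xs"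
  using walk_edges_subset_iff[of xs E] by (simp add: adj_def[abs_def])

lemma inj_\<phi>: "inj_on \<phi> V"
  using emb by (simp add: graph_embedding_def)

lemma edge_arc:
  assumes "e \<in> E"
  shows "arc (\<gamma> e)" "{pathstart (\<gamma> e), pathfinish (\<gamma> e)} = \<phi> ` e"
    "path_image (\<gamma> e) \<inter> \<phi> ` V = \<phi> ` e"
  using emb assms by (auto simp: graph_embedding_def)

lemma edges_meet:
  assumes "e \<in> E" "f \<in> E" "e \<noteq> f"
  shows "path_image (\<gamma> e) \<inter> path_image (\<gamma> f) \<subseteq> \<phi> ` (e \<inter> f)"
  using emb assms by (simp add: graph_embedding_def)

lemma drawings_meet:
  assumes "A \<subseteq> E" "B \<subseteq> E" "A \<inter> B = {}"
  shows "drawing A \<inter> drawing B \<subseteq> \<phi> ` (\<Union>A \<inter> \<Union>B)"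
proof
  fix z assume "z \<in> drawing A \<inter> drawing B"
  then obtain e f where ef: "e \<in> A" "f \<in> B" "z \<in> path_image (\<gamma> e)" "z \<in> path_image (\<gamma> f)"
    by (auto simp: drawing_def)
  then have "z \<in> \<phi> ` (e \<inter> f)" using edges_meet[of e f] assms by blast
  then show "z \<in> \<phi> ` (\<Union>A \<inter> \<Union>B)" using ef by blast
qed

lemma vertex_in_drawing:
  assumes "A \<subseteq> E" "v \<in> V"
  shows "\<phi> v \<in> drawing A \<longleftrightarrow> v \<in> \<Union>A"
proof -
  have "\<phi> v \<in> path_image (\<gamma> e) \<longleftrightarrow> v \<in> e" if "e \<in> A" for e
  proof -
    have e: "e \<in> E" using that assms by blast
    have "\<phi> v \<in> path_image (\<gamma> e) \<longleftrightarrow> \<phi> v \<in> \<phi> ` e"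
      using edge_arc(3)[OF e] assms(2) by blast
    then show ?thesis using inj_\<phi> edge_subset[OF e] assms(2) by (auto dest: inj_onD)
  qed
  then show ?thesis by (auto simp: drawing_def)
qed

text \<open>Edges are sets, so \<open>\<gamma>\<close> may draw one in either direction; reversal
  supplies the direction needed for joining arcs along a walk.\<close>

lemma edge_arc_oriented:
  assumes "{x, y} \<in> E"
  obtains c where "arc c" "pathstart c = \<phi> x" "pathfinish c = \<phi> y" "path_image c = path_image (\<gamma> {x, y})"
proof (cases "pathstart (\<gamma> {x, y}) = \<phi> x")
  case True
  have "\<phi> x \<noteq> \<phi> y" using adjD[of x y] assms inj_\<phi> by (auto simp: adj_def dest: inj_onD)
  then have "pathfinish (\<gamma> {x, y}) = \<phi> y"
    using edge_arc(2)[OF assms] True by (auto simp: doubleton_eq_iff)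
  then show ?thesis using that edge_arc(1)[OF assms] True by blast
next
  case False
  then have "pathstart (\<gamma> {x, y}) = \<phi> y" "pathfinish (\<gamma> {x, y}) = \<phi> x"
    using edge_arc(2)[OF assms] by (auto simp: doubleton_eq_iff)
  then show ?thesis
    using that[of "reversepath (\<gamma> {x, y})"] edge_arc(1)[OF assms] by (simp add: arc_reversepath)
qed

lemma walk_arc:
  assumes "distinct xs" "length xs \<ge> 2" "successively adj xs"
  shows "\<exists>c. arc c \<and> pathstart c = \<phi> (hd xs) \<and> pathfinish c = \<phi> (last xs) \<and>
    path_image c = drawing (walk_edges xs)"
  using assms
proof (induction xs rule: walk_edges.induct)
  case (1 x y xs)
  have xy: "{x, y} \<in> E" using 1 by (simp add: adj_def)
  obtain c where c: "arc c" "pathstart c = \<phi> x" "pathfinish c = \<phi> y"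
    "path_image c = path_image (\<gamma> {x, y})"
    using edge_arc_oriented[OF xy] .
  show ?case
  proof (cases "xs = []")
    case True
    then show ?thesis using c by (auto simp: drawing_def)
  next
    case False
    then have len: "length (y # xs) \<ge> 2" by (cases xs) auto
    obtain d where d: "arc d" "pathstart d = \<phi> y" "pathfinish d = \<phi> (last (y # xs))"
      "path_image d = drawing (walk_edges (y # xs))"
      using 1 len by auto
    have un: "\<Union> (walk_edges (y # xs)) = set (y # xs)" using Union_walk_edges[OF len] .
    have "{x, y} \<notin> walk_edges (y # xs)" using un 1 by auto
    moreover have "walk_edges (y # xs) \<subseteq> E"
      using 1 by (simp add: walk_edges_subset)
    ultimately have "drawing {{x, y}} \<inter> drawing (walk_edges (y # xs)) \<subseteq> 
        \<phi> ` ({x, y} \<inter> set (y # xs))"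
      using drawings_meet[of "{{x, y}}" "walk_edges (y # xs)"] xy un by simp
    also have "\<dots> \<subseteq> {\<phi> y}" using 1 by auto
    finally have "path_image c \<inter> path_image d \<subseteq> {pathstart d}"
      using c d by (simp add: drawing_def)
    then have "arc (c +++ d)" using c d by (intro arc_join) auto
    moreover have "path_image (c +++ d) = drawing (walk_edges (x # y # xs))"
      using c d by (simp add: path_image_join drawing_def)
    ultimately show ?thesis using c d False by (intro exI[of _ "c +++ d"]) auto
  qed
qed auto

text \<open>A common edge has both ends in \<open>{a, b}\<close>, the only vertices shared by the
  two sides, so it is the edge \<open>ab\<close>; but a subdivided side does not contain that
  edge.\<close>

lemma side_walks_disjoint:
  assumes "distinct (a # b # P @ Q)" "P \<noteq> []" "successively adj (a # P @ [b])"
  shows "walk_edges (a # P @ [b]) \<inter> walk_edges (a # Q @ [b]) = {}"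
proof (rule ccontr)
  assume "\<not> ?thesis"
  then obtain e where e: "e \<in> walk_edges (a # P @ [b])" "e \<in> walk_edges (a # Q @ [b])" by blast
  have "e \<in> E" using e assms(3) walk_edges_subset[of "a # P @ [b]"] by blast
  then obtain x y where xy: "e = {x, y}" "x \<noteq> y" by (elim edgeE)
  have "e \<subseteq> set (a # P @ [b])" "e \<subseteq> set (a # Q @ [b])"
    using e Union_walk_edges[of "a # P @ [b]"] Union_walk_edges[of "a # Q @ [b]"] by auto
  then have "e \<subseteq> {a, b}" using assms(1) by auto
  then have "e = {a, b}" using xy by auto
  then show False using e ends_notin_walk_edges[of a b P] assms by auto
qed

lemma side_walks_meet:
  assumes "distinct (a # b # P @ Q)" "P \<noteq> []" "successively adj (a # P @ [b])" 
    "successively adj (a # Q @ [b])"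
  shows "side a b P \<inter> side a b Q \<subseteq> {\<phi> a, \<phi> b}"
proof -
  have "side a b P \<inter> side a b Q \<subseteq> \<phi> ` (\<Union>(walk_edges (a # P @ [b])) \<inter> \<Union>(walk_edges (a # Q @ [b])))"
    using assms by (intro drawings_meet side_walks_disjoint) (auto simp: walk_edges_subset)
  also have "\<dots> = \<phi> ` (set (a # P @ [b]) \<inter> set (a # Q @ [b]))"
    using Union_walk_edges[of "a # P @ [b]"] Union_walk_edges[of "a # Q @ [b]"] by simp
  also have "\<dots> \<subseteq> {\<phi> a, \<phi> b}" using assms(1) by auto
  finally show ?thesis .
qed

lemma theta_vertices:
  assumes "theta adj a b P Q R"
  shows "set (a # b # P @ Q @ R) \<subseteq> V"
proof -
  have "set (a # X @ [b]) \<subseteq> V" if "successively adj (a # X @ [b])" for X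
  proof -
    have "\<Union>(walk_edges (a # X @ [b])) \<subseteq> V" 
      using that walk_edges_subset[of "a # X @ [b]"] edge_subset by blast
    then show ?thesis using Union_walk_edges[of "a # X @ [b]"] by simp
  qed
  then show ?thesis using assms by (auto simp: theta_def)
qed

text \<open>\<open>R\<close> may be empty, which lets an edge \<open>ab\<close> serve as the third
  arc. A second empty side would give the same arc twice.\<close>

lemma theta_to_arcs:
  assumes th: "theta adj a b P Q R" and ne: "P \<noteq> []" "Q \<noteq> []"
  obtains c1 c2 c3 where "theta_arcs (\<phi> a) (\<phi> b) c1 c2 c3" "path_image c1 = side a b P"
    "path_image c2 = side a b Q" "path_image c3 = side a b R"
proof -
  have *: "\<exists>c. arc c \<and> pathstart c = \<phi> a \<and> pathfinish c = \<phi> b \<and> path_image c = side a b X"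
    if "X \<in> {P, Q, R}" for X
    using walk_arc[of "a # X @ [b]"] th that by (auto simp: theta_def)
  obtain c1 c2 c3 where c:
    "arc c1 \<and> pathstart c1 = \<phi> a \<and> pathfinish c1 = \<phi> b \<and> path_image c1 = side a b P"
    "arc c2 \<and> pathstart c2 = \<phi> a \<and> pathfinish c2 = \<phi> b \<and> path_image c2 = side a b Q"
    "arc c3 \<and> pathstart c3 = \<phi> a \<and> pathfinish c3 = \<phi> b \<and> path_image c3 = side a b R"
    using *[of P] *[of Q] *[of R] by auto
  moreover have "side a b P \<inter> side a b Q \<subseteq> {\<phi> a, \<phi> b}" "side a b P \<inter> side a b R \<subseteq> {\<phi> a, \<phi> b}"
    "side a b Q \<inter> side a b R \<subseteq> {\<phi> a, \<phi> b}"
    using th ne side_walks_meet[of a b P Q] side_walks_meet[of a b P R] side_walks_meet[of a b Q R]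
    unfolding theta_def by (simp_all add: Int_Un_distrib)
  ultimately have "theta_arcs (\<phi> a) (\<phi> b) c1 c2 c3" by (simp add: theta_arcs_def)
  then show ?thesis using that c by blast
qed

text \<open>The sides \<open>P\<close> and \<open>Q\<close> form a cycle, of length at least 3
  because \<open>P\<close> is nonempty. A vertex off the cycle is also off its image, hence inside
  or outside, and the drawing puts all such vertices on the same side.\<close>

lemma not_separated:
  assumes th: "theta adj a b P Q R" and ne: "P \<noteq> []"
    and u: "u \<in> V - set (a # b # P @ Q)" and v: "v \<in> V - set (a # b # P @ Q)"
  shows "\<not> separated_by (side a b P \<union> side a b Q) (\<phi> u) (\<phi> v)"
proof -
  let ?p = "a # P @ b # rev Q"
  let ?S = "walk_edges (a # P @ [b]) \<union> walk_edges (a # Q @ [b])"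
  have sub: "?S \<subseteq> E"
    using th by (auto simp: theta_def walk_edges_subset simp del: walk_edges.simps)
  have im: "cycle_image \<gamma> ?p = drawing ?S"
    unfolding cycle_image_def cycle_edges_two_walks drawing_def ..
  have "length ?p \<ge> 3" using ne by (cases P) auto
  moreover have "distinct ?p" using th by (auto simp: theta_def)
  moreover have "set ?p \<subseteq> V" using theta_vertices[OF th] by auto
  ultimately have "is_cycle (V, E) ?p"
    using sub by (simp add: is_cycle_def cycle_edges_two_walks)
  then have ns: "\<not> cycle_separates (V, E) \<phi> \<gamma> ?p" by (rule nonsep)
  have "\<Union>?S = set (a # b # P @ Q)"
    using Union_walk_edges[of "a # P @ [b]"] Union_walk_edges[of "a # Q @ [b]"] by auto
  then have off: "\<phi> x \<notin> drawing ?S" if "x \<in> V - set (a # b # P @ Q)" for x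
    using vertex_in_drawing[OF sub, of x] that by simp
  have uv: "u \<in> V - set ?p" "v \<in> V - set ?p" using u v by auto
  have "\<phi> x \<in> inside (drawing ?S) \<or> \<phi> x \<in> outside (drawing ?S)" if "x \<in> V - set (a # b # P @ Q)" for x
    using off[OF that] inside_Un_outside[of "drawing ?S"] by blast
  then show ?thesis
    using ns uv u v unfolding cycle_separates_def im separated_by_def drawing_Un[symmetric] fst_conv
    by blast
qed

lemma interior_vertex:
  assumes th: "theta adj a b P Q R" and p: "p \<in> set P"
  shows "\<phi> p \<in> side a b P - {\<phi> a, \<phi> b}"
proof -
  have V: "p \<in> V" "a \<in> V" "b \<in> V" and ne: "p \<noteq> a" "p \<noteq> b"
    using theta_vertices[OF th] p th by (auto simp: theta_def)
  have "p \<in> \<Union>(walk_edges (a # P @ [b]))" using Union_walk_edges[of "a # P @ [b]"] p by simp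
  then have "\<phi> p \<in> side a b P"
    using vertex_in_drawing[of "walk_edges (a # P @ [b])" p] V th
    by (auto simp: theta_def walk_edges_subset simp del: walk_edges.simps)
  then show ?thesis using V ne inj_\<phi> by (auto dest: inj_onD)
qed

lemma exterior_vertex:
  assumes th: "theta adj a b P Q R" and w: "w \<in> V - set (a # b # P @ Q @ R)"
  shows "\<phi> w \<notin> side a b P \<union> side a b Q \<union> side a b R"
proof -
  have "\<phi> w \<notin> side a b X" if "X \<in> {P, Q, R}" for X
  proof -
    have "w \<notin> \<Union>(walk_edges (a # X @ [b]))" 
      using Union_walk_edges[of "a # X @ [b]"] w that by auto
    then show ?thesis
      using vertex_in_drawing[of "walk_edges (a # X @ [b])" w] w that th
      by (auto simp: theta_def walk_edges_subset simp del: walk_edges.simps)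
  qed
  then show ?thesis by blast
qed

text \<open>Each cycle formed by two sides leaves a missing vertex \<open>w\<close> unseparated from
  the inner vertices of the third side. This contradicts \<open>theta_separation\<close>, by which
  exactly one of the three cycles separates.\<close>

lemma theta_spans:
  assumes th: "theta adj a b P Q R" and ne: "P \<noteq> []" "Q \<noteq> []" "R \<noteq> []"
  shows "set (a # b # P @ Q @ R) = V"
proof (rule ccontr)
  assume "\<not> ?thesis"
  then obtain w where w: "w \<in> V - set (a # b # P @ Q @ R)"
    using theta_vertices[OF th] by blast
  obtain c1 c2 c3 where c: "theta_arcs (\<phi> a) (\<phi> b) c1 c2 c3" "path_image c1 = side a b P"
    "path_image c2 = side a b Q" "path_image c3 = side a b R"
    using theta_to_arcs[OF th ne(1,2)] .
  have hds: "hd P \<in> set P" "hd Q \<in> set Q" "hd R \<in> set R" using ne by auto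
  note th' = theta_rotate[OF th] theta_rotate[OF theta_rotate[OF th]] theta_swap[OF theta_rotate[OF th]]
  have dist: "distinct (a # b # P @ Q @ R)" using th by (simp add: theta_def)
  have V: "set P \<subseteq> V" "set Q \<subseteq> V" "set R \<subseteq> V" using theta_vertices[OF th] by auto
  have "\<not> separated_by (side a b Q \<union> side a b R) (\<phi> (hd P)) (\<phi> w)"
    using hds w dist V by (intro not_separated[OF th'(1) ne(2)]) auto
  moreover have "\<not> separated_by (side a b P \<union> side a b R) (\<phi> (hd Q)) (\<phi> w)"
    using hds w dist V by (intro not_separated[OF theta_rotate[OF theta_swap[OF th]] ne(1)]) auto
  moreover have "\<not> separated_by (side a b P \<union> side a b Q) (\<phi> (hd R)) (\<phi> w)"
    using hds w dist V by (intro not_separated[OF th ne(1)]) auto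
  ultimately show False
    using theta_separation[OF c(1), of "\<phi> (hd P)" "\<phi> (hd Q)" "\<phi> (hd R)" "\<phi> w"]
      interior_vertex[OF th hds(1)] interior_vertex[OF th'(1) hds(2)] interior_vertex[OF th'(2) hds(3)]
      exterior_vertex[OF th w] c by auto
qed

lemma edge_midpoint:
  assumes "{x, y} \<in> E"
  obtains m where "m \<in> path_image (\<gamma> {x, y})" "m \<notin> \<phi> ` {x, y}"
proof -
  have "path_image (\<gamma> {x, y}) - {pathstart (\<gamma> {x, y}), pathfinish (\<gamma> {x, y})} \<noteq> {}"
    using nonempty_simple_path_endless[OF arc_imp_simple_path[OF edge_arc(1)[OF assms]]] .
  then show ?thesis using that edge_arc(2)[OF assms] by blast
qed

lemma midpoint_notin_drawing:
  assumes "e \<in> E" "m \<in> path_image (\<gamma> e)" "m \<notin> \<phi> ` e" "A \<subseteq> E" "e \<notin> A"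
  shows "m \<notin> drawing A"
  using drawings_meet[of "{e}" A] assms by (auto simp: drawing_def)

lemma side_Nil: "side a b [] = path_image (\<gamma> {a, b})"
  by (simp add: drawing_def)

text \<open>The two cycles through the edge \<open>ab\<close> do not separate \<open>w\<close> from
  the inner vertices of the remaining side, so by \<open>theta_separation\<close> the cycle of
  \<open>P\<close> and \<open>Q\<close> must separate \<open>w\<close> from the point
  \<open>m\<close> of the edge.\<close>

lemma midpoint_separated:
  assumes th: "theta adj a b P Q []" and ne: "P \<noteq> []" "Q \<noteq> []"
    and m: "m \<in> path_image (\<gamma> {a, b})" "m \<notin> \<phi> ` {a, b}"
    and w: "w \<in> V - set (a # b # P @ Q)"
  shows "separated_by (side a b P \<union> side a b Q) m (\<phi> w)"
proof -
  obtain c1 c2 c3 where c: "theta_arcs (\<phi> a) (\<phi> b) c1 c2 c3" "path_image c1 = side a b P"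
    "path_image c2 = side a b Q" "path_image c3 = side a b []"
    using theta_to_arcs[OF th ne(1,2)] .
  have hds: "hd P \<in> set P" "hd Q \<in> set Q" using ne by auto
  have dist: "distinct (a # b # P @ Q)" using th by (simp add: theta_def)
  have V: "set P \<subseteq> V" "set Q \<subseteq> V" using theta_vertices[OF th] by auto
  have "\<not> separated_by (side a b Q \<union> side a b []) (\<phi> (hd P)) (\<phi> w)"
    using hds w dist V by (intro not_separated[OF theta_rotate[OF th] ne(2)]) auto
  moreover have "\<not> separated_by (side a b P \<union> side a b []) (\<phi> (hd Q)) (\<phi> w)"
    using hds w dist V by (intro not_separated[OF theta_rotate[OF theta_swap[OF th]] ne(1)]) auto
  moreover have "m \<in> side a b [] - {\<phi> a, \<phi> b}" using m side_Nil[of a b] by blast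
  ultimately show ?thesis
    using theta_separation[OF c(1), of "\<phi> (hd P)" "\<phi> (hd Q)" m "\<phi> w"]
      interior_vertex[OF th hds(1)] interior_vertex[OF theta_swap[OF th] hds(2)] 
      exterior_vertex[OF th, of w] w c by auto
qed

text \<open>With the edge \<open>ab\<close>, any two sides form a theta with it, and
  \<open>midpoint_separated\<close> shows that the cycle of these two sides separates
  \<open>m\<close> from the third. So all three cycles separate, while
  \<open>theta_separation\<close> allows just one.\<close>

lemma theta_no_edge:
  assumes th: "theta adj a b P Q R" and ne: "P \<noteq> []" "Q \<noteq> []" "R \<noteq> []"
  shows "\<not> adj a b"
proof
  assume ab: "adj a b"
  then have abE: "{a, b} \<in> E" by (simp add: adj_def)
  obtain m where m: "m \<in> path_image (\<gamma> {a, b})" "m \<notin> \<phi> ` {a, b}"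
    using edge_midpoint[OF abE] .
  obtain c1 c2 c3 where c: "theta_arcs (\<phi> a) (\<phi> b) c1 c2 c3" "path_image c1 = side a b P"
    "path_image c2 = side a b Q" "path_image c3 = side a b R"
    using theta_to_arcs[OF th ne(1,2)] .
  have hds: "hd P \<in> set P" "hd Q \<in> set Q" "hd R \<in> set R" using ne by auto
  have dist: "distinct (a # b # P @ Q @ R)" using th by (simp add: theta_def)
  have V: "set P \<subseteq> V" "set Q \<subseteq> V" "set R \<subseteq> V" using theta_vertices[OF th] by auto
  have thN: "theta adj a b P Q []" "theta adj a b P R []" "theta adj a b Q R []"
    using th ab by (auto simp: theta_def)
  have "separated_by (side a b P \<union> side a b Q) m (\<phi> (hd R))"
    using hds dist V by (intro midpoint_separated[OF thN(1) ne(1,2) m]) auto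
  moreover have "separated_by (side a b P \<union> side a b R) m (\<phi> (hd Q))"
    using hds dist V by (intro midpoint_separated[OF thN(2) ne(1,3) m]) auto
  moreover have "separated_by (side a b Q \<union> side a b R) m (\<phi> (hd P))"
    using hds dist V by (intro midpoint_separated[OF thN(3) ne(2,3) m]) auto
  moreover have "m \<notin> side a b X" if "X \<in> {P, Q, R}" for X
    using that ends_notin_walk_edges[of a b X] dist ne th
    by (intro midpoint_notin_drawing[OF abE m])
      (auto simp: walk_edges_subset theta_def simp del: walk_edges.simps)
  ultimately show False
    using theta_separation[OF c(1), of "\<phi> (hd P)" "\<phi> (hd Q)" "\<phi> (hd R)" m]
      interior_vertex[OF th hds(1)] interior_vertex[OF theta_rotate[OF th] hds(2)]
      interior_vertex[OF theta_rotate[OF theta_rotate[OF th]] hds(3)] c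
    by (auto simp: separated_by_def)
qed

text \<open>The arc of the edge without its far end is connected and avoids the drawing of
  \<open>A\<close>. The far end \<open>y\<close> may lie on \<open>A\<close>; for this reason it is
  removed.\<close>

lemma not_separated_along_edge:
  assumes "{x, y} \<in> E" "m \<in> path_image (\<gamma> {x, y})" "m \<notin> \<phi> ` {x, y}" "A \<subseteq> E" "x \<notin> \<Union>A"
  shows "\<not> separated_by (drawing A) (\<phi> x) m"
proof -
  obtain c where c: "arc c" "pathstart c = \<phi> y" "pathfinish c = \<phi> x" "path_image c = path_image (\<gamma> {x, y})"
    using edge_arc_oriented[of y x] assms(1) by (metis insert_commute)
  let ?S = "path_image c - {\<phi> y}"
  have xy: "x \<in> V" "y \<in> V" "x \<noteq> y" using adjD[of x y] assms(1) by (auto simp: adj_def)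
  have "connected ?S" using connected_arc_minus_start[OF c(1)] c(2) by simp
  moreover have "?S \<inter> drawing A = {}"
  proof -
    have "{x, y} \<notin> A" using assms by auto
    then have "path_image c \<inter> drawing A \<subseteq> \<phi> ` ({x, y} \<inter> \<Union>A)"
      using drawings_meet[of "{{x, y}}" A] assms c by (simp add: drawing_def)
    then show ?thesis using assms(5) by auto
  qed
  moreover have "\<phi> x \<in> ?S"
    using pathfinish_in_path_image[of c] c xy inj_\<phi> by (auto dest: inj_onD)
  moreover have "m \<in> ?S" using assms c by auto
  ultimately have "\<phi> x \<in> inside (drawing A) \<longleftrightarrow> m \<in> inside (drawing A)"
    by (rule inside_iff_connected)
  then show ?thesis by (simp add: separated_by_def)
qed

text \<open>The edges \<open>pq\<close> and \<open>rs\<close> are the two diagonals of the 4-cycle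
  \<open>p r q s\<close>. A further vertex \<open>w\<close> forces both to lie on the side of that
  cycle away from \<open>w\<close>. But two diagonals cannot share a side: in the theta with sides
  through \<open>r\<close>, through \<open>s\<close> and along \<open>pq\<close>, the point
  \<open>n\<close> of \<open>rs\<close> is not separated from \<open>r\<close> or \<open>s\<close>,
  being joined to them along \<open>rs\<close>, so it would have to be separated from
  \<open>m\<close>.\<close>

lemma no_K4:
  assumes adj: "adj p q" "adj p r" "adj p s" "adj q r" "adj q s" "adj r s"
    and w: "w \<in> V - {p, q, r, s}"
  shows False
proof -
  have ne: "distinct [p, q, r, s]" using adj[THEN adjD] by auto
  have V: "p \<in> V" "q \<in> V" "r \<in> V" "s \<in> V" using adj[THEN adjD] by auto
  have E: "{p, q} \<in> E" "{r, s} \<in> E" "{s, r} \<in> E" using adj by (auto simp: adj_def insert_commute)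
  have th1: "theta adj p q [r] [s] []" and th2: "theta adj r s [p] [q] []"
    using adj ne by (auto simp: theta_def adj_sym)
  obtain m where m: "m \<in> path_image (\<gamma> {p, q})" "m \<notin> \<phi> ` {p, q}" using edge_midpoint[OF E(1)] .
  obtain n where n: "n \<in> path_image (\<gamma> {r, s})" "n \<notin> \<phi> ` {r, s}" using edge_midpoint[OF E(2)] .
  have n': "n \<in> path_image (\<gamma> {s, r})" "n \<notin> \<phi> ` {s, r}" using n by (simp_all add: insert_commute)
  \<comment> \<open>Both thetas have the same 4-cycle, so the two separations from \<open>w\<close>
    can be compared.\<close>
  have C: "side r s [p] \<union> side r s [q] = side p q [r] \<union> side p q [s]"
    by (auto simp: drawing_def insert_commute)
  have "separated_by (side p q [r] \<union> side p q [s]) m (\<phi> w)"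
    using midpoint_separated[OF th1 _ _ m, of w] w by auto
  moreover have "separated_by (side p q [r] \<union> side p q [s]) n (\<phi> w)"
    using midpoint_separated[OF th2 _ _ n, of w] w C by auto
  ultimately have no3: "\<not> separated_by (side p q [r] \<union> side p q [s]) m n"
    by (auto simp: separated_by_def)
  have eqs: "side p q [s] \<union> side p q [] = drawing {{p, s}, {s, q}, {p, q}}"
    "side p q [r] \<union> side p q [] = drawing {{p, r}, {r, q}, {p, q}}"
    by (auto simp: drawing_def)
  have no1: "\<not> separated_by (side p q [s] \<union> side p q []) (\<phi> r) n"
    unfolding eqs using adj ne by (intro not_separated_along_edge[OF E(2) n]) (auto simp: adj_def insert_commute)
  have no2: "\<not> separated_by (side p q [r] \<union> side p q []) (\<phi> s) n"
    unfolding eqs using adj ne by (intro not_separated_along_edge[OF E(3) n']) (auto simp: adj_def insert_commute)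
  obtain c1 c2 c3 where c: "theta_arcs (\<phi> p) (\<phi> q) c1 c2 c3" "path_image c1 = side p q [r]"
    "path_image c2 = side p q [s]" "path_image c3 = side p q []"
    using theta_to_arcs[OF th1] by auto
  have "n \<notin> drawing ({{p, r}, {r, q}} \<union> {{p, s}, {s, q}} \<union> {{p, q}})"
    using adj ne by (intro midpoint_notin_drawing[OF E(2) n]) (auto simp: adj_def insert_commute doubleton_eq_iff)
  then have "n \<notin> side p q [r] \<union> side p q [s] \<union> side p q []"
    by (simp add: drawing_def)
  moreover have "m \<in> side p q [] - {\<phi> p, \<phi> q}" using m side_Nil[of p q] by blast
  ultimately show False
    using theta_separation[OF c(1), of "\<phi> r" "\<phi> s" m n] c no1 no2 no3
      interior_vertex[OF th1, of r] interior_vertex[OF theta_swap[OF th1], of s] 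
    by auto
qed

end

section \<open>Clique models in the complement\<close>

text \<open>Independence is stronger than connectedness in the complement: any two vertices of a bag
  are joined there, so a bag can be contracted in any order. The bags need not cover
  \<open>V\<close>.\<close>

definition clique_model :: "('a \<Rightarrow> 'a \<Rightarrow> bool) \<Rightarrow> 'a set \<Rightarrow> 'a set set \<Rightarrow> bool" where
  "clique_model E V B \<longleftrightarrow>
     (\<forall>X\<in>B. X \<noteq> {} \<and> X \<subseteq> V \<and> (\<forall>x\<in>X. \<forall>y\<in>X. \<not> E x y)) \<and>
     (\<forall>X\<in>B. \<forall>Y\<in>B. X \<noteq> Y \<longrightarrow> X \<inter> Y = {} \<and> (\<exists>x\<in>X. \<exists>y\<in>Y. \<not> E x y))"

lemma clique_model_mono: "clique_model E V B \<Longrightarrow> V \<subseteq> W \<Longrightarrow> clique_model E W B"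
  unfolding clique_model_def by blast

lemma clique_model_image:
  assumes "clique_model (\<lambda>x y. E (f x) (f y)) W B" "inj_on f W"
  shows "clique_model E (f ` W) ((`) f ` B)" "card ((`) f ` B) = card B"
proof -
  have sub: "X \<subseteq> W" if "X \<in> B" for X using assms(1) that by (auto simp: clique_model_def)
  have "f ` X \<inter> f ` Y = f ` (X \<inter> Y)" if "X \<in> B" "Y \<in> B" for X Y
    using assms(2) sub[OF that(1)] sub[OF that(2)] by (simp add: inj_on_image_Int)
  then show "clique_model E (f ` W) ((`) f ` B)"
    using assms(1) unfolding clique_model_def by (simp add: image_mono) blast
  show "card ((`) f ` B) = card B"
    using sub by (intro card_image inj_on_subset[OF inj_on_image_Pow[OF assms(2)]]) auto
qed

lemma clique_model_insert_pair:
  assumes "clique_model E (V - {a, b}) B" "a \<in> V" "b \<in> V" "symp E" "irreflp E" "\<not> E a b"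
    and far: "\<And>z. z \<in> V \<Longrightarrow> \<not> (E a z \<and> E b z)" and fin: "finite B"
  shows "clique_model E V (insert {a, b} B)" "card (insert {a, b} B) = Suc (card B)"
proof -
  have sym: "E x y \<longleftrightarrow> E y x" and irr: "\<not> E x x" for x y
    using assms(4,5) by (auto dest: sympD irreflpD)
  have *: "\<exists>x\<in>{a, b}. \<exists>y\<in>X. \<not> E x y" "\<exists>y\<in>X. \<exists>x\<in>{a, b}. \<not> E y x" if X: "X \<in> B" for X
  proof -
    have "X \<noteq> {}" "X \<subseteq> V - {a, b}" using assms(1) X by (simp_all add: clique_model_def)
    then obtain y where "y \<in> X" "y \<in> V" by blast
    then show "\<exists>x\<in>{a, b}. \<exists>y\<in>X. \<not> E x y" "\<exists>y\<in>X. \<exists>x\<in>{a, b}. \<not> E y x"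
      using far[of y] sym by blast+
  qed
  have disj: "{a, b} \<inter> X = {}" "X \<inter> {a, b} = {}" if "X \<in> B" for X
    using assms(1) that by (auto simp: clique_model_def)
  have "{a, b} \<noteq> {} \<and> {a, b} \<subseteq> V \<and> (\<forall>x\<in>{a, b}. \<forall>y\<in>{a, b}. \<not> E x y)"
    using assms(2,3,6) sym irr by auto
  moreover have "X \<noteq> {} \<and> X \<subseteq> V \<and> (\<forall>x\<in>X. \<forall>y\<in>X. \<not> E x y)" if "X \<in> B" for X
    using assms(1) that unfolding clique_model_def by (metis Diff_subset order_trans)
  moreover have "X \<inter> Y = {} \<and> (\<exists>x\<in>X. \<exists>y\<in>Y. \<not> E x y)"
    if XY: "X \<in> insert {a, b} B" "Y \<in> insert {a, b} B" "X \<noteq> Y" for X Y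
  proof -
    consider "X = {a, b}" "Y \<in> B" | "X \<in> B" "Y = {a, b}" | "X \<in> B" "Y \<in> B" using XY by blast
    then show ?thesis
    proof cases
      case 1
      then show ?thesis using *(1)[of Y] disj(1)[of Y] by simp
    next
      case 2
      then show ?thesis using *(2)[of X] disj(2)[of X] sym by simp
    next
      case 3
      then show ?thesis using assms(1) XY(3) by (simp add: clique_model_def)
    qed
  qed
  ultimately show "clique_model E V (insert {a, b} B)"
    unfolding clique_model_def by (metis insert_iff)
  have "{a, b} \<notin> B" using disj by blast
  then show "card (insert {a, b} B) = Suc (card B)" using fin by simp
qed

definition path_like :: "('a \<Rightarrow> 'a \<Rightarrow> bool) \<Rightarrow> 'a list \<Rightarrow> bool" where
  "path_like E vs \<longleftrightarrow> distinct vs \<and> (\<forall>j<length vs. \<forall>i. Suc i < j \<longrightarrow> \<not> E (vs ! i) (vs ! j))"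

text \<open>An executable form of \<open>clique_model\<close> on numbers. It asks for
  \<open>E\<close> only at increasing pairs, so that bounds known for \<open>x < y\<close> suffice
  to evaluate it, by \<open>simp\<close> or by the code equations.\<close>

definition bags_ok :: "(nat \<Rightarrow> nat \<Rightarrow> bool) \<Rightarrow> nat list list \<Rightarrow> bool" where
  "bags_ok E bs \<longleftrightarrow> distinct (concat bs) \<and>
     (\<forall>X\<in>set bs. X \<noteq> [] \<and> (\<forall>x\<in>set X. \<forall>y\<in>set X. x < y \<longrightarrow> \<not> E x y)) \<and>
     sorted_wrt (\<lambda>X Y. \<exists>x\<in>set X. \<exists>y\<in>set Y. \<not> (if x < y then E x y else E y x)) bs"

lemma clique_model_bags:
  assumes "bags_ok E bs" "symp E" "irreflp E"
  shows "clique_model E (set (concat bs)) (set ` set bs)" "card (set ` set bs) = length bs"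
proof -
  have sym: "E x y \<longleftrightarrow> E y x" and irr: "\<not> E x x" for x y
    using assms(2,3) by (auto dest: sympD irreflpD)
  have dc: "distinct (concat bs)" and ne: "[] \<notin> set bs" using assms(1) by (auto simp: bags_ok_def)
  have disj: "set X \<inter> set Y = {}" if "X \<in> set bs" "Y \<in> set bs" "X \<noteq> Y" for X Y
    using dc that by (auto simp: distinct_concat_iff)
  have "distinct bs" using dc ne by (simp add: distinct_concat_iff removeAll_id)
  have "inj_on set (set bs)"
  proof (rule inj_onI)
    fix X Y assume XY: "X \<in> set bs" "Y \<in> set bs" "set X = set Y"
    then show "X = Y" using disj[OF XY(1,2)] ne by (cases "X = Y") auto
  qed
  then show "card (set ` set bs) = length bs"
    using \<open>distinct bs\<close> by (simp add: card_image distinct_card)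
  have indep: "\<not> E x y" if "X \<in> set bs" "x \<in> set X" "y \<in> set X" for X x y
  proof -
    have "x < y \<longrightarrow> \<not> E x y" "y < x \<longrightarrow> \<not> E y x" using assms(1) that by (auto simp: bags_ok_def)
    then show ?thesis using sym irr by (cases x y rule: linorder_cases) auto
  qed
  have "\<exists>x\<in>set X. \<exists>y\<in>set Y. \<not> E x y" if XY: "X \<in> set bs" "Y \<in> set bs" "X \<noteq> Y" for X Y
  proof -
    have "sorted_wrt (\<lambda>X Y. \<exists>x\<in>set X. \<exists>y\<in>set Y. \<not> E x y) bs"
    proof (rule sorted_wrt_mono_rel)
      show "sorted_wrt (\<lambda>X Y. \<exists>x\<in>set X. \<exists>y\<in>set Y. \<not> (if x < y then E x y else E y x)) bs"
        using assms(1) by (simp add: bags_ok_def)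
    qed (use sym in \<open>auto split: if_splits\<close>)
    moreover obtain i j where "i < length bs" "j < length bs" "X = bs ! i" "Y = bs ! j"
      using XY(1,2) by (auto simp: in_set_conv_nth)
    ultimately show ?thesis
      using XY(3) sym unfolding sorted_wrt_iff_nth_less
      by (metis linorder_neqE_nat)
  qed
  then have "set X \<inter> set Y = {} \<and> (\<exists>x\<in>set X. \<exists>y\<in>set Y. \<not> E x y)"
    if "X \<in> set bs" "Y \<in> set bs" "set X \<noteq> set Y" for X Y
    using that disj[of X Y] by (cases "X = Y") auto
  then show "clique_model E (set (concat bs)) (set ` set bs)"
    unfolding clique_model_def using ne indep by auto
qed

text \<open>The two ends of a long path are nonadjacent and have no common neighbour, so each step
  of the induction peels them off as one more bag.\<close>

lemma path_like_model:
  assumes "n \<ge> 7" "length vs = 2 * n - 5" "path_like E vs" "symp E" "irreflp E"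
  shows "\<exists>B. card B = n \<and> clique_model E (set vs) B"
  using assms(1-3)
proof (induction n arbitrary: vs rule: nat_induct_at_least)
  case base
  \<comment> \<open>The even positions are pairwise nonconsecutive. The odd ones are paired at
    distance 4, so that no position is next to both members of a pair.\<close>
  let ?bs = "[[0],[2],[4],[6],[8],[1,5],[3,7::nat]]"
  let ?E = "\<lambda>i j. E (vs ! i) (vs ! j)"
  have ne: "\<not> E (vs ! i) (vs ! j)" if "Suc i < j" "j < 9" for i j
    using base that by (auto simp: path_like_def)
  have ok: "bags_ok ?E ?bs"
    unfolding bags_ok_def by (simp add: ne)
  have se: "symp ?E" "irreflp ?E" using assms(4,5) by (auto simp: symp_def irreflp_def)
  have "clique_model ?E {..<9} (set ` set ?bs)" 
    by (rule clique_model_mono[OF clique_model_bags(1)[OF ok se]]) auto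
  moreover have "inj_on ((!) vs) {..<9}"
    using base by (auto simp: path_like_def inj_on_def nth_eq_iff_index_eq)
  moreover have "(!) vs ` {..<9} = set vs" using base by (auto simp: set_conv_nth)
  ultimately show ?case
    using clique_model_image[of E "(!) vs" "{..<9}" "set ` set ?bs"] clique_model_bags(2)[OF ok se]
    by (intro exI[of _ "(`) ((!) vs) ` set ` set ?bs"]) simp
next
  case (Suc n)
  obtain x ws y where vs: "vs = x # ws @ [y]"
  proof -
    obtain x us where "vs = x # us" using Suc by (cases vs) auto
    moreover obtain ws y where "us = ws @ [y]" using Suc calculation by (cases us rule: rev_cases) auto
    ultimately show ?thesis using that by simp
  qed
  have sym: "E x y \<longleftrightarrow> E y x" and irr: "\<not> E x x" for x y
    using assms(4,5) by (auto dest: sympD irreflpD)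
  have len: "length ws = 2 * n - 5" "length ws \<ge> 9" using Suc vs by auto
  have ne: "\<not> E (vs ! i) (vs ! j)" if "Suc i < j" "j < length vs" for i j
    using Suc that by (auto simp: path_like_def)
  have "\<not> E (ws ! i) (ws ! j)" if "Suc i < j" "j < length ws" for i j
    using ne[of "Suc i" "Suc j"] that vs by (simp add: nth_append)
  then have "path_like E ws" using Suc.prems vs by (auto simp: path_like_def)
  then obtain B where B: "card B = n" "clique_model E (set ws) B" using Suc.IH len by blast
  have dist: "distinct vs" using Suc.prems by (simp add: path_like_def)
  have set: "set vs - {x, y} = set ws" using dist vs by auto
  have finB: "finite B" using B Suc by (metis card.infinite not_numeral_le_zero)
  have xn: "\<not> E x (vs ! j)" if "1 < j" "j < length vs" for j
    using ne[of 0 j] that vs by simp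
  have yn: "\<not> E y (vs ! i)" if "Suc i < Suc (length ws)" for i
    using ne[of i "Suc (length ws)"] that vs sym by (simp add: nth_append)
  have "\<not> (E x z \<and> E y z)" if z: "z \<in> set vs" for z
  proof -
    obtain j where j: "j < length vs" "z = vs ! j" using z by (auto simp: in_set_conv_nth)
    show ?thesis
    proof (cases "1 < j")
      case False
      then show ?thesis using yn[of j] j len by auto
    qed (use xn j in auto)
  qed
  moreover have "\<not> E x y" using xn[of "Suc (length ws)"] len vs by (simp add: nth_append)
  ultimately have "clique_model E (set vs) (insert {x, y} B)" "card (insert {x, y} B) = Suc n"
    using clique_model_insert_pair[of E "set vs" x y B] B set vs assms(4,5) finB by auto
  then show ?case by blast
qed

section \<open>Noncrossing chords of a polygon\<close>

definition noncrossing :: "nat \<Rightarrow> (nat \<Rightarrow> nat \<Rightarrow> bool) \<Rightarrow> bool" where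
  "noncrossing N E \<longleftrightarrow> (\<forall>d<N. \<forall>c<d. \<forall>b<c. \<forall>a<b. \<not> (E a c \<and> E b d))"

lemma noncrossingD: "noncrossing N E \<Longrightarrow> a < b \<Longrightarrow> b < c \<Longrightarrow> c < d \<Longrightarrow> d < N \<Longrightarrow> E a c \<Longrightarrow> E b d \<Longrightarrow> False"
  unfolding noncrossing_def by blast

lemma noncrossing_mono_image:
  assumes "noncrossing N E" "\<And>i j. i < j \<Longrightarrow> j < M \<Longrightarrow> f i < f j" "\<And>i. i < M \<Longrightarrow> f i < N"
  shows "noncrossing M (\<lambda>i j. E (f i) (f j))"
  using assms unfolding noncrossing_def by (meson order.strict_trans)

lemma noncrossing_rotate:
  assumes "noncrossing N E" "symp E"
  shows "noncrossing N (\<lambda>i j. E ((i + r) mod N) ((j + r) mod N))"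
proof (induction r)
  case 0
  have "i mod N = i" if "i < N" for i using that by simp
  then show ?case using assms(1) unfolding noncrossing_def by (metis add.right_neutral order.strict_trans)
next
  case (Suc r)
  define F where "F = (\<lambda>i j. E ((i + r) mod N) ((j + r) mod N))"
  have F: "noncrossing N F" "symp F" using Suc assms(2) by (auto simp: F_def symp_def)
  have shift: "E ((i + Suc r) mod N) ((j + Suc r) mod N) \<longleftrightarrow> F (Suc i mod N) (Suc j mod N)" for i j
    by (simp add: F_def mod_simps)
  show ?case unfolding noncrossing_def
  proof (intro allI impI notI)
    fix a b c d assume abcd: "d < N" "c < d" "b < c" "a < b"
      and "E ((a + Suc r) mod N) ((c + Suc r) mod N) \<and> E ((b + Suc r) mod N) ((d + Suc r) mod N)"
    then have "F (Suc a mod N) (Suc c mod N)" "F (Suc b mod N) (Suc d mod N)"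
      unfolding shift by blast+
    then have E: "F (Suc a) (Suc c)" "F (Suc b) (Suc d mod N)" using abcd by simp_all
    show False
    \<comment> \<open>Only the last point can wrap around. It then becomes 0 and moves to the front
      of the quadruple, and the two chords exchange their roles.\<close>
    proof (cases "Suc d = N")
      case True
      then have "F 0 (Suc b)" using E F(2) by (simp add: symp_def)
      then show False using noncrossingD[OF F(1), of 0 "Suc a" "Suc b" "Suc c"] abcd E True by simp
    next
      case False
      then show False using noncrossingD[OF F(1), of "Suc a" "Suc b" "Suc c" "Suc d"] abcd E by simp
    qed
  qed
qed

lemma inj_on_rotate: "inj_on (\<lambda>i. (i + r) mod N) {..<N::nat}"
proof -
  have "x = y" if "x \<le> y" "y < N" "(x + r) mod N = (y + r) mod N" for x y
  proof -
    have "N dvd (y + r) - (x + r)"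
      using that mod_eq_dvd_iff_nat[of "x + r" "y + r" N] by simp
    then show ?thesis using that by (auto dest: dvd_imp_le)
  qed
  then show ?thesis by (intro inj_onI) (metis lessThan_iff nat_le_linear)
qed

lemma image_rotate: "(\<lambda>i. (i + r) mod N) ` {..<N::nat} = {..<N}"
  by (intro endo_inj_surj inj_on_rotate) auto

text \<open>Take for \<open>k\<close> the last neighbour of \<open>i\<close> before
  \<open>j\<close>, or \<open>i + 1\<close> if there is none. An edge passing over \<open>k\<close>
  cannot start at \<open>i\<close> by maximality, unless it is \<open>ij\<close>, and otherwise it
  would cross the edge \<open>ik\<close>. Thus \<open>i\<close>, \<open>k\<close>, \<open>j\<close>
  can be completed to a triangle without crossings.\<close>

lemma noncrossing_split:
  assumes "noncrossing N E" "i + 1 < j" "j < N"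
  obtains k where "i < k" "k < j"
    "\<And>x y. i \<le> x \<Longrightarrow> x < y \<Longrightarrow> y \<le> j \<Longrightarrow> E x y \<Longrightarrow> y \<le> k \<or> k \<le> x \<or> (x = i \<and> y = j)"
proof -
  let ?K = "{k. i < k \<and> k < j \<and> (k = Suc i \<or> E i k)}"
  have fin: "finite ?K" by (rule finite_subset[of _ "{..<j}"]) auto
  have "Suc i \<in> ?K" using assms by auto
  define k where "k = Max ?K"
  have k: "i < k" "k < j" "k = Suc i \<or> E i k"
    using Max_in[OF fin] \<open>Suc i \<in> ?K\<close> unfolding k_def by blast+
  have kmax: "y \<le> k" if "i < y" "y < j" "E i y" for y
    unfolding k_def using fin that by (intro Max_ge) auto
  show ?thesis
  proof (rule that[OF k(1,2)])
    fix x y assume xy: "i \<le> x" "x < y" "y \<le> j" "E x y"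
    show "y \<le> k \<or> k \<le> x \<or> (x = i \<and> y = j)"
    proof (cases "x = i")
      case True
      then show ?thesis using kmax[of y] xy by auto
    next
      case False
      then show ?thesis using noncrossingD[OF assms(1), of i x k y] k xy assms(3) by force
    qed
  qed
qed

section \<open>Checkable case distinctions for eleven points\<close>

datatype certificate = Leaf "nat list list" | Split nat "certificate list"

text \<open>The densest relation a dissection permits. Bags that work for it work for every graph
  whose edges all lie in cells.\<close>

definition same_cell :: "nat list list \<Rightarrow> nat \<Rightarrow> nat \<Rightarrow> bool" where
  "same_cell cs x y \<longleftrightarrow> (\<exists>c\<in>set cs. x \<in> set c \<and> y \<in> set c)"

text \<open>The cells form a dissection of the polygon with vertices \<open>0, \<dots>, 10\<close>; every edge lies in a cell.
  \<open>Split p\<close> branches over the apex \<open>c ! k\<close> of a triangle on the side of the \<open>p\<close>-th cell \<open>c\<close> that joins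
  its first and last vertex.\<close>

function certifies :: "nat list list \<Rightarrow> certificate \<Rightarrow> bool" where
  "certifies cs (Leaf bs) \<longleftrightarrow> length bs = 7 \<and> list_all (list_all (\<lambda>x. x < 11)) bs \<and> bags_ok (same_cell cs) bs"
| "certifies cs (Split p ts) \<longleftrightarrow> p < length cs \<and>
     (let c = cs ! p; rest = take p cs @ drop (Suc p) cs in
       length c \<ge> 3 \<and> sorted_wrt (<) c \<and> list_all (\<lambda>x. x < 11) c \<and> length ts = length c - 2 \<and>
       list_all (\<lambda>(k, t). certifies ([take (Suc k) c, drop k c, [c ! 0, c ! k, last c]] @ rest) t)
         (zip [1..<length c - 1] ts))"
  by pat_completeness auto
termination
  by (relation "Wellfounded.measure (\<lambda>(cs, t). size t)")
    (auto dest!: set_zip_rightD simp: less_Suc_eq_le intro: size_list_estimation')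

text \<open>At a leaf, removing edges keeps the bags valid. At a split, the points of the cell form
  a polygon of their own, \<open>noncrossing_split\<close> yields an apex for its long side, and the
  certificate has a subtree for every possible apex.\<close>

lemma certifies_sound:
  assumes "certifies cs t" "noncrossing 11 E" "symp E" "irreflp E"
    and "\<And>x y. x < y \<Longrightarrow> y < 11 \<Longrightarrow> E x y \<Longrightarrow> same_cell cs x y"
  shows "\<exists>B. card B = 7 \<and> clique_model E {..<11} B"
  using assms(1,5)
proof (induction cs t rule: certifies.induct)
  case (1 cs bs)
  have lt: "x < 11" if "X \<in> set bs" "x \<in> set X" for X x
    using 1 that by (auto simp: list_all_iff)
  have ne: "\<not> E x y" if "\<not> same_cell cs x y" "x < y" "y < 11" for x y
    using 1 that by blast
  have sym: "E x y \<longleftrightarrow> E y x" and irr: "\<not> E x x" for x y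
    using assms(3,4) by (auto dest: sympD irreflpD)
  have cell_sym: "same_cell cs x y \<longleftrightarrow> same_cell cs y x" for x y
    by (auto simp: same_cell_def)
  have bs: "bags_ok (same_cell cs) bs" using 1 by simp
  have "\<not> E x y" if "x < 11" "y < 11" "\<not> same_cell cs x y" for x y
    using ne[of x y] ne[of y x] that cell_sym[of x y] sym[of x y] irr
    by (cases x y rule: linorder_cases) auto
  then have "sorted_wrt (\<lambda>X Y. \<exists>x\<in>set X. \<exists>y\<in>set Y. \<not> (if x < y then E x y else E y x)) bs"
    using bs cell_sym sym lt unfolding bags_ok_def
    by (elim conjE sorted_wrt_mono_rel[rotated]) (metis (full_types))
  then have "bags_ok E bs" using bs ne lt by (auto simp: bags_ok_def)
  from clique_model_bags[OF this assms(3,4)] show ?case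
    using 1 lt by (intro exI[of _ "set ` set bs"]) (auto elim!: clique_model_mono)
next
  case (2 cs p ts)
  define c where "c = cs ! p"
  define rest where "rest = take p cs @ drop (Suc p) cs"
  have c: "p < length cs" "length c \<ge> 3" "sorted_wrt (<) c" "length ts = length c - 2"
    and c_less: "\<And>x. x \<in> set c \<Longrightarrow> x < 11"
    and ch: "list_all (\<lambda>(k, t). certifies ([take (Suc k) c, drop k c, [c ! 0, c ! k, last c]] @ rest) t)
         (zip [1..<length c - 1] ts)"
    using 2(2) by (simp_all add: Let_def c_def rest_def list_all_iff)
  have "noncrossing (length c) (\<lambda>i j. E (c ! i) (c ! j))"
    using assms(2) by (rule noncrossing_mono_image) (use c c_less in \<open>auto simp: sorted_wrt_iff_nth_less\<close>)
  then obtain k where k: "0 < k" "k < length c - 1"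
    and split: "\<And>x y. x < y \<Longrightarrow> y \<le> length c - 1 \<Longrightarrow> E (c ! x) (c ! y) \<Longrightarrow>
      y \<le> k \<or> k \<le> x \<or> (x = 0 \<and> y = length c - 1)"
    by (rule noncrossing_split[of _ _ 0 "length c - 1"]) (use c(2) in auto)
  \<comment> \<open>The possible apices start at 1, so the subtree for apex \<open>k\<close> has
    index \<open>k - 1\<close>.\<close>
  let ?t = "ts ! (k - 1)" and ?cs = "[take (Suc k) c, drop k c, [c ! 0, c ! k, last c]] @ rest"
  have mem: "(k, ?t) \<in> set (zip [1..<length c - 1] ts)"
    using k c(4) by (auto simp: set_zip intro!: exI[of _ "k - 1"])
  then have cert: "certifies ?cs ?t" using ch by (auto simp: list_all_iff)
  have "cs = take p cs @ c # drop (Suc p) cs" using c(1) by (simp add: c_def id_take_nth_drop)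
  then have set_cs: "set cs = insert c (set rest)"
    by (metis rest_def set_append list.set(2) Un_insert_right)
  have "same_cell ?cs x y" if xy: "x < y" "y < 11" "E x y" for x y
  proof -
    obtain c' where c': "c' \<in> set cs" "x \<in> set c'" "y \<in> set c'"
      using 2(3)[OF xy] by (auto simp: same_cell_def)
    show ?thesis
    proof (cases "c' = c")
      case False
      then show ?thesis using c' set_cs by (auto simp: same_cell_def)
    next
      case True
      obtain i j where ij: "i < length c" "j < length c" "x = c ! i" "y = c ! j"
        using c' True by (auto simp: in_set_conv_nth)
      have "i < j" using ij xy(1) c(3) unfolding sorted_wrt_iff_nth_less
        by (metis linorder_neqE_nat order_less_asym)
      then consider "j \<le> k" | "k \<le> i" | "i = 0" "j = length c - 1"
        using split[of i j] ij xy(3) by fastforce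
      then show ?thesis
      proof cases
        case 1
        then have "x \<in> set (take (Suc k) c)" "y \<in> set (take (Suc k) c)"
          using nth_mem[of i "take (Suc k) c"] nth_mem[of j "take (Suc k) c"] ij \<open>i < j\<close> by auto
        then show ?thesis by (auto simp: same_cell_def)
      next
        case 2
        then have "x \<in> set (drop k c)" "y \<in> set (drop k c)"
          using nth_mem[of "i - k" "drop k c"] nth_mem[of "j - k" "drop k c"] ij \<open>i < j\<close> by auto
        then show ?thesis by (auto simp: same_cell_def)
      next
        case 3
        then have "x = c ! 0" "y = last c" using ij by (auto simp: last_conv_nth)
        then show ?thesis by (auto simp: same_cell_def)
      qed
    qed
  qed
  then show ?case using 2(1)[OF c_def rest_def mem refl cert] by blast
qed

text \<open>The third arc runs from \<open>a + b\<close> past 10 back to 0. Cells are sorted, so 0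
  comes first, and a split of this cell uses the polygon side from 0 to 10 instead of a side of the
  triangle. Each split puts its three new cells in front, which shifts the positions named by nested
  splits.\<close>

definition triangle_cells :: "nat \<Rightarrow> nat \<Rightarrow> nat list list" where
  "triangle_cells a b = [[0..<Suc a], [a..<Suc (a + b)], 0 # [a + b..<11], [0, a, a + b]]"

text \<open>Found by computer search; the entry for \<open>(a, b)\<close> treats the graphs with central triangle
  \<open>{0, a, a + b}\<close>.\<close>

definition certificates :: "((nat \<times> nat) \<times> certificate) list" where
  "certificates =
    [((1, 5), Split 1 [Split 4 [Split 1 [Leaf [[0],[3],[8],[1,4],[2,7],[5,10],[6,9]],
       Leaf [[1],[3],[7],[10],[0,4],[2,8],[5,9]], Leaf [[1],[3],[7],[10],[0,4],[2,8],[5,9]]],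
       Leaf [[0],[3],[8],[1,4],[2,7],[5,10],[6,9]], Leaf [[1],[3],[7],[10],[0,4],[2,8],[5,9]],
       Leaf [[1],[3],[7],[10],[0,4],[2,8],[5,9]]],
       Split 4 [Leaf [[0],[2],[4],[8],[1,9],[3,7],[5,10]],
       Leaf [[0],[2],[4],[8],[1,9],[3,7],[5,10]], Leaf [[1],[4],[7],[10],[0,5],[2,8],[3,9]],
       Leaf [[1],[4],[7],[10],[0,5],[2,8],[3,9]]],
       Split 4 [Leaf [[0],[2],[5],[8],[1,9],[3,7],[4,10]],
       Leaf [[0],[2],[5],[8],[1,9],[3,7],[4,10]], Leaf [[2],[5],[7],[9],[0,3],[1,8],[4,10]],
       Leaf [[2],[5],[7],[10],[0,3],[1,8],[4,9]]],
       Split 4 [Leaf [[0],[3],[7],[1,8],[2,9],[4,6],[5,10]],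
       Leaf [[0],[2],[8],[1,9],[3,6],[4,7],[5,10]], Leaf [[2],[7],[9],[0,3],[1,8],[4,6],[5,10]],
       Leaf [[2],[7],[10],[0,3],[1,8],[4,6],[5,9]]]]),
     ((2, 4), Split 2 [Split 1 [Leaf [[0],[3],[8],[1,4],[2,7],[5,10],[6,9]],
       Leaf [[1],[3],[7],[10],[0,4],[2,8],[5,9]], Leaf [[1],[3],[7],[10],[0,4],[2,8],[5,9]]],
       Leaf [[1],[3],[8],[0,4],[2,7],[5,9],[6,10]], Leaf [[1],[3],[7],[10],[0,4],[2,8],[5,9]],
       Leaf [[1],[3],[7],[10],[0,4],[2,8],[5,9]]]),
     ((2, 5), Split 1 [Split 1 [Leaf [[1],[3],[5],[8],[0,4],[2,9],[6,10]],
       Leaf [[1],[3],[6],[8],[0,4],[2,9],[5,10]], Leaf [[1],[4],[8],[0,3],[2,9],[5,7],[6,10]]],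
       Leaf [[1],[3],[6],[8],[0,4],[2,9],[5,10]], Leaf [[1],[3],[6],[8],[0,4],[2,9],[5,10]],
       Leaf [[1],[4],[8],[0,3],[2,9],[5,7],[6,10]]]),
     ((3, 3), Split 2 [Leaf [[1],[4],[7],[0,8],[2,6],[3,9],[5,10]],
       Leaf [[1],[4],[8],[0,5],[2,7],[3,9],[6,10]], Leaf [[1],[4],[7],[10],[0,5],[2,8],[3,9]],
       Leaf [[1],[4],[7],[10],[0,5],[2,8],[3,9]]]),
     ((3, 4), Leaf [[1],[4],[8],[0,5],[2,7],[3,9],[6,10]]),
     ((3, 5), Split 1 [Leaf [[1],[5],[9],[0,4],[2,8],[3,6],[7,10]],
       Leaf [[1],[4],[7],[10],[0,5],[2,8],[3,9]], Leaf [[1],[4],[7],[10],[0,5],[2,8],[3,9]],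
       Leaf [[1],[4],[9],[0,5],[2,7],[3,10],[6,8]]]),
     ((4, 2), Split 2 [Leaf [[1],[5],[8],[0,9],[2,6],[3,7],[4,10]],
       Leaf [[1],[5],[8],[0,9],[2,6],[3,7],[4,10]], Leaf [[1],[5],[7],[9],[2,6],[3,8],[4,10]],
       Leaf [[1],[5],[7],[10],[2,6],[3,8],[4,9]]]),
     ((4, 3), Leaf [[1],[5],[8],[0,6],[2,7],[3,9],[4,10]]),
     ((4, 4), Leaf [[1],[5],[9],[0,6],[2,7],[3,8],[4,10]]),
     ((4, 5), Split 1 [Leaf [[1],[6],[10],[0,5],[2,7],[3,9],[4,8]],
       Leaf [[1],[5],[8],[0,6],[2,7],[3,9],[4,10]], Leaf [[1],[5],[8],[0,6],[2,7],[3,9],[4,10]],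
       Split 0 [Leaf [[1],[6],[9],[0,5],[2,8],[3,10],[4,7]],
       Leaf [[1],[5],[8],[0,6],[2,7],[3,9],[4,10]],
       Leaf [[1],[5],[8],[0,6],[2,7],[3,9],[4,10]]]]),
     ((5, 1), Split 0 [Split 4 [Leaf [[0],[2],[7],[1,8],[3,6],[4,10],[5,9]],
       Leaf [[2],[6],[8],[0,3],[1,7],[4,9],[5,10]], Leaf [[2],[7],[10],[0,3],[1,8],[4,6],[5,9]],
       Leaf [[2],[7],[10],[0,3],[1,8],[4,6],[5,9]]],
       Split 4 [Leaf [[1],[4],[7],[0,8],[2,6],[3,9],[5,10]],
       Leaf [[1],[3],[6],[8],[0,9],[2,7],[4,10]], Leaf [[1],[4],[7],[10],[2,6],[3,8],[5,9]],
       Leaf [[1],[4],[7],[10],[2,6],[3,8],[5,9]]],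
       Split 4 [Leaf [[1],[4],[7],[0,8],[2,6],[3,9],[5,10]],
       Leaf [[1],[4],[6],[8],[0,9],[2,7],[3,10]], Leaf [[1],[4],[7],[10],[2,6],[3,8],[5,9]],
       Leaf [[1],[4],[7],[10],[2,6],[3,8],[5,9]]],
       Split 4 [Leaf [[1],[5],[8],[0,9],[2,6],[3,7],[4,10]],
       Leaf [[1],[5],[8],[0,9],[2,6],[3,7],[4,10]], Leaf [[1],[5],[7],[10],[2,6],[3,8],[4,9]],
       Leaf [[1],[5],[7],[10],[2,6],[3,8],[4,9]]]]),
     ((5, 2), Split 0 [Leaf [[2],[6],[8],[0,3],[1,7],[4,9],[5,10]],
       Leaf [[1],[3],[6],[8],[0,4],[2,9],[5,10]], Leaf [[1],[4],[6],[8],[2,7],[3,9],[5,10]],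
       Split 0 [Leaf [[2],[6],[8],[0,3],[1,7],[4,9],[5,10]],
       Leaf [[1],[4],[6],[8],[2,7],[3,9],[5,10]], Leaf [[1],[4],[6],[8],[2,7],[3,9],[5,10]]]]),
     ((5, 3), Split 0 [Leaf [[2],[7],[10],[0,3],[1,8],[4,6],[5,9]],
       Leaf [[1],[4],[7],[10],[2,6],[3,8],[5,9]], Leaf [[1],[4],[7],[10],[2,6],[3,8],[5,9]],
       Leaf [[1],[6],[9],[0,7],[2,5],[3,8],[4,10]]]),
     ((5, 4), Split 0 [Split 1 [Leaf [[1],[4],[7],[0,8],[2,6],[3,9],[5,10]],
       Leaf [[1],[4],[7],[0,8],[2,6],[3,9],[5,10]],
       Leaf [[0],[2],[6],[1,7],[3,5],[4,9],[8,10]]],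
       Leaf [[1],[4],[7],[0,8],[2,6],[3,9],[5,10]], Leaf [[1],[4],[7],[0,8],[2,6],[3,9],[5,10]],
       Leaf [[1],[6],[10],[0,7],[2,5],[3,8],[4,9]]]),
     ((5, 5), Split 0 [Split 3 [Leaf [[0],[2],[7],[1,8],[3,6],[4,10],[5,9]],
       Leaf [[0],[2],[6],[8],[1,7],[3,9],[4,10]], Leaf [[0],[2],[7],[1,8],[3,6],[4,10],[5,9]],
       Split 0 [Leaf [[0],[2],[7],[1,6],[3,9],[4,10],[5,8]],
       Leaf [[0],[2],[6],[8],[1,7],[3,9],[4,10]], Leaf [[0],[2],[6],[9],[1,7],[3,8],[4,10]]]],
       Split 3 [Leaf [[0],[3],[7],[1,6],[2,8],[4,10],[5,9]],
       Leaf [[1],[3],[6],[8],[0,9],[2,7],[4,10]], Leaf [[0],[3],[7],[1,6],[2,8],[4,10],[5,9]],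
       Leaf [[1],[3],[6],[10],[0,7],[2,8],[4,9]]],
       Split 3 [Leaf [[1],[4],[7],[0,6],[2,8],[3,10],[5,9]],
       Leaf [[1],[4],[6],[8],[0,9],[2,7],[3,10]], Leaf [[1],[4],[7],[0,6],[2,8],[3,10],[5,9]],
       Leaf [[1],[6],[10],[0,7],[2,5],[3,8],[4,9]]],
       Split 3 [Leaf [[1],[5],[7],[0,8],[2,6],[3,10],[4,9]],
       Leaf [[1],[6],[9],[0,7],[2,5],[3,8],[4,10]], Leaf [[1],[6],[9],[0,7],[2,5],[3,8],[4,10]],
       Leaf [[1],[6],[10],[0,7],[2,5],[3,8],[4,9]]]])]"

text \<open>The third arc has length \<open>11 - (a + b)\<close>, so the condition
  \<open>6 \<le> a + b\<close> bounds it by 5 as well. Fifteen pairs remain.\<close>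

lemma certificates_valid:
  "list_all (\<lambda>a. list_all (\<lambda>b. 6 \<le> a + b \<longrightarrow>
     (case map_of certificates (a, b) of None \<Rightarrow> False | Some t \<Rightarrow> certifies (triangle_cells a b) t))
     [1..<6]) [1..<6]"
  by code_simp

lemma exists_certificate:
  assumes "1 \<le> a" "a \<le> 5" "1 \<le> b" "b \<le> 5" "6 \<le> a + b"
  obtains t where "certifies (triangle_cells a b) t"
proof -
  have "case map_of certificates (a, b) of None \<Rightarrow> False | Some t \<Rightarrow> certifies (triangle_cells a b) t"
    using certificates_valid assms by (auto simp: list_all_iff)
  then show ?thesis using that by (auto split: option.splits)
qed

text \<open>Cross triangles towards an arc of length at least 6 as long as there is one. At a chord
  with \<open>i + 6 \<le> j\<close> the arc behind it has length \<open>11 - (j - i)\<close>, at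
  most 5, so the triangle at which the descent stops has three short arcs.\<close>

lemma central_triangle:
  assumes nc: "noncrossing 11 E"
  obtains i k j where "i < k" "k < j" "j < 11" "k \<le> i + 5" "j \<le> k + 5" "i + 6 \<le> j"
    "\<And>x y. x < y \<Longrightarrow> y < 11 \<Longrightarrow> E x y \<Longrightarrow>
       (i \<le> x \<and> y \<le> k) \<or> (k \<le> x \<and> y \<le> j) \<or> ((x \<le> i \<or> j \<le> x) \<and> (y \<le> i \<or> j \<le> y))"
proof -
  define P where "P i k j \<longleftrightarrow> i < k \<and> k < j \<and> j < 11 \<and> k \<le> i + 5 \<and> j \<le> k + 5 \<and> i + 6 \<le> j \<and>
    (\<forall>x y. x < y \<longrightarrow> y < 11 \<longrightarrow> E x y \<longrightarrow>
       (i \<le> x \<and> y \<le> k) \<or> (k \<le> x \<and> y \<le> j) \<or> ((x \<le> i \<or> j \<le> x) \<and> (y \<le> i \<or> j \<le> y)))" for i k j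
  have main: "\<exists>i k j. P i k j"
    if "i + 6 \<le> j" "j < 11"
      "\<forall>x y. x < y \<longrightarrow> y < 11 \<longrightarrow> E x y \<longrightarrow>
        (i \<le> x \<and> y \<le> j) \<or> ((x \<le> i \<or> j \<le> x) \<and> (y \<le> i \<or> j \<le> y))" for i j
    using that
  proof (induction "j - i" arbitrary: i j rule: less_induct)
    case less
    obtain k where k: "i < k" "k < j"
      and split: "\<And>x y. i \<le> x \<Longrightarrow> x < y \<Longrightarrow> y \<le> j \<Longrightarrow> E x y \<Longrightarrow> y \<le> k \<or> k \<le> x \<or> (x = i \<and> y = j)"
      using noncrossing_split[OF nc, of i j] less.prems by auto
    have cells: "(i \<le> x \<and> y \<le> k) \<or> (k \<le> x \<and> y \<le> j) \<or> ((x \<le> i \<or> j \<le> x) \<and> (y \<le> i \<or> j \<le> y))"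
      if "x < y" "y < 11" "E x y" for x y
    proof -
      consider "i \<le> x" "y \<le> j" | "(x \<le> i \<or> j \<le> x) \<and> (y \<le> i \<or> j \<le> y)"
        using less.prems(3) \<open>x < y\<close> \<open>y < 11\<close> \<open>E x y\<close> by blast
      then show ?thesis
      proof cases
        case 1
        then show ?thesis using split[of x y] that by auto
      qed simp
    qed
    consider "k \<le> i + 5" "j \<le> k + 5" | "i + 6 \<le> k" | "k + 6 \<le> j" by linarith
    then show ?case
    proof cases
      case 1
      then have "P i k j" using k less.prems cells unfolding P_def by blast
      then show ?thesis by blast
    next
      case 2
      show ?thesis
      proof (rule less.hyps[of k i])
        show "\<forall>x y. x < y \<longrightarrow> y < 11 \<longrightarrow> E x y \<longrightarrow>
          (i \<le> x \<and> y \<le> k) \<or> ((x \<le> i \<or> k \<le> x) \<and> (y \<le> i \<or> k \<le> y))"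
          using cells k by (meson le_trans less_imp_le)
      qed (use 2 k less.prems in auto)
    next
      case 3
      show ?thesis
      proof (rule less.hyps[of j k])
        show "\<forall>x y. x < y \<longrightarrow> y < 11 \<longrightarrow> E x y \<longrightarrow>
          (k \<le> x \<and> y \<le> j) \<or> ((x \<le> k \<or> j \<le> x) \<and> (y \<le> k \<or> j \<le> y))"
          using cells k by (meson le_trans less_imp_le)
      qed (use 3 k less.prems in auto)
    qed
  qed
  \<comment> \<open>The descent starts at the polygon side from 0 to 10, which has every point on
    its near side.\<close>
  have "\<exists>i k j. P i k j" by (rule main[of 0 10]) auto
  then show ?thesis using that unfolding P_def by blast
qed

lemma model_rotate:
  assumes "clique_model (\<lambda>i j. E ((i + r) mod N) ((j + r) mod N)) {..<N} B"
  shows "\<exists>B'. card B' = card B \<and> clique_model E {..<N::nat} B'"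
  using clique_model_image[OF assms inj_on_rotate] image_rotate[of r N] by metis

lemma noncrossing_model_11:
  assumes nc: "noncrossing 11 E" and E: "symp E" "irreflp E"
  shows "\<exists>B. card B = 7 \<and> clique_model E {..<11} B"
proof -
  obtain i k j where ikj: "i < k" "k < j" "j < 11" "k \<le> i + 5" "j \<le> k + 5" "i + 6 \<le> j"
    and cells: "\<And>x y. x < y \<Longrightarrow> y < 11 \<Longrightarrow> E x y \<Longrightarrow>
       (i \<le> x \<and> y \<le> k) \<or> (k \<le> x \<and> y \<le> j) \<or> ((x \<le> i \<or> j \<le> x) \<and> (y \<le> i \<or> j \<le> y))"
    using central_triangle[OF nc] by blast
  define a b where "a = k - i" and "b = j - k"
  have ab: "1 \<le> a" "a \<le> 5" "1 \<le> b" "b \<le> 5" "6 \<le> a + b" "k = i + a" "j = i + a + b"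
    using ikj by (auto simp: a_def b_def)
  obtain t where t: "certifies (triangle_cells a b) t" using exists_certificate ab by blast
  let ?E = "\<lambda>x y. E ((x + i) mod 11) ((y + i) mod 11)"
  have "same_cell (triangle_cells a b) x y" if xy: "x < y" "y < 11" "?E x y" for x y
  proof -
    have m: "(z + i) mod 11 = (if z + i < 11 then z + i else z + i - 11)" if "z < 11" for z
      using that ikj by (auto simp: mod_if)
    \<comment> \<open>After the shift by \<open>i\<close> the third arc is
      \<open>a + b, ..., 10\<close> together with 0. Points from \<open>11 - i\<close> on wrap
      around. If both ends of an edge wrap, both lie in the third arc; if only \<open>y\<close>
      does, the order of the ends is reversed.\<close>
    have "y \<le> a \<or> (a \<le> x \<and> y \<le> a + b) \<or> ((x = 0 \<or> a + b \<le> x) \<and> a + b \<le> y)"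
    proof (cases "y + i < 11")
      case True
      then have "E (x + i) (y + i)" using xy m[of x] m[of y] by simp
      then have "(i \<le> x + i \<and> y + i \<le> k) \<or> (k \<le> x + i \<and> y + i \<le> j) \<or>
          ((x + i \<le> i \<or> j \<le> x + i) \<and> (y + i \<le> i \<or> j \<le> y + i))"
        using cells[of "x + i" "y + i"] True xy(1) by auto
      then show ?thesis using xy(1) ab(6,7) by auto
    next
      case y: False
      show ?thesis
      proof (cases "x + i < 11")
        case True
        then have "E (x + i) (y + i - 11)" using xy y m[of x] m[of y] by simp
        then have "E (y + i - 11) (x + i)" using E(1) by (simp add: symp_def)
        moreover have yi: "y + i - 11 < i" using xy(2) y by linarith
        ultimately have "x + i \<le> i \<or> j \<le> x + i"
          using cells[of "y + i - 11" "x + i"] True ikj by auto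
        then show ?thesis using y ab(6,7) ikj(3) by auto
      next
        case False
        then show ?thesis using y ab(6,7) ikj(3) by linarith
      qed
    qed
    then show ?thesis using xy(1,2)
      by (auto simp: same_cell_def triangle_cells_def)
  qed
  then have "\<exists>B. card B = 7 \<and> clique_model ?E {..<11} B"
    using noncrossing_rotate[OF nc E(1), of i] E
    by (intro certifies_sound[OF t]) (auto simp: symp_def irreflp_def)
  then show ?thesis using model_rotate[of E i 11] by metis
qed

section \<open>Induction on the number of points\<close>

text \<open>Let \<open>ij\<close> be an edge of least span at least 2. From \<open>i + 1\<close>, an
  edge leaving the range would cross \<open>ij\<close> and a long edge within it would be shorter
  than \<open>ij\<close>, so only \<open>i\<close> and \<open>i + 2\<close> can be neighbours.
  Without such an edge, 0 sees at most 1.\<close>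

lemma exists_degree_le_2:
  assumes nc: "noncrossing N E" and E: "symp E" "irreflp E" and "N > 1"
  shows "\<exists>a<N. \<exists>x y. \<forall>v<N. E a v \<longrightarrow> v = x \<or> v = y"
proof (cases "\<exists>i j. i + 2 \<le> j \<and> j < N \<and> E i j")
  case True
  define P where "P d \<longleftrightarrow> (\<exists>i. d \<ge> 2 \<and> i + d < N \<and> E i (i + d))" for d
  obtain i j where "i + 2 \<le> j" "j < N" "E i j" using True by blast
  then have "P (j - i)" unfolding P_def by (intro exI[of _ i]) auto
  then have P: "P (LEAST d. P d)" by (rule LeastI)
  then obtain i where i: "(LEAST d. P d) \<ge> 2" "i + (LEAST d. P d) < N" "E i (i + (LEAST d. P d))"
    unfolding P_def by blast
  define j where "j = i + (LEAST d. P d)"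
  have small: "\<not> E x y" if "x + 2 \<le> y" "y < N" "y - x < j - i" for x y
  proof
    assume "E x y"
    then have "P (y - x)" unfolding P_def using that by (intro exI[of _ x]) auto
    then show False using not_less_Least[of "y - x" P] that j_def by auto
  qed
  have ij: "i + 2 \<le> j" "j < N" "E i j" using i j_def by auto
  have "v = i \<or> v = i + 2" if v: "v < N" "E (Suc i) v" for v
  proof -
    have "E v (Suc i)" using v E by (simp add: symp_def)
    then have "\<not> v < i" using noncrossingD[OF nc, of v i "Suc i" j] ij by auto
    moreover have "\<not> j < v" using noncrossingD[OF nc, of i "Suc i" j v] ij v by auto
    moreover have "\<not> (Suc i + 2 \<le> v \<and> v \<le> j)"
    proof
      assume h: "Suc i + 2 \<le> v \<and> v \<le> j"
      then have "v - Suc i < j - i" using ij(1) by linarith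
      then show False using small[of "Suc i" v] v h by auto
    qed
    moreover have "v \<noteq> Suc i" using v E by (auto dest: irreflpD)
    ultimately show ?thesis by linarith
  qed
  then show ?thesis using ij by (intro exI[of _ "Suc i"]) auto
next
  case False
  have "v = 1" if "v < N" "E 0 v" for v
  proof -
    have "v \<noteq> 0" using that E by (metis irreflpD)
    moreover have "\<not> 2 \<le> v" using False that by auto
    ultimately show ?thesis by simp
  qed
  then show ?thesis using assms(4) by (intro exI[of _ 0]) auto
qed

text \<open>If \<open>q\<close> lies beyond the middle neighbour, the chords from 0 to
  \<open>p 1\<close> and \<open>p 2\<close> both run between \<open>p 0\<close> and
  \<open>q\<close>. A common neighbour of these two vertices is not 0, and it would have to lie both
  before and beyond one of the chords. The other case is symmetric. Five neighbours guarantee two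
  separating chords and an outer neighbour on either side.\<close>

lemma five_neighbours_dominate:
  assumes nc: "noncrossing N E" and E: "symp E" "irreflp E"
    and near: "\<And>a b. a < N \<Longrightarrow> b < N \<Longrightarrow> a \<noteq> b \<Longrightarrow> E a b \<or> (\<exists>z<N. E a z \<and> E b z)"
    and S: "card S = 5" "\<And>s. s \<in> S \<Longrightarrow> s < N \<and> E 0 s"
    and q: "0 < q" "q < N"
  shows "E 0 q"
proof (rule ccontr)
  assume nq: "\<not> E 0 q"
  have sym: "E x y \<longleftrightarrow> E y x" and irr: "\<not> E x x" for x y
    using E by (auto dest: sympD irreflpD)
  have finS: "finite S" using S by (metis card.infinite zero_neq_numeral)
  obtain l where l: "sorted_wrt (<) l" "set l = S" "length l = 5"
    using sorted_list_of_set.strict_sorted_key_list_of_set[of S] finS S 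
    by (metis set_sorted_list_of_set sorted_list_of_set.length_sorted_key_list_of_set strict_sorted_list_of_set)
  define p where "p i = l ! i" for i
  have p: "p i < N" "E 0 (p i)" "0 < p i" "p i \<noteq> q" if "i < 5" for i
  proof -
    have "p i \<in> S" using that l unfolding p_def by (metis nth_mem)
    then show "p i < N" "E 0 (p i)" "0 < p i" "p i \<noteq> q"
      using S(2)[of "p i"] irr nq by (auto intro: gr0I)
  qed
  have mono: "p i < p j" if "i < j" "j < 5" for i j
    using l that by (auto simp: p_def sorted_wrt_iff_nth_less)
  have cross: False if "0 < u" "u < m" "m < v" "v < N" "E u v" "E 0 m" for u m v
    using noncrossingD[OF nc, of 0 u m v] that by auto
  consider "p 2 < q" | "q < p 2" using p[of 2] by fastforce
  then show False
  proof cases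
    case 1
    have o: "p 0 < p 1" "p 1 < p 2" using mono by auto
    have "\<not> E (p 0) q" using cross[of "p 0" "p 1" q] o 1 p q by auto
    then obtain z where z: "z < N" "E (p 0) z" "E q z"
      using near[of "p 0" q] p[of 0] q by auto
    have z0: "0 < z" using z nq sym by (auto intro: gr0I)
    have "\<not> p 1 < z" using cross[of "p 0" "p 1" z] o p z by auto
    moreover have "\<not> z \<le> p 1" using cross[of z "p 2" q] o 1 p q z z0 sym[of q z] by auto
    ultimately show False by simp
  next
    case 2
    have o: "p 2 < p 3" "p 3 < p 4" using mono by auto
    have "\<not> E q (p 4)" using cross[of q "p 3" "p 4"] o 2 p q by auto
    then obtain z where z: "z < N" "E q z" "E (p 4) z"
      using near[of q "p 4"] p[of 4] q by auto
    have z0: "0 < z" using z nq sym by (auto intro: gr0I)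
    have "\<not> z < p 3" using cross[of z "p 3" "p 4"] o p[of 3] p[of 4] z z0 sym[of "p 4" z] by auto
    moreover have "\<not> p 3 \<le> z" using cross[of q "p 2" z] o 2 p[of 2] q z by auto
    ultimately show False by simp
  qed
qed

lemma model_of_dominating_vertex:
  assumes nc: "noncrossing (2 * n - 3) E" and E: "symp E" "irreflp E" and n: "n \<ge> 7"
    and dom: "\<And>q. 0 < q \<Longrightarrow> q < 2 * n - 3 \<Longrightarrow> E 0 q"
  shows "\<exists>B. card B = n \<and> clique_model E {..<2 * n - 3} B"
proof -
  \<comment> \<open>An edge from \<open>i\<close> to some \<open>j > i + 1\<close> would cross the
    chord from 0 to \<open>i + 1\<close>. Besides 0 the vertex 1 is left out, since
    \<open>path_like_model\<close> takes exactly \<open>2 * n - 5\<close> vertices.\<close>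
  let ?N = "2 * n - 3" and ?vs = "[2..<2 * n - 3]"
  have "path_like E ?vs" unfolding path_like_def
  proof (intro conjI allI impI notI)
    fix j i assume ji: "j < length ?vs" "Suc i < j" "E (?vs ! i) (?vs ! j)"
    then have lt: "j + 2 < 2 * n - 3" "i + 3 < 2 * n - 3" "E (i + 2) (j + 2)"
      using n by (auto simp: add.commute)
    then show False
      using noncrossingD[OF nc, of 0 "i + 2" "i + 3" "j + 2"] dom[of "i + 3"] ji(2) by simp
  qed simp
  moreover have "length ?vs = 2 * n - 5" using n by simp
  ultimately obtain B where "card B = n" "clique_model E (set ?vs) B"
    using path_like_model[OF n _ _ E] by blast
  moreover have "set ?vs \<subseteq> {..<?N}" by auto
  ultimately show ?thesis using clique_model_mono by blast
qed

lemma noncrossing_model: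
  assumes "n \<ge> 7" "noncrossing (2 * n - 3) E" "symp E" "irreflp E"
  shows "\<exists>B. card B = n \<and> clique_model E {..<2 * n - 3} B"
  using assms
proof (induction n arbitrary: E rule: nat_induct_at_least)
  case base
  then show ?case using noncrossing_model_11 by simp
next
  case (Suc n)
  define N where "N = 2 * Suc n - 3"
  have N: "N \<ge> 13" "N - 2 = 2 * n - 3" "N = 2 * n - 1" using Suc.hyps by (auto simp: N_def)
  note nc = Suc.prems(1)[folded N_def] and E = Suc.prems(2,3)
  have sym: "E x y \<longleftrightarrow> E y x" and irr: "\<not> E x x" for x y
    using E by (auto dest: sympD irreflpD)
  show ?case
  proof (cases "\<exists>a b. a < N \<and> b < N \<and> a \<noteq> b \<and> \<not> E a b \<and> (\<forall>z<N. \<not> (E a z \<and> E b z))")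
    case True
    then obtain a b where ab: "a < N" "b < N" "a \<noteq> b" "\<not> E a b" "\<And>z. z < N \<Longrightarrow> \<not> (E a z \<and> E b z)"
      by blast
    define W where "W = {..<N} - {a, b}"
    define f where "f = (!) (sorted_list_of_set W)"
    have W: "finite W" "card W = 2 * n - 3" using ab N by (auto simp: W_def)
    then have len: "length (sorted_list_of_set W) = 2 * n - 3" by simp
    have mono: "f i < f j" if "i < j" "j < 2 * n - 3" for i j
      using strict_sorted_list_of_set[of W] that len by (auto simp: f_def sorted_wrt_iff_nth_less)
    have fW: "f i \<in> W" if "i < 2 * n - 3" for i
      using that W len nth_mem[of i "sorted_list_of_set W"] by (auto simp: f_def)
    have im: "f ` {..<2 * n - 3} = W"
    proof -
      have "(!) l ` {..<length l} = set l" for l :: "nat list" by (auto simp: in_set_conv_nth)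
      from this[of "sorted_list_of_set W"] show ?thesis using W len by (simp add: f_def)
    qed
    have inj: "inj_on f {..<2 * n - 3}"
      by (rule inj_onI) (metis mono lessThan_iff less_irrefl linorder_neqE_nat)
    have "noncrossing (2 * n - 3) (\<lambda>i j. E (f i) (f j))"
      using nc mono by (rule noncrossing_mono_image) (use fW W_def in auto)
    moreover have "symp (\<lambda>i j. E (f i) (f j))" "irreflp (\<lambda>i j. E (f i) (f j))"
      using E by (auto simp: symp_def irreflp_def)
    ultimately obtain B where "card B = n" "clique_model (\<lambda>i j. E (f i) (f j)) {..<2 * n - 3} B"
      using Suc.IH by blast
    then have B: "card ((`) f ` B) = n" "clique_model E ({..<N} - {a, b}) ((`) f ` B)"
      using clique_model_image[OF _ inj] im W_def by auto
    then have "finite ((`) f ` B)" using Suc.hyps by (metis card.infinite not_numeral_le_zero)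
    then show ?thesis
      using clique_model_insert_pair[OF B(2) _ _ E ab(4)] ab B(1) N_def by (metis lessThan_iff)
  next
    case False
    then have near: "E a b \<or> (\<exists>z<N. E a z \<and> E b z)" if "a < N" "b < N" "a \<noteq> b" for a b
      using that by blast
    obtain a x y where a: "a < N" "\<And>v. v < N \<Longrightarrow> E a v \<Longrightarrow> v = x \<or> v = y"
      using exists_degree_le_2[OF nc E] N by auto
    let ?D = "\<lambda>x. {v. v < N \<and> x < N \<and> E x v}"
    \<comment> \<open>A vertex other than \<open>a\<close> is one of the neighbours
      \<open>x\<close>, \<open>y\<close> of \<open>a\<close> or adjacent to one of them. So
      \<open>N\<close> is at most 3 plus the degrees of \<open>x\<close> and \<open>y\<close>, and
      \<open>N \<ge> 13\<close> gives a degree of at least 5. The conjunct \<open>x < N\<close>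
      makes the set empty if \<open>a\<close> has fewer than two neighbours and \<open>x\<close> is
      a dummy.\<close>
    have "{..<N} \<subseteq> insert a (insert x (insert y (?D x \<union> ?D y)))"
    proof
      fix v assume "v \<in> {..<N}"
      then show "v \<in> insert a (insert x (insert y (?D x \<union> ?D y)))"
        using near[of a v] a sym by auto
    qed
    then have "N \<le> card (insert a (insert x (insert y (?D x \<union> ?D y))))"
      using card_mono[of "insert a (insert x (insert y (?D x \<union> ?D y)))" "{..<N}"] by simp
    also have "\<dots> \<le> 3 + card (?D x \<union> ?D y)"
      by (simp add: card_insert_if)
    also have "\<dots> \<le> 3 + (card (?D x) + card (?D y))" by (simp add: card_Un_le)
    finally have "card (?D x) \<ge> 5 \<or> card (?D y) \<ge> 5" using N by linarith
    then obtain x where x: "card (?D x) \<ge> 5" by blast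
    then obtain S where S: "S \<subseteq> ?D x" "card S = 5" using obtain_subset_with_card_n by metis
    have "S \<noteq> {}" using S(2) by auto
    then have "x < N" using S(1) by blast
    define g where "g i = (i + x) mod N" for i
    define F where "F = (\<lambda>i j. E (g i) (g j))"
    have g: "inj_on g {..<N}" "g ` {..<N} = {..<N}" "g 0 = x"
      unfolding g_def using inj_on_rotate image_rotate \<open>x < N\<close> by auto
    have F: "noncrossing N F" "symp F" "irreflp F"
      using noncrossing_rotate[OF nc E(1), of x] E by (auto simp: F_def g_def symp_def irreflp_def)
    have nearF: "F a b \<or> (\<exists>z<N. F a z \<and> F b z)" if "a < N" "b < N" "a \<noteq> b" for a b
    proof -
      have "g a \<noteq> g b" "g a < N" "g b < N" using g that by (auto dest: inj_onD)
      then consider "E (g a) (g b)" | z where "z < N" "E (g a) z" "E (g b) z" using near by blast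
      then show ?thesis
      proof cases
        case 2
        then obtain z' where "z' < N" "z = g z'" using g(2) by (metis imageE lessThan_iff)
        then show ?thesis using 2 by (auto simp: F_def)
      qed (simp add: F_def)
    qed
    define T where "T = {i. i < N \<and> g i \<in> S}"
    have "g ` T = S"
    proof
      show "S \<subseteq> g ` T"
      proof
        fix s assume "s \<in> S"
        moreover then obtain i where "i < N" "s = g i" using S(1) g(2) by (metis (no_types, lifting) imageE lessThan_iff mem_Collect_eq subsetD)
        ultimately show "s \<in> g ` T" by (auto simp: T_def)
      qed
    qed (auto simp: T_def)
    moreover have "inj_on g T" using g(1) by (rule inj_on_subset) (auto simp: T_def)
    ultimately have "card T = 5" using S(2) card_image by metis
    moreover have "t < N \<and> F 0 t" if "t \<in> T" for t
      using that S(1) g(3) by (auto simp: T_def F_def)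
    ultimately have "F 0 q" if "0 < q" "q < N" for q
      using five_neighbours_dominate[OF F nearF] that by blast
    then have "\<exists>B. card B = Suc n \<and> clique_model F {..<N} B"
      using model_of_dominating_vertex[of "Suc n" F] F Suc.hyps by (simp add: N_def)
    then show ?thesis
      using model_rotate[of E x N] unfolding F_def g_def N_def by metis
  qed
qed

section \<open>Outerplanar graphs\<close>

text \<open>A subdivided \<open>K\<^sub>4\<close> need not be excluded separately: unless it is \<open>K\<^sub>4\<close> itself, it contains a
  theta with three subdivided sides.\<close>

definition outerplanar_on :: "'a set \<Rightarrow> ('a \<Rightarrow> 'a \<Rightarrow> bool) \<Rightarrow> bool" where
  "outerplanar_on V E \<longleftrightarrow>
     (\<forall>a b P Q R. theta E a b P Q R \<longrightarrow> set (a # b # P @ Q @ R) \<subseteq> V \<longrightarrow> P = [] \<or> Q = [] \<or> R = []) \<and>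
     (\<forall>p\<in>V. \<forall>q\<in>V. \<forall>r\<in>V. \<forall>s\<in>V. \<not> (E p q \<and> E p r \<and> E p s \<and> E q r \<and> E q s \<and> E r s))"

definition noncrossing_list :: "('a \<Rightarrow> 'a \<Rightarrow> bool) \<Rightarrow> 'a list \<Rightarrow> bool" where
  "noncrossing_list E vs \<longleftrightarrow> noncrossing (length vs) (\<lambda>i j. E (vs ! i) (vs ! j))"

lemma outerplanar_onI:
  assumes "\<And>a b P Q R. theta E a b P Q R \<Longrightarrow> set (a # b # P @ Q @ R) \<subseteq> V \<Longrightarrow> P = [] \<or> Q = [] \<or> R = []"
    and "\<And>p q r s. {p, q, r, s} \<subseteq> V \<Longrightarrow> \<not> (E p q \<and> E p r \<and> E p s \<and> E q r \<and> E q s \<and> E r s)"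
  shows "outerplanar_on V E"
  unfolding outerplanar_on_def
proof (intro conjI allI impI ballI)
  show "P = [] \<or> Q = [] \<or> R = []" if "theta E a b P Q R" "set (a # b # P @ Q @ R) \<subseteq> V" for a b P Q R
    using assms(1)[OF that] .
  show "\<not> (E p q \<and> E p r \<and> E p s \<and> E q r \<and> E q s \<and> E r s)"
    if "p \<in> V" "q \<in> V" "r \<in> V" "s \<in> V" for p q r s
    using assms(2)[of p q r s] that by simp
qed

lemma outerplanar_on_theta:
  assumes "outerplanar_on V E" "theta E a b P Q R" "set (a # b # P @ Q @ R) \<subseteq> V"
  shows "P = [] \<or> Q = [] \<or> R = []"
  using conjunct1[OF assms(1)[unfolded outerplanar_on_def], rule_format, OF assms(2,3)] .

lemma outerplanar_on_K4:
  assumes "outerplanar_on V E" "{p, q, r, s} \<subseteq> V"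
  shows "\<not> (E p q \<and> E p r \<and> E p s \<and> E q r \<and> E q s \<and> E r s)"
  using conjunct2[OF assms(1)[unfolded outerplanar_on_def], rule_format, of p q r s] assms(2) by simp

lemma outerplanar_on_subset:
  assumes "outerplanar_on V E" "W \<subseteq> V"
  shows "outerplanar_on W E"
proof (rule outerplanar_onI)
  show "P = [] \<or> Q = [] \<or> R = []" if "theta E a b P Q R" "set (a # b # P @ Q @ R) \<subseteq> W" for a b P Q R
    using outerplanar_on_theta[OF assms(1) that(1) order_trans[OF that(2) assms(2)]] .
  show "\<not> (E p q \<and> E p r \<and> E p s \<and> E q r \<and> E q s \<and> E r s)" if "{p, q, r, s} \<subseteq> W" for p q r s
    using outerplanar_on_K4[OF assms(1) order_trans[OF that assms(2)]] .
qed

lemma noncrossing_cong: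
  assumes "noncrossing N E" "\<And>i j. i < N \<Longrightarrow> j < N \<Longrightarrow> F i j = E i j"
  shows "noncrossing N F"
  unfolding noncrossing_def
proof (intro allI impI notI)
  fix a b c d assume "d < N" "c < d" "b < c" "a < b" "F a c \<and> F b d"
  then show False using noncrossingD[OF assms(1), of a b c d] assms(2)[of a c] assms(2)[of b d] by simp
qed

lemma noncrossing_list_rotate:
  assumes "noncrossing_list E vs" "symp E"
  shows "noncrossing_list E (rotate r vs)"
proof -
  let ?N = "length vs"
  have *: "noncrossing ?N (\<lambda>i j. E (vs ! ((i + r) mod ?N)) (vs ! ((j + r) mod ?N)))"
    using assms(1)[unfolded noncrossing_list_def]
    by (rule noncrossing_rotate) (use assms(2) in \<open>auto simp: symp_def\<close>)
  have "rotate r vs ! i = vs ! ((i + r) mod ?N)" if "i < ?N" for i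
    using that by (simp add: nth_rotate add.commute)
  then show ?thesis
    unfolding noncrossing_list_def length_rotate by (intro noncrossing_cong[OF *]) simp
qed

lemma noncrossing_list_hd:
  assumes "noncrossing_list E vs" "symp E" "v \<in> set vs" "distinct vs"
  shows "\<exists>us. noncrossing_list E (v # us) \<and> distinct (v # us) \<and> set (v # us) = set vs"
proof -
  obtain i where i: "i < length vs" "vs ! i = v" using assms(3) by (auto simp: in_set_conv_nth)
  let ?us = "rotate i vs"
  have "vs \<noteq> []" using i by auto
  then have "?us \<noteq> []" "hd ?us = v" using i by (simp_all add: hd_rotate_conv_nth)
  then obtain us where us: "?us = v # us" by (metis list.collapse)
  have "noncrossing_list E (v # us)" "distinct (v # us)" "set (v # us) = set vs"
    using noncrossing_list_rotate[OF assms(1,2), of i] assms(4) us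
    by (metis distinct_rotate set_rotate)+
  then show ?thesis by blast
qed

text \<open>Suppose two edges cross and the last end \<open>d\<close> is in \<open>bs\<close>. Then
  \<open>b\<close> is in \<open>bs\<close>, its partner being \<open>d\<close>, hence so is
  \<open>c\<close>, and \<open>a\<close> is \<open>v\<close> or in \<open>bs\<close>. So the
  crossing occurs within one of the two given lists.\<close>

lemma noncrossing_list_glue:
  assumes A: "noncrossing_list E (v # as)" and B: "noncrossing_list E (v # bs)" and "symp E"
    and no: "\<And>a b. a \<in> set as \<Longrightarrow> b \<in> set bs \<Longrightarrow> \<not> E a b"
  shows "noncrossing_list E (v # as @ bs)"
  unfolding noncrossing_list_def noncrossing_def
proof (intro allI impI notI)
  let ?l = "v # as @ bs" and ?p = "length as"
  fix d c b a
  assume d: "d < length ?l" and cd: "c < d" and bc: "b < c" and ab: "a < b"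
    and EE: "E (?l ! a) (?l ! c) \<and> E (?l ! b) (?l ! d)"
  have inA: "?l ! i = (v # as) ! i" if "i \<le> ?p" for i
    using that by (auto simp: nth_Cons nth_append split: nat.splits)
  have inB: "?l ! i = (v # bs) ! (i - ?p)" if "?p < i" for i
    using that by (auto simp: nth_Cons nth_append split: nat.splits)
      (metis Suc_diff_Suc diff_Suc_Suc diff_is_0_eq leD less_Suc_eq_le nat.inject)+
  have memA: "?l ! i \<in> set as" if "0 < i" "i \<le> ?p" for i
    using that by (auto simp: nth_Cons nth_append split: nat.splits)
  have memB: "?l ! i \<in> set bs" if "?p < i" "i < length ?l" for i
    using that by (auto simp: nth_Cons nth_append split: nat.splits)
  show False
  proof (cases "d \<le> ?p")
    case True
    then have "a \<le> ?p" "b \<le> ?p" "c \<le> ?p" "d \<le> ?p" using ab bc cd by linarith+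
    then have eqs: "?l ! a = (v # as) ! a" "?l ! b = (v # as) ! b" "?l ! c = (v # as) ! c" "?l ! d = (v # as) ! d"
      by (blast intro: inA)+
    have "E ((v # as) ! a) ((v # as) ! c)" "E ((v # as) ! b) ((v # as) ! d)"
      using EE unfolding eqs by blast+
    then show False
      using noncrossingD[OF A[unfolded noncrossing_list_def], of a b c d] ab bc cd True by simp
  next
    case False
    then have "\<not> b \<le> ?p" using no[OF memA memB, of b d] EE ab d by auto
    then have b: "?p < b" by simp
    then have nc: "\<not> (0 < a \<and> a \<le> ?p)" using no[OF memA memB, of a c] EE bc cd d by auto
    \<comment> \<open>For \<open>a = 0\<close> truncated subtraction gives 0 again, the position of
      \<open>v\<close> in both lists.\<close>
    have "?l ! a = (v # bs) ! (a - ?p)" using nc inB[of a] by (cases "a = 0") auto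
    moreover have "a - ?p < b - ?p" "b - ?p < c - ?p" "c - ?p < d - ?p" using ab bc cd b by linarith+
    moreover have "d - ?p < length (v # bs)" using d b bc cd by simp
    ultimately show False
      using noncrossingD[OF B[unfolded noncrossing_list_def], of "a - ?p" "b - ?p" "c - ?p" "d - ?p"]
        EE inB[of b] inB[of c] inB[of d] b bc cd by auto
  qed
qed

section \<open>The circular order from a spanning cycle\<close>

text \<open>Length 2 is allowed, so that any edge can start the search for a longest cycle.\<close>

definition closed_walk :: "('a \<Rightarrow> 'a \<Rightarrow> bool) \<Rightarrow> 'a list \<Rightarrow> bool" where
  "closed_walk E p \<longleftrightarrow> distinct p \<and> length p \<ge> 2 \<and> successively E p \<and> E (last p) (hd p)"

lemma closed_walk_rotate: "closed_walk E (xs @ ys) \<Longrightarrow> closed_walk E (ys @ xs)"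
  by (cases "xs = []"; cases "ys = []") (auto simp: closed_walk_def successively_append_iff)

text \<open>Crossing chords \<open>ac\<close> and \<open>bd\<close> give a theta between
  \<open>a\<close> and \<open>b\<close>: one side along \<open>A\<close>, one over the chord to
  \<open>c\<close> and back along \<open>B\<close>, one back along \<open>D\<close> and over the
  chord from \<open>d\<close>. The last two are subdivided, so \<open>A\<close> is empty.\<close>

lemma crossing_closed_walk_gap:
  assumes cyc: "closed_walk E (a # A @ b # B @ c # C @ d # D)" and E: "symp E" "E a c" "E b d"
    and op: "outerplanar_on V E" and V: "set (a # A @ b # B @ c # C @ d # D) \<subseteq> V"
  shows "A = []"
proof (rule ccontr)
  assume A: "A \<noteq> []"
  have sym: "E x y \<longleftrightarrow> E y x" for x y using E(1) by (auto dest: sympD)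
  have flip: "(\<lambda>x y. E y x) = E" using sym by auto
  have "theta E a b A (c # rev B) (rev D @ [d])"
    using cyc E(2,3) sym A
    by (auto simp: theta_def closed_walk_def successively_append_iff successively_Cons flip hd_rev last_rev
        hd_append split: if_splits)
  moreover have "set (a # b # A @ (c # rev B) @ rev D @ [d]) \<subseteq> V" using V by auto
  ultimately show False using outerplanar_on_theta[OF op] A by blast
qed

text \<open>Rotating the cycle closes all four gaps, and \<open>a\<close>, \<open>b\<close>,
  \<open>c\<close>, \<open>d\<close> with the two chords form a K_4.\<close>

lemma crossing_closed_walk:
  assumes cyc: "closed_walk E (a # A @ b # B @ c # C @ d # D)" and E: "symp E" "E a c" "E b d"
    and op: "outerplanar_on V E" and V: "set (a # A @ b # B @ c # C @ d # D) \<subseteq> V"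
  shows False
proof -
  have sym: "E x y \<longleftrightarrow> E y x" for x y using E(1) by (auto dest: sympD)
  have "A = []" using crossing_closed_walk_gap[OF assms] .
  moreover have "B = []"
  proof (rule crossing_closed_walk_gap[of E b B c C d D a A])
    show "closed_walk E (b # B @ c # C @ d # D @ a # A)"
      using closed_walk_rotate[of E "a # A" "b # B @ c # C @ d # D"] cyc by simp
  qed (use E sym op V in auto)
  moreover have "C = []"
  proof (rule crossing_closed_walk_gap[of E c C d D a A b B])
    show "closed_walk E (c # C @ d # D @ a # A @ b # B)"
      using closed_walk_rotate[of E "a # A @ b # B" "c # C @ d # D"] cyc by simp
  qed (use E sym op V in auto)
  moreover have "D = []"
  proof (rule crossing_closed_walk_gap[of E d D a A b B c C])
    show "closed_walk E (d # D @ a # A @ b # B @ c # C)"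
      using closed_walk_rotate[of E "a # A @ b # B @ c # C" "d # D"] cyc by simp
  qed (use E sym op V in auto)
  ultimately have "E a b" "E b c" "E c d" "E d a" using cyc by (auto simp: closed_walk_def)
  then have "E a b \<and> E a c \<and> E a d \<and> E b c \<and> E b d \<and> E c d" using E sym by simp
  moreover have "{a, b, c, d} \<subseteq> V" using V by auto
  ultimately show False using outerplanar_on_K4[OF op] by blast
qed

lemma connecting_path:
  assumes "(\<lambda>a b. E a b \<and> b \<in> S)\<^sup>*\<^sup>* x y" "x \<in> S"
  shows "\<exists>xs. xs \<noteq> [] \<and> distinct xs \<and> hd xs = x \<and> last xs = y \<and> successively E xs \<and> set xs \<subseteq> S"
  using assms
proof (induction rule: rtranclp_induct)
  case base
  then show ?case by (intro exI[of _ "[x]"]) auto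
next
  case (step y z)
  then obtain xs where xs: "xs \<noteq> []" "distinct xs" "hd xs = x" "last xs = y" "successively E xs" "set xs \<subseteq> S"
    by blast
  show ?case
  proof (cases "z \<in> set xs")
    case True
    then obtain us ws where "xs = us @ z # ws" by (meson split_list)
    then show ?thesis using xs
      by (intro exI[of _ "us @ [z]"]) (auto simp: successively_append_iff hd_append)
  next
    case False
    then show ?thesis using xs step
      by (intro exI[of _ "xs @ [z]"]) (auto simp: successively_append_iff)
  qed
qed

text \<open>Not only cut vertices: in a disconnected graph, a vertex whose removal leaves at least
  two components qualifies too. Disconnected graphs therefore need no case of their own.\<close>

definition separable :: "'a set \<Rightarrow> ('a \<Rightarrow> 'a \<Rightarrow> bool) \<Rightarrow> 'a \<Rightarrow> bool" where
  "separable V E v \<longleftrightarrow> (\<exists>A B. A \<union> B = V - {v} \<and> A \<inter> B = {} \<and> A \<noteq> {} \<and> B \<noteq> {} \<and>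
     (\<forall>x\<in>A. \<forall>y\<in>B. \<not> E x y))"

text \<open>A component \<open>D\<close> of the rest is attached to the cycle at two vertices
  \<open>c1\<close>, \<open>c2\<close>. A path through \<open>D\<close> together with the two halves
  of the cycle is a theta whose middle side is subdivided, so one half is a single edge, and the
  detour through \<open>D\<close> replaces it.\<close>

lemma extend_closed_walk:
  assumes E: "symp E" and nonsep: "\<And>v. v \<in> V \<Longrightarrow> \<not> separable V E v"
    and op: "outerplanar_on V E" and p: "closed_walk E p" "set p \<subset> V"
  obtains q where "closed_walk E q" "set q \<subseteq> V" "length p < length q"
proof -
  have sym: "E x y \<longleftrightarrow> E y x" for x y using E by (auto dest: sympD)
  have flip: "(\<lambda>x y. E y x) = E" using sym by auto
  obtain w where w: "w \<in> V - set p" using p by blast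
  let ?S = "V - set p"
  let ?R = "\<lambda>a b. E a b \<and> b \<in> ?S"
  define D where "D = {x. ?R\<^sup>*\<^sup>* w x}"
  have DS: "D \<subseteq> ?S"
  proof
    fix x assume "x \<in> D"
    then have "?R\<^sup>*\<^sup>* w x" by (simp add: D_def)
    then show "x \<in> ?S" using w by (induction rule: rtranclp_induct) auto
  qed
  have wD: "w \<in> D" by (simp add: D_def)
  have Dstep: "y \<in> D" if "x \<in> D" "E x y" "y \<in> ?S" for x y
    using that unfolding D_def by (auto intro: rtranclp.rtrancl_into_rtrancl)
  have return_path: "?R\<^sup>*\<^sup>* x w" if "x \<in> D" for x
  proof -
    have "?R\<^sup>*\<^sup>* w x" using that by (simp add: D_def)
    then show ?thesis
    proof (induction rule: rtranclp_induct)
      case (step y z)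
      have "y \<in> ?S" using step(1) DS by (auto simp: D_def)
      then have "?R z y" using step(2) sym by blast
      then show ?case using step(3) by (rule converse_rtranclp_into_rtranclp)
    qed simp
  qed
  \<comment> \<open>If \<open>c\<close> were the only vertex of the cycle with a neighbour in
    \<open>D\<close>, removing \<open>c\<close> would separate \<open>D\<close> from the other
    vertices of the cycle.\<close>
  have attach: "\<exists>d\<in>D. \<exists>y\<in>set p. y \<noteq> c \<and> E d y" if c: "c \<in> V" "c \<in> set p" for c
  proof -
    obtain c' where c': "c' \<in> set p" "c' \<noteq> c"
    proof -
      have "card (set p) \<ge> 2" using p by (simp add: closed_walk_def distinct_card)
      then have "\<not> set p \<subseteq> {c}" using card_mono[of "{c}" "set p"] by auto
      then show ?thesis using that by blast
    qed
    let ?B = "V - {c} - D"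
    have "D \<union> ?B = V - {c}" "D \<inter> ?B = {}" "D \<noteq> {}" "?B \<noteq> {}"
      using DS wD c c' p by auto
    then obtain x y where "x \<in> D" "y \<in> ?B" "E x y"
      using nonsep[OF c(1)] unfolding separable_def by meson
    then show ?thesis using Dstep[of x y] by blast
  qed
  obtain c0 where "c0 \<in> set p" using p(1) by (cases p) (auto simp: closed_walk_def)
  then obtain d1 c1 where 1: "d1 \<in> D" "c1 \<in> set p" "E d1 c1" using attach[of c0] p by blast
  then obtain d2 c2 where 2: "d2 \<in> D" "c2 \<in> set p" "E d2 c2" "c2 \<noteq> c1" using attach[of c1] p by blast
  have "?R\<^sup>*\<^sup>* d1 d2" using return_path[OF 1(1)] 2(1) by (auto simp: D_def)
  then obtain xs where xs: "xs \<noteq> []" "distinct xs" "hd xs = d1" "last xs = d2" "successively E xs" "set xs \<subseteq> ?S"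
    using connecting_path[of E ?S d1 d2] 1(1) DS by blast
  obtain us vs where "p = us @ c1 # vs" using 1(2) by (meson split_list)
  then have cyc1: "closed_walk E (c1 # vs @ us)" and set1: "set p = set (c1 # vs @ us)" 
    and len1: "length p = length (c1 # vs @ us)"
    using closed_walk_rotate[of E us "c1 # vs"] p by auto
  have "c2 \<in> set (vs @ us)" using 2 set1 by auto
  then obtain P R where PR: "vs @ us = P @ c2 # R" by (meson split_list)
  have cyc: "closed_walk E (c1 # P @ c2 # R)" and setp: "set p = set (c1 # P @ c2 # R)"
    and len: "length p = length (c1 # P @ c2 # R)" using cyc1 set1 len1 PR by auto
  have dis: "distinct (c1 # P @ c2 # R)" and disx: "set xs \<inter> set (c1 # P @ c2 # R) = {}"
    using cyc xs setp by (auto simp: closed_walk_def)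
  have "theta E c1 c2 P xs (rev R)"
    using cyc xs 1 2 sym dis disx
    by (auto simp: theta_def closed_walk_def successively_append_iff successively_Cons flip hd_rev last_rev
        hd_append split: if_splits)
  moreover have "set (c1 # c2 # P @ xs @ rev R) \<subseteq> V" using p setp xs by auto
  ultimately consider "P = []" | "R = []" using outerplanar_on_theta[OF op] xs(1) by fastforce
  then show ?thesis
  proof cases
    case P: 1
    show ?thesis
    proof (rule that)
      show "closed_walk E (c1 # xs @ c2 # R)"
        using cyc xs 1 2 sym dis disx P
        by (auto simp: closed_walk_def successively_append_iff successively_Cons hd_append split: if_splits)
      show "set (c1 # xs @ c2 # R) \<subseteq> V" using p setp xs by auto
      show "length p < length (c1 # xs @ c2 # R)" using len P xs by simp
    qed
  next
    case R: 2
    show ?thesis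
    proof (rule that)
      show "closed_walk E (c1 # P @ c2 # rev xs)"
        using cyc xs 1 2 sym dis disx R
        by (auto simp: closed_walk_def successively_append_iff successively_Cons flip hd_rev last_rev hd_append split: if_splits)
      show "set (c1 # P @ c2 # rev xs) \<subseteq> V" using p setp xs by auto
      show "length p < length (c1 # P @ c2 # rev xs)" using len R xs by simp
    qed
  qed
qed

text \<open>A longest closed walk spans \<open>V\<close>, as otherwise
  \<open>extend_closed_walk\<close> would lengthen it.\<close>

lemma hamiltonian_closed_walk:
  assumes "finite V" "card V \<ge> 2" and E: "symp E" "irreflp E"
    and nonsep: "\<And>v. v \<in> V \<Longrightarrow> \<not> separable V E v" and op: "outerplanar_on V E"
    and "\<exists>x\<in>V. \<exists>y\<in>V. E x y"
  shows "\<exists>p. closed_walk E p \<and> set p = V"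
proof -
  let ?P = "\<lambda>p. closed_walk E p \<and> set p \<subseteq> V"
  obtain x y where "x \<in> V" "y \<in> V" "E x y" using assms by blast
  then have ex: "?P [x, y]" using E by (auto simp: closed_walk_def irreflp_def symp_def)
  have bound: "length p < Suc (card V)" if "?P p" for p
    using that card_mono[OF assms(1), of "set p"] distinct_card[of p] by (auto simp: closed_walk_def)
  obtain p where p: "?P p" "\<And>q. ?P q \<Longrightarrow> length q \<le> length p"
    using ex_has_greatest_nat[of ?P "[x, y]" length "Suc (card V)"] ex bound
    by (metis (no_types, lifting) less_imp_le)
  have "set p = V"
  proof (rule ccontr)
    assume "set p \<noteq> V"
    then have "set p \<subset> V" using p by blast
    then show False using extend_closed_walk[OF E(1) nonsep op] p by (metis not_less)
  qed
  then show ?thesis using p by blast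
qed

lemma closed_walk_noncrossing:
  assumes cyc: "closed_walk E p" "set p = V" and E: "symp E" and op: "outerplanar_on V E"
  shows "noncrossing_list E p"
  unfolding noncrossing_list_def noncrossing_def
proof (intro allI impI notI)
  fix d c b a assume lt: "d < length p" "c < d" "b < c" "a < b"
    and EE: "E (p ! a) (p ! c) \<and> E (p ! b) (p ! d)"
  define A where "A = take (b - Suc a) (drop (Suc a) p)"
  define B where "B = take (c - Suc b) (drop (Suc b) p)"
  define C where "C = take (d - Suc c) (drop (Suc c) p)"
  have seg: "drop i p = p ! i # take (j - Suc i) (drop (Suc i) p) @ drop j p" if "i < j" "j < length p" for i j
  proof -
    have "drop i p = p ! i # drop (Suc i) p" using that by (simp add: Cons_nth_drop_Suc)
    moreover have "drop (Suc i) p = take (j - Suc i) (drop (Suc i) p) @ drop (j - Suc i) (drop (Suc i) p)"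
      by (rule append_take_drop_id[symmetric])
    ultimately show ?thesis using that by simp
  qed
  let ?X = "p ! a # A @ p ! b # B @ p ! c # C @ p ! d # drop (Suc d) p"
  have "drop a p = ?X"
    using seg[of a b] seg[of b c] seg[of c d] lt
    by (simp add: A_def B_def C_def Cons_nth_drop_Suc[of d p])
  then have dec: "p = take a p @ ?X" by (metis append_take_drop_id)
  then have "closed_walk E (?X @ take a p)" using cyc(1) closed_walk_rotate[of E "take a p" ?X] by simp
  moreover have "set (?X @ take a p) = V" using arg_cong[OF dec, of set] cyc(2) by auto
  ultimately have "closed_walk E (p ! a # A @ p ! b # B @ p ! c # C @ p ! d # (drop (Suc d) p @ take a p))"
    "set (p ! a # A @ p ! b # B @ p ! c # C @ p ! d # (drop (Suc d) p @ take a p)) \<subseteq> V"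
    by simp_all
  then show False using crossing_closed_walk[OF _ E _ _ op] EE by blast
qed

text \<open>A separable vertex splits the graph into two smaller ones whose circular orders are
  rotated to start at that vertex and then glued. Without one there is a spanning cycle, and its
  order is noncrossing.\<close>

lemma outerplanar_noncrossing_list:
  assumes "finite V" "outerplanar_on V E" and E: "symp E" "irreflp E"
  shows "\<exists>vs. distinct vs \<and> set vs = V \<and> noncrossing_list E vs"
  using assms(1,2)
proof (induction "card V" arbitrary: V rule: less_induct)
  case less
  have sym: "E x y \<longleftrightarrow> E y x" for x y using E by (auto dest: sympD)
  show ?case
  proof (cases "\<exists>v\<in>V. separable V E v")
    case True
    then obtain v A B where v: "v \<in> V" and AB: "A \<union> B = V - {v}" "A \<inter> B = {}" "A \<noteq> {}" "B \<noteq> {}"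
      and no: "\<And>x y. x \<in> A \<Longrightarrow> y \<in> B \<Longrightarrow> \<not> E x y"
      unfolding separable_def by blast
    have sub: "insert v A \<subset> V" "insert v B \<subset> V" using AB v by auto
    have "\<exists>vs. distinct vs \<and> set vs = insert v A \<and> noncrossing_list E vs"
      using sub less.prems by (intro less.hyps psubset_card_mono) (auto intro: finite_subset outerplanar_on_subset)
    then obtain ws where ws: "distinct ws" "set ws = insert v A" "noncrossing_list E ws" by blast
    obtain as where as: "noncrossing_list E (v # as)" "distinct (v # as)" "set (v # as) = insert v A"
      using noncrossing_list_hd[OF ws(3) E(1) _ ws(1), of v, unfolded ws(2)] by blast
    have "\<exists>vs. distinct vs \<and> set vs = insert v B \<and> noncrossing_list E vs"
      using sub less.prems by (intro less.hyps psubset_card_mono) (auto intro: finite_subset outerplanar_on_subset)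
    then obtain ws where ws: "distinct ws" "set ws = insert v B" "noncrossing_list E ws" by blast
    obtain bs where bs: "noncrossing_list E (v # bs)" "distinct (v # bs)" "set (v # bs) = insert v B"
      using noncrossing_list_hd[OF ws(3) E(1) _ ws(1), of v, unfolded ws(2)] by blast
    have "v \<notin> A" "v \<notin> B" using AB(1) by blast+
    then have sets: "set as = A" "set bs = B"
      using as(2,3) bs(2,3) insert_ident[of v "set as" A] insert_ident[of v "set bs" B] by simp_all
    have "noncrossing_list E (v # as @ bs)"
      using noncrossing_list_glue[OF as(1) bs(1) E(1)] no sets by blast
    moreover have "distinct (v # as @ bs)" "set (v # as @ bs) = V" using as(2) bs(2) sets AB(1,2) v by auto
    ultimately show ?thesis by blast
  next
    case nonsep: False
    show ?thesis
    proof (cases "card V \<ge> 3")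
      case False
      obtain vs where vs: "distinct vs" "set vs = V" using finite_distinct_list[OF less.prems(1)] by blast
      then have "length vs \<le> 2" using False distinct_card[of vs] by simp
      then have "noncrossing_list E vs" by (auto simp: noncrossing_list_def noncrossing_def)
      then show ?thesis using vs by blast
    next
      case True
      \<comment> \<open>The spanning cycle needs an edge to start from: with at least three vertices
        and no edges, every vertex would be separable.\<close>
      have "\<exists>x\<in>V. \<exists>y\<in>V. E x y"
      proof -
        obtain v where v: "v \<in> V" using True by fastforce
        have "card (V - {v}) \<ge> 2" using True v less.prems by simp
        then have "V - {v} \<noteq> {}" by (metis card.empty not_numeral_le_zero)
        then obtain a where a: "a \<in> V - {v}" by blast
        have "card (V - {v} - {a}) \<ge> 1" using \<open>card (V - {v}) \<ge> 2\<close> a less.prems by simp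
        then have "V - {v} - {a} \<noteq> {}" by (metis card.empty not_one_le_zero)
        show ?thesis
        proof (rule ccontr)
          assume no: "\<not> ?thesis"
          have "separable V E v" unfolding separable_def
            by (rule exI[of _ "{a}"], rule exI[of _ "V - {v} - {a}"])
              (use no a \<open>V - {v} - {a} \<noteq> {}\<close> in auto)
          then show False using nonsep v by blast
        qed
      qed
      then obtain p where p: "closed_walk E p" "set p = V"
        using hamiltonian_closed_walk[OF less.prems(1) _ E _ less.prems(2)] nonsep True by auto
      then show ?thesis
        using closed_walk_noncrossing[OF p E(1) less.prems(2)] by (auto simp: closed_walk_def)
    qed
  qed
qed

lemma outerplanar_model:
  assumes "finite V" "outerplanar_on V E" and E: "symp E" "irreflp E" and n: "n \<ge> 7" "card V = 2 * n - 3"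
  shows "\<exists>B. card B = n \<and> clique_model E V B"
proof -
  obtain vs where vs: "distinct vs" "set vs = V" "noncrossing_list E vs"
    using outerplanar_noncrossing_list[OF assms(1-4)] by blast
  have len: "length vs = 2 * n - 3" using vs n distinct_card by metis
  let ?E = "\<lambda>i j. E (vs ! i) (vs ! j)"
  have "symp ?E" "irreflp ?E" using E by (auto simp: symp_def irreflp_def)
  then obtain B where B: "card B = n" "clique_model ?E {..<2 * n - 3} B"
    using noncrossing_model[of n ?E] n vs len by (auto simp: noncrossing_list_def)
  have "inj_on ((!) vs) {..<2 * n - 3}" using vs len by (auto simp: inj_on_def nth_eq_iff_index_eq)
  moreover have "(!) vs ` {..<2 * n - 3} = V" using vs len by (auto simp: in_set_conv_nth)
  ultimately show ?thesis using clique_model_image[of E "(!) vs" "{..<2 * n - 3}" B] B by metis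
qed

section \<open>Spanning thetas\<close>

lemma path_like_append:
  assumes "path_like E xs" "path_like E ys" "set xs \<inter> set ys = {}"
    and cross: "\<And>x y. x \<in> set xs \<Longrightarrow> y \<in> set ys \<Longrightarrow> E x y \<Longrightarrow> x = last xs \<and> y = hd ys"
  shows "path_like E (xs @ ys)"
  unfolding path_like_def
proof (intro conjI allI impI notI)
  show "distinct (xs @ ys)" using assms by (simp add: path_like_def)
  fix j i assume j: "j < length (xs @ ys)" and ij: "Suc i < j" and e: "E ((xs @ ys) ! i) ((xs @ ys) ! j)"
  let ?n = "length xs"
  have d: "distinct xs" "distinct ys" using assms by (simp_all add: path_like_def)
  consider "j < ?n" | "?n \<le> i" | "i < ?n" "?n \<le> j" by linarith
  then show False
  proof cases
    case 1
    then show False using assms(1) ij e by (auto simp: path_like_def nth_append)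
  next
    case 2
    then have "E (ys ! (i - ?n)) (ys ! (j - ?n))" "Suc (i - ?n) < j - ?n" "j - ?n < length ys"
      using ij e j by (auto simp: nth_append)
    then show False using assms(2) by (auto simp: path_like_def)
  next
    case 3
    then have e': "E (xs ! i) (ys ! (j - ?n))" "j - ?n < length ys" using e j by (auto simp: nth_append)
    then have "xs ! i = last xs" "ys ! (j - ?n) = hd ys"
      using cross[of "xs ! i" "ys ! (j - ?n)"] 3 by simp_all
    moreover have "xs \<noteq> []" "ys \<noteq> []" using 3 e'(2) by auto
    ultimately have ne: "ys \<noteq> []" and "xs ! i = xs ! (?n - 1)" "ys ! (j - ?n) = ys ! 0" 
      using 3 e'(2) by (simp_all add: last_conv_nth hd_conv_nth)
    then have "i = ?n - 1" "j - ?n = 0"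
      using d 3 e'(2) ne nth_eq_iff_index_eq[of xs i "?n - 1"] nth_eq_iff_index_eq[of ys "j - ?n" 0] by auto
    then show False using 3 ij by simp
  qed
qed

lemma path_like_rev:
  assumes "path_like E xs" "symp E"
  shows "path_like E (rev xs)"
  unfolding path_like_def
proof (intro conjI allI impI notI)
  show "distinct (rev xs)" using assms by (simp add: path_like_def)
  fix j i assume j: "j < length (rev xs)" "Suc i < j" "E (rev xs ! i) (rev xs ! j)"
  let ?i = "length xs - Suc i" and ?j = "length xs - Suc j"
  have "E (xs ! ?j) (xs ! ?i)" using j assms(2) by (simp add: rev_nth symp_def)
  moreover have "Suc ?j < ?i" "?i < length xs" using j by auto
  ultimately show False using assms(1) by (auto simp: path_like_def)
qed

lemma path_like_infix:
  assumes "path_like E (us @ xs @ ws)"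
  shows "path_like E xs"
  unfolding path_like_def
proof (intro conjI allI impI notI)
  show "distinct xs" using assms by (simp add: path_like_def)
  fix j i assume j: "j < length xs" "Suc i < j" "E (xs ! i) (xs ! j)"
  have nth: "(us @ xs @ ws) ! (length us + k) = xs ! k" if "k < length xs" for k
    using that by (simp add: nth_append)
  have *: "\<forall>j<length (us @ xs @ ws). \<forall>i. Suc i < j \<longrightarrow> \<not> E ((us @ xs @ ws) ! i) ((us @ xs @ ws) ! j)"
    using assms unfolding path_like_def by blast
  have "\<not> E ((us @ xs @ ws) ! (length us + i)) ((us @ xs @ ws) ! (length us + j))"
    by (rule *[rule_format]) (use j in simp_all)
  then show False using j nth[of i] nth[of j] by simp
qed

lemma path_like_split:
  assumes "path_like E (us @ x # M @ y # ws)" "M \<noteq> []"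
  shows "\<not> E x y"
proof
  assume e: "E x y"
  have "path_like E (x # M @ [y])" using path_like_infix[of E us "x # M @ [y]" ws] assms(1) by simp
  then have "\<not> E ((x # M @ [y]) ! 0) ((x # M @ [y]) ! Suc (length M))"
    unfolding path_like_def using assms(2)
    by (metis length_Cons length_append_singleton length_greater_0_conv lessI Suc_less_eq)
  then show False using e by (simp add: nth_append)
qed

lemma path_likeI:
  assumes "distinct xs"
    and "\<And>us x M y ws. xs = us @ x # M @ y # ws \<Longrightarrow> M \<noteq> [] \<Longrightarrow> \<not> E x y"
  shows "path_like E xs"
  unfolding path_like_def
proof (intro conjI allI impI)
  fix j i assume j: "j < length xs" "Suc i < j"
  let ?M = "take (j - Suc i) (drop (Suc i) xs)"
  have "xs = take i xs @ xs ! i # drop (Suc i) xs" using j by (simp add: id_take_nth_drop)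
  also have "drop (Suc i) xs = ?M @ drop (j - Suc i) (drop (Suc i) xs)" by (rule append_take_drop_id[symmetric])
  also have "drop (j - Suc i) (drop (Suc i) xs) = drop j xs" using j by simp
  also have "\<dots> = xs ! j # drop (Suc j) xs" using j by (simp add: Cons_nth_drop_Suc)
  finally have "xs = take i xs @ xs ! i # ?M @ xs ! j # drop (Suc j) xs" .
  moreover have "?M \<noteq> []" using j by auto
  ultimately show "\<not> E (xs ! i) (xs ! j)" using assms(2) by blast
qed (rule assms(1))

text \<open>All that is used of the drawing when a theta with three subdivided sides exists.\<close>

locale spanning_thetas =
  fixes V :: "'a set" and E :: "'a \<Rightarrow> 'a \<Rightarrow> bool"
  assumes sym: "symp E" and irr: "irreflp E"
    and spans: "\<And>a b P Q R. theta E a b P Q R \<Longrightarrow> P \<noteq> [] \<Longrightarrow> Q \<noteq> [] \<Longrightarrow> R \<noteq> [] \<Longrightarrow>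
      set (a # b # P @ Q @ R) = V"
    and no_edge: "\<And>a b P Q R. theta E a b P Q R \<Longrightarrow> P \<noteq> [] \<Longrightarrow> Q \<noteq> [] \<Longrightarrow> R \<noteq> [] \<Longrightarrow> \<not> E a b"
begin

definition proper_theta :: "'a \<Rightarrow> 'a \<Rightarrow> 'a list \<Rightarrow> 'a list \<Rightarrow> 'a list \<Rightarrow> bool" where
  "proper_theta a b P Q R \<longleftrightarrow> theta E a b P Q R \<and> P \<noteq> [] \<and> Q \<noteq> [] \<and> R \<noteq> []"

lemma E_sym: "E x y \<longleftrightarrow> E y x"
  using sym by (auto dest: sympD)

lemma E_flip: "(\<lambda>x y. E y x) = E"
  using E_sym by auto

lemma proper_theta_swap: "proper_theta a b P Q R \<Longrightarrow> proper_theta a b Q P R"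
  by (auto simp: proper_theta_def theta_swap)

lemma proper_theta_swap': "proper_theta a b P Q R \<Longrightarrow> proper_theta a b P R Q"
  by (auto simp: proper_theta_def theta_def)

lemma proper_theta_rev:
  assumes "proper_theta a b P Q R"
  shows "proper_theta b a (rev P) (rev Q) (rev R)"
proof -
  have *: "successively E (b # rev X @ [a])" if "successively E (a # X @ [b])" for X
  proof -
    have "successively E (rev (a # X @ [b]))" using that unfolding successively_rev E_flip .
    then show ?thesis by simp
  qed
  show ?thesis using assms * by (auto simp: proper_theta_def theta_def)
qed

lemma proper_theta_vertices: "proper_theta a b P Q R \<Longrightarrow> set (a # b # P @ Q @ R) = V"
  unfolding proper_theta_def by (elim conjE) (rule spans)

lemma same_vertices:
  assumes "proper_theta a b P Q R" "proper_theta a' b' P' Q' R'"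
  shows "set (a # b # P @ Q @ R) = set (a' # b' # P' @ Q' @ R')"
  using assms by (simp only: proper_theta_vertices)

text \<open>A chord of one side of a theta yields a smaller theta, which does not span.\<close>

lemma side_path_like:
  assumes th: "proper_theta a b P Q R"
  shows "path_like E (a # P @ [b])"
proof (rule path_likeI)
  have dis: "distinct (a # b # P @ Q @ R)" using th by (simp add: proper_theta_def theta_def)
  then show "distinct (a # P @ [b])" by auto
  fix us x M y ws assume eq: "a # P @ [b] = us @ x # M @ y # ws" and M: "M \<noteq> []"
  show "\<not> E x y"
  proof
    assume e: "E x y"
    have short: False if P': "successively E (a # P' @ [b])" "P' \<noteq> []" "distinct P'" "set P' \<subseteq> set P" "set M \<inter> set P' = {}" "set M \<subseteq> set P" for P'
    proof -
      have "proper_theta a b P' Q R" using th P' by (auto simp: proper_theta_def theta_def)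
      from same_vertices[OF th this] have "set P \<subseteq> set P'" using dis by auto
      then show False using P'(5,6) M by (cases M) auto
    qed
    have "successively E (a # P @ [b])" using th by (simp only: proper_theta_def theta_def)
    then have suc: "successively E (us @ x # M @ y # ws)" by (simp only: eq)
    have suc': "successively E (us @ x # y # ws)"
      using suc e by (auto simp: successively_append_iff successively_Cons)
    have disP: "distinct P" using dis by simp
    \<comment> \<open>A chord from \<open>a\<close> to \<open>b\<close> is excluded by
      \<open>no_edge\<close>. In the other three cases skipping \<open>M\<close> leaves a nonempty
      side, and the shorter theta misses \<open>M\<close>.\<close>
    consider "us = []" "ws = []" | us' where "us = a # us'" "ws = []" | ws' where "us = []" "ws = ws' @ [b]"
      | us' ws' where "us = a # us'" "ws = ws' @ [b]"
    proof -
      have "us = [] \<or> (\<exists>us'. us = a # us')" using eq by (cases us) auto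
      moreover have "ws = [] \<or> (\<exists>ws'. ws = ws' @ [b])"
      proof (cases ws rule: rev_cases)
        case (snoc ws' z)
        then have "last (a # P @ [b]) = z" unfolding eq by simp
        then show ?thesis using snoc by simp
      qed simp
      ultimately show ?thesis using that by blast
    qed
    then show False
    proof cases
      case 1
      then have "x = a" "y = b" using eq by (auto simp: append_eq_append_conv2 Cons_eq_append_conv)
      then show False using e no_edge th by (auto simp: proper_theta_def)
    next
      case (2 us')
      then have P: "P = us' @ x # M" "y = b" using eq by (simp_all add: append_eq_append_conv2[of P])
        
      show False
        by (rule short[of "us' @ [x]"]) (use 2 P suc' M disP in \<open>auto\<close>)
    next
      case (3 ws')
      then have P: "P = M @ y # ws'" "x = a" using eq by auto
      show False
        by (rule short[of "y # ws'"]) (use 3 P suc' M disP in \<open>auto\<close>)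
    next
      case (4 us' ws')
      then have P: "P = us' @ x # M @ y # ws'" using eq by auto
      show False
        by (rule short[of "us' @ x # y # ws'"]) (use 4 P suc' M disP in \<open>auto\<close>)
    qed
  qed
qed

text \<open>The theta between \<open>a\<close> and \<open>u\<close> with sides \<open>P1\<close>,
  \<open>Q1\<close> followed by \<open>v\<close>, and \<open>R\<close> continued over
  \<open>b\<close> back along \<open>P2\<close> contains every vertex except those of
  \<open>Q2\<close>. As it spans, \<open>Q2\<close> is empty.\<close>

lemma chord_gap:
  assumes th: "proper_theta a b (P1 @ u # P2) (Q1 @ v # Q2) R" and e: "E u v" and "P1 \<noteq> []"
  shows "Q2 = []"
proof -
  have dis: "distinct (a # b # (P1 @ u # P2) @ (Q1 @ v # Q2) @ R)"
    using th by (simp add: proper_theta_def theta_def)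
  have "proper_theta a u P1 (Q1 @ [v]) (R @ b # rev P2)"
    using th e assms(3) E_sym
    by (auto simp: proper_theta_def theta_def successively_append_iff successively_Cons E_flip hd_rev last_rev
        hd_append split: if_splits)
  from same_vertices[OF th this] show ?thesis using dis by (cases Q2) auto
qed

text \<open>\<open>chord_gap\<close> applied to the theta, to its swap and to its reverse leaves
  only chords between two first or two last vertices.\<close>

lemma chord_ends:
  assumes th: "proper_theta a b P Q R" and e: "E u v" "u \<in> set P" "v \<in> set Q"
    and len: "length P \<ge> 2" "length Q \<ge> 2"
  shows "(u = hd P \<and> v = hd Q) \<or> (u = last P \<and> v = last Q)"
proof -
  obtain P1 P2 where P: "P = P1 @ u # P2" using e by (meson split_list)
  obtain Q1 Q2 where Q: "Q = Q1 @ v # Q2" using e by (meson split_list)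
  have vu: "E v u" using e E_sym by blast
  have 1: "P1 \<noteq> [] \<Longrightarrow> Q2 = []" using chord_gap[of a b P1 u P2 Q1 v Q2 R] th e P Q by simp
  have 2: "Q1 \<noteq> [] \<Longrightarrow> P2 = []"
    using chord_gap[of a b Q1 v Q2 P1 u P2 R] proper_theta_swap[OF th] vu P Q by simp
  have 3: "P2 \<noteq> [] \<Longrightarrow> Q1 = []"
    using chord_gap[of b a "rev P2" u "rev P1" "rev Q2" v "rev Q1" "rev R"] proper_theta_rev[OF th] e P Q by simp
  show ?thesis
  proof (cases "P1 = []")
    case True
    then have "P2 \<noteq> []" using P len(1) by auto
    then have "Q1 = []" by (rule 3)
    then show ?thesis using True P Q by simp
  next
    case False
    then have "Q2 = []" by (rule 1)
    then have "Q1 \<noteq> []" using Q len(2) by auto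
    then have "P2 = []" by (rule 2)
    then show ?thesis using P Q \<open>Q2 = []\<close> by simp
  qed
qed

lemma start_neighbour:
  assumes th: "proper_theta a b P Q R" and "E a x" "x \<in> set P"
  shows "x = hd P"
proof -
  obtain P1 P2 where P: "P = P1 @ x # P2" using assms(3) by (meson split_list)
  have "P1 = []" using path_like_split[of E "[]" a P1 x "P2 @ [b]"] side_path_like[OF th] assms(2) P by auto
  then show ?thesis using P by simp
qed

lemma end_neighbour:
  assumes th: "proper_theta a b P Q R" and "E b x" "x \<in> set P"
  shows "x = last P"
  using start_neighbour[OF proper_theta_rev[OF th] assms(2)] assms(3) th
  by (simp add: hd_rev proper_theta_def)

text \<open>The omitted vertices are \<open>a\<close> and \<open>last R\<close>. Without
  \<open>last R\<close>, the only possible chord between \<open>Q\<close> and \<open>R\<close> joins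
  their first vertices, exactly where the list passes from \<open>rev Q\<close> to
  \<open>butlast R\<close>.\<close>

lemma path_avoiding_isolated_side:
  assumes th: "proper_theta a b P Q R" and len: "length Q \<ge> 2" "length R \<ge> 2"
    and iso: "\<And>x y. x \<in> set P \<Longrightarrow> y \<in> set Q \<union> set R \<Longrightarrow> \<not> E x y"
  shows "path_like E (P @ b # rev Q @ butlast R)" (is "path_like E ?vs")
    "set (P @ b # rev Q @ butlast R) \<subseteq> V" "length (P @ b # rev Q @ butlast R) = length (P @ Q @ R)"
proof -
  have dis: "distinct (a # b # P @ Q @ R)" using th by (simp add: proper_theta_def theta_def)
  note thQ = proper_theta_swap[OF th] and thR = proper_theta_swap[OF proper_theta_swap'[OF th]]
  have R: "set (butlast R) \<subseteq> set R" "last R \<notin> set (butlast R)" "hd (butlast R) = hd R" "butlast R \<noteq> []"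
  proof -
    obtain R' z where R': "R = R' @ [z]" using len(2) by (cases R rule: rev_cases) auto
    moreover have "R' \<noteq> []" using len(2) R' by auto
    ultimately show "set (butlast R) \<subseteq> set R" "last R \<notin> set (butlast R)" "hd (butlast R) = hd R" "butlast R \<noteq> []"
      using dis by auto
  qed
  have pP: "path_like E P" using path_like_infix[of E "[a]" P "[b]"] side_path_like[OF th] by simp
  have pQ: "path_like E (b # rev Q)"
    using path_like_infix[of E "[]" "b # rev Q" "[a]"] path_like_rev[OF side_path_like[OF thQ] sym] by simp
  have pR: "path_like E (butlast R)"
  proof -
    have "R \<noteq> []" using len by auto
    then have "a # R @ [b] = [a] @ butlast R @ [last R, b]" by simp
    from side_path_like[OF thR, unfolded this] show ?thesis by (rule path_like_infix)
  qed
  have pQR: "path_like E ((b # rev Q) @ butlast R)"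
  proof (rule path_like_append[OF pQ pR])
    show "set (b # rev Q) \<inter> set (butlast R) = {}" using R(1) dis by auto
    fix x y assume xy: "x \<in> set (b # rev Q)" "y \<in> set (butlast R)" "E x y"
    have yR: "y \<in> set R" "y \<noteq> last R" using xy(2) R by auto
    have "x \<noteq> b" using end_neighbour[OF thR _ yR(1)] xy(3) yR(2) by auto
    then have xQ: "x \<in> set Q" using xy(1) by auto
    have thQR: "proper_theta a b Q R P" using proper_theta_swap'[OF thQ] .
    have "x = hd Q \<and> y = hd R" using chord_ends[OF thQR xy(3) xQ yR(1) len] yR(2) by auto
    then show "x = last (b # rev Q) \<and> y = hd (butlast R)" using R len by (auto simp: last_rev)
  qed
  show "path_like E ?vs"
  proof (rule path_like_append[OF pP])
    show "path_like E (b # rev Q @ butlast R)" using pQR by simp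
    show "set P \<inter> set (b # rev Q @ butlast R) = {}" using R(1) dis by auto
    fix x y assume xy: "x \<in> set P" "y \<in> set (b # rev Q @ butlast R)" "E x y"
    then have "y = b" using iso[of x y] R(1) by auto
    then show "x = last P \<and> y = hd (b # rev Q @ butlast R)"
      using end_neighbour[OF th _ xy(1)] xy(3) E_sym by auto
  qed
  show "set ?vs \<subseteq> V" using proper_theta_vertices[OF th] R(1) by auto
  show "length ?vs = length (P @ Q @ R)" using len by simp
qed

text \<open>The omitted vertices are \<open>u\<close> and \<open>hd Q\<close>. This removes the
  chord between first vertices and the edge from \<open>a\<close> to \<open>Q\<close>; the chord
  between last vertices is absent by assumption.\<close>

lemma path_avoiding_hub:
  assumes th: "proper_theta a b [u] Q R" and len: "length Q \<ge> 2" "length R \<ge> 2"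
    and nl: "\<not> E (last Q) (last R)"
  shows "path_like E (a # R @ b # rev (tl Q))" (is "path_like E ?vs")
    "set (a # R @ b # rev (tl Q)) \<subseteq> V" "length (a # R @ b # rev (tl Q)) = length Q + length R + 1"
proof -
  have dis: "distinct (a # b # u # Q @ R)" using th by (simp add: proper_theta_def theta_def)
  note thQ = proper_theta_swap[OF th] and thR = proper_theta_swap[OF proper_theta_swap'[OF th]]
  have thQR: "proper_theta a b Q R [u]" using proper_theta_swap'[OF thQ] .
  obtain h Q' where Q: "Q = h # Q'" "Q' \<noteq> []"
  proof (rule that)
    have "Q \<noteq> []" using len(1) by auto
    then show "Q = hd Q # tl Q" by simp
    have "length (tl Q) > 0" using len(1) by simp
    then show "tl Q \<noteq> []" unfolding length_greater_0_conv .
  qed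
  have pQ: "path_like E (rev Q')"
    using path_like_rev[OF path_like_infix[of E "[a, h]" Q' "[b]"] sym] side_path_like[OF thQ] Q by simp
  have "path_like E ((a # R @ [b]) @ rev Q')"
  proof (rule path_like_append[OF side_path_like[OF thR] pQ])
    show "set (a # R @ [b]) \<inter> set (rev Q') = {}" using dis Q by auto
    fix x y assume xy: "x \<in> set (a # R @ [b])" "y \<in> set (rev Q')" "E x y"
    have y: "y \<in> set Q" "y \<noteq> hd Q" using xy(2) dis Q by auto
    have "x \<noteq> a" using start_neighbour[OF thQ _ y(1)] xy(3) y(2) by auto
    moreover have "x \<notin> set R"
      using chord_ends[OF thQR _ y(1) _ len, of x] xy(3) E_sym[of x y] y(2) nl by auto
    ultimately have "x = b" using xy(1) by auto
    then show "x = last (a # R @ [b]) \<and> y = hd (rev Q')"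
      using end_neighbour[OF thQ _ y(1)] xy(3) Q by (auto simp: hd_rev)
  qed
  then show "path_like E ?vs" using Q by simp
  show "set ?vs \<subseteq> V" using proper_theta_vertices[OF th] Q by auto
  show "length ?vs = length Q + length R + 1" using Q by simp
qed

text \<open>If the first vertices of two sides are adjacent, the theta can be shifted: its new branch vertex
  is the first vertex of one of them, and that side becomes shorter.\<close>

lemma shortest_side_isolated:
  assumes th: "proper_theta a b P Q R" and len: "length P \<ge> 2" "length Q \<ge> 2"
    and minimal: "\<And>a b P' Q R. proper_theta a b P' Q R \<Longrightarrow> length P \<le> length P'"
    and "x \<in> set P" "y \<in> set Q"
  shows "\<not> E x y"
proof
  assume e: "E x y"
  have shift: "\<not> E (hd P') (hd Q')" if th': "proper_theta a' b' P' Q' R'" and P': "length P' = length P" 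
    for a' b' P' Q' R'
  proof
    assume e': "E (hd P') (hd Q')"
    obtain p P'' where P'': "P' = p # P''" "P'' \<noteq> []"
    proof (rule that)
      have "P' \<noteq> []" using P' len(1) by auto
      then show "P' = hd P' # tl P'" by simp
      have "length (tl P') > 0" using P' len(1) by simp
      then show "tl P' \<noteq> []" unfolding length_greater_0_conv .
    qed
    \<comment> \<open>The chord replaces the edge from \<open>a'\<close> to \<open>hd Q'\<close>,
      and \<open>a'\<close> becomes an inner vertex of the third side.\<close>
    have "proper_theta p b' P'' Q' (a' # R')"
      using th' e' E_sym P''
      by (auto simp: proper_theta_def theta_def successively_Cons hd_append split: if_splits)
    from minimal[OF this] show False using P' P'' by simp
  qed
  have "(x = hd P \<and> y = hd Q) \<or> (x = last P \<and> y = last Q)"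
    using chord_ends[OF th e assms(5,6) len] .
  then show False
  proof
    assume "x = hd P \<and> y = hd Q"
    then show False using shift[OF th] e by simp
  next
    assume "x = last P \<and> y = last Q"
    then show False using shift[OF proper_theta_rev[OF th]] e th by (simp add: hd_rev proper_theta_def)
  qed
qed

text \<open>If \<open>t\<close> were not last, the theta between \<open>t\<close> and
  \<open>b\<close> with sides \<open>Q2\<close>, \<open>u\<close>, and \<open>Q1\<close> backwards
  followed by \<open>R\<close> would miss \<open>a\<close>. The chord between the first vertices
  carries its third side.\<close>

lemma hub_chord_last:
  assumes th: "proper_theta a b [u] Q R" and e: "E u t" "t \<in> set Q" and "E (hd Q) (hd R)"
  shows "t = last Q"
proof -
  obtain Q1 Q2 where Q: "Q = Q1 @ t # Q2" using e(2) by (meson split_list)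
  have dis: "distinct (a # b # u # Q @ R)" using th by (simp add: proper_theta_def theta_def)
  have "Q2 = []"
  proof (rule ccontr)
    assume Q2: "Q2 \<noteq> []"
    have "proper_theta t b Q2 [u] (rev Q1 @ R)"
      using th e Q2 assms(4) E_sym unfolding Q
      by (auto simp: proper_theta_def theta_def successively_append_iff successively_Cons E_flip hd_rev last_rev
          hd_append split: if_splits)
    from same_vertices[OF th this] show False using dis Q by auto
  qed
  then show ?thesis using Q by simp
qed

text \<open>By \<open>hub_chord_last\<close> and its mirror image, a neighbour of \<open>u\<close>
  on \<open>Q\<close> would be both the last and the first vertex of \<open>Q\<close>.\<close>

lemma hub_isolated:
  assumes th: "proper_theta a b [u] Q R" and "E (hd Q) (hd R)" "E (last Q) (last R)" "length Q \<ge> 2"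
    and t: "t \<in> set Q"
  shows "\<not> E u t"
proof
  assume e: "E u t"
  have ne: "Q \<noteq> []" "R \<noteq> []" using th by (simp_all add: proper_theta_def)
  have "t = last Q" using hub_chord_last[OF th e t assms(2)] .
  moreover have "t = last (rev Q)"
    using hub_chord_last[of b a u "rev Q" "rev R" t] proper_theta_rev[OF th] e t assms(3) ne
    by (simp add: hd_rev)
  moreover have "distinct Q" using th by (simp add: proper_theta_def theta_def)
  moreover have "hd Q \<noteq> last Q"
    using assms(4) \<open>distinct Q\<close> by (cases Q) auto
  ultimately show False using ne by (simp add: last_rev)
qed

text \<open>\<open>P\<close> is a shortest side among all proper thetas, which forbids shifting. In
  each case two vertices are omitted and the rest is path-like: those of \<open>P\<close> and
  \<open>Q\<close> if both are single, \<open>a\<close> and \<open>last R\<close> if no chord meets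
  \<open>P\<close>, otherwise the hub \<open>u\<close> and the first or last vertex of
  \<open>Q\<close>.\<close>

lemma theta_model:
  assumes "proper_theta a0 b0 P0 Q0 R0" and n: "n \<ge> 7" "card V = 2 * n - 3"
  shows "\<exists>B. card B = n \<and> clique_model E V B"
proof -
  let ?S = "\<lambda>k. \<exists>a b P Q R. proper_theta a b P Q R \<and> length P = k"
  have "?S (length P0)" using assms(1) by blast
  then have "?S (LEAST k. ?S k)" by (rule LeastI)
  then obtain a b P Q1 R1 where th1: "proper_theta a b P Q1 R1" and least: "length P = (LEAST k. ?S k)" by blast
  have minimal: "length P \<le> length P'" if "proper_theta a' b' P' Q' R'" for a' b' P' Q' R'
    unfolding least by (rule Least_le) (use that in blast)
  obtain Q R where th: "proper_theta a b P Q R" and QR: "length Q \<le> length R"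
  proof (cases "length Q1 \<le> length R1")
    case True
    then show ?thesis using that th1 by blast
  next
    case False
    then show ?thesis using that[OF proper_theta_swap'[OF th1]] by simp
  qed
  have dis: "distinct (a # b # P @ Q @ R)" using th by (simp add: proper_theta_def theta_def)
  have card: "length P + length Q + length R + 2 = 2 * n - 3"
    using distinct_card[OF dis] proper_theta_vertices[OF th] n(2) by simp
  note thQ = proper_theta_swap[OF th] and thPR = proper_theta_swap'[OF th]
  note thR = proper_theta_swap[OF thPR]
  have PQ: "length P \<le> length Q" using minimal[OF thQ] .
  have ne: "P \<noteq> []" "Q \<noteq> []" "R \<noteq> []" using th by (simp_all add: proper_theta_def)
  have "\<exists>vs. path_like E vs \<and> set vs \<subseteq> V \<and> length vs = 2 * n - 5"
  proof (cases "length Q \<ge> 2")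
    case False
    then have "length P = 1" "length Q = 1" using PQ ne by (simp_all add: Suc_leI le_antisym not_less_eq_eq)
    then have "length (a # R @ [b]) = 2 * n - 5" using card by simp
    moreover have "set (a # R @ [b]) \<subseteq> V" using proper_theta_vertices[OF th] by auto
    ultimately show ?thesis using side_path_like[OF thR] by blast
  next
    case Q2: True
    then have R2: "length R \<ge> 2" using QR by simp
    show ?thesis
    proof (cases "\<exists>x\<in>set P. \<exists>y\<in>set Q \<union> set R. E x y")
      case False
      then show ?thesis using path_avoiding_isolated_side[OF th Q2 R2] card
        by (intro exI[of _ "P @ b # rev Q @ butlast R"]) auto
    next
      case True
      then obtain x y where xy: "x \<in> set P" "y \<in> set Q \<union> set R" "E x y" by blast
      have "\<not> length P \<ge> 2"
        using shortest_side_isolated[OF th _ Q2 minimal xy(1)] shortest_side_isolated[OF thPR _ R2 minimal xy(1)] xy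
        by auto
      moreover have "length P > 0" using ne by simp
      ultimately have "length P = 1" by linarith
      then obtain u where u: "P = [u]" by (auto simp: length_Suc_conv)
      \<comment> \<open>With both chords present, \<open>hub_isolated\<close> would exclude the
        chord from \<open>u\<close> to \<open>y\<close>, whichever of \<open>Q\<close> and
        \<open>R\<close> contains \<open>y\<close>.\<close>
      have "\<not> (E (hd Q) (hd R) \<and> E (last Q) (last R))"
        using hub_isolated[of a b u Q R y] hub_isolated[of a b u R Q y] th thPR xy u Q2 R2 E_sym by auto
      then consider "\<not> E (last Q) (last R)" | "\<not> E (hd Q) (hd R)" by blast
      then show ?thesis
      proof cases
        case 1
        then show ?thesis
          using path_avoiding_hub[of a b u Q R] th u Q2 R2 card
          by (intro exI[of _ "a # R @ b # rev (tl Q)"]) auto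
      next
        case 2
        then show ?thesis
          using path_avoiding_hub[of b a u "rev Q" "rev R"] proper_theta_rev[OF th] u Q2 R2 card ne
          by (intro exI[of _ "b # rev R @ a # rev (tl (rev Q))"]) (auto simp: last_rev)
      qed
    qed
  qed
  then obtain vs where vs: "path_like E vs" "set vs \<subseteq> V" "length vs = 2 * n - 5" by blast
  then obtain B where "card B = n" "clique_model E (set vs) B"
    using path_like_model[OF n(1) vs(3,1) sym irr] by blast
  then show ?thesis using clique_model_mono vs(2) by blast
qed

end

section \<open>Minors\<close>

text \<open>Indexing keeps track of the bags during contraction: bag \<open>i\<close> merely loses
  the merged vertex. At the end the index is the vertex of the complete graph.\<close>

definition clique_bags :: "'a graph \<Rightarrow> nat \<Rightarrow> (nat \<Rightarrow> 'a set) \<Rightarrow> bool" where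
  "clique_bags H n b \<longleftrightarrow>
     (\<forall>i<n. b i \<noteq> {} \<and> b i \<subseteq> fst H \<and> (\<forall>x\<in>b i. \<forall>y\<in>b i. x \<noteq> y \<longrightarrow> {x, y} \<in> snd H)) \<and>
     (\<forall>i<n. \<forall>j<n. i \<noteq> j \<longrightarrow> b i \<inter> b j = {} \<and> (\<exists>x\<in>b i. \<exists>y\<in>b j. {x, y} \<in> snd H))"

lemma clique_bagsD:
  assumes "clique_bags H n b"
  shows "i < n \<Longrightarrow> b i \<noteq> {}" "i < n \<Longrightarrow> b i \<subseteq> fst H"
    "i < n \<Longrightarrow> x \<in> b i \<Longrightarrow> y \<in> b i \<Longrightarrow> x \<noteq> y \<Longrightarrow> {x, y} \<in> snd H"
    "i < n \<Longrightarrow> j < n \<Longrightarrow> i \<noteq> j \<Longrightarrow> b i \<inter> b j = {}"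
    "i < n \<Longrightarrow> j < n \<Longrightarrow> i \<noteq> j \<Longrightarrow> \<exists>x\<in>b i. \<exists>y\<in>b j. {x, y} \<in> snd H"
  using assms unfolding clique_bags_def by simp_all

lemma is_minor_step: "minor_step G G' \<Longrightarrow> is_minor H G' \<Longrightarrow> is_minor H G"
  unfolding is_minor_def by (meson converse_rtranclp_into_rtranclp)

text \<open>As long as possible, delete a vertex outside all bags or contract an edge within a bag;
  bags being cliques, any two of their vertices span such an edge. When neither applies, the bags
  are single vertices covering \<open>V\<close>, and the graph is complete.\<close>

lemma complete_minor_of_bags:
  assumes "simple_graph H" "clique_bags H n b"
  shows "is_minor (complete_graph n) H"
  using assms
proof (induction "card (fst H)" arbitrary: H b rule: less_induct)
  case less
  obtain V F where H: "H = (V, F)" by (cases H)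
  have fin: "finite V" and FV: "F \<subseteq> nsets V 2" using less.prems(1) by (simp_all add: simple_graph_def H)
  note bags = clique_bagsD[OF less.prems(2), unfolded H fst_conv snd_conv]
  have edge: "\<exists>x y. e = {x, y} \<and> x \<in> V \<and> y \<in> V \<and> x \<noteq> y" if "e \<in> F" for e
  proof -
    have "e \<in> nsets V 2" using that FV by (rule subsetD[rotated])
    then show ?thesis by (elim nsets2_E) auto
  qed
  consider v where "v \<in> V" "\<And>i. i < n \<Longrightarrow> v \<notin> b i"
    | i u v where "i < n" "u \<in> b i" "v \<in> b i" "u \<noteq> v"
    | "V \<subseteq> (\<Union>i<n. b i)" "\<And>i u v. i < n \<Longrightarrow> u \<in> b i \<Longrightarrow> v \<in> b i \<Longrightarrow> u = v"
    by blast
  then show ?case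
  proof cases
    case 1
    let ?H = "(V - {v}, {e \<in> F. v \<notin> e})"
    have step: "minor_step H ?H" unfolding H by (rule delete_vertex[OF 1(1)])
    have "is_minor (complete_graph n) ?H"
    proof (rule less.hyps)
      show "card (fst ?H) < card (fst H)" unfolding H fst_conv by (rule card_Diff1_less[OF fin 1(1)])
      show "simple_graph ?H" using fin FV by (auto simp: simple_graph_def nsets_def)
      have mem: "{x, y} \<in> snd ?H" if "{x, y} \<in> F" "x \<in> b i" "i < n" "y \<in> b j" "j < n" for x y i j
        using that 1(2) by auto
      show "clique_bags ?H n b" unfolding clique_bags_def
      proof (intro conjI allI impI ballI)
        fix i assume i: "i < n"
        show "b i \<noteq> {}" using bags(1)[OF i] .
        show "b i \<subseteq> fst ?H" using bags(2)[OF i] 1(2)[OF i] by auto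
        show "{x, y} \<in> snd ?H" if "x \<in> b i" "y \<in> b i" "x \<noteq> y" for x y
          using mem[OF bags(3)[OF i that] that(1) i that(2) i] .
        fix j assume j: "j < n" "i \<noteq> j"
        show "b i \<inter> b j = {}" using bags(4)[OF i j] .
        show "\<exists>x\<in>b i. \<exists>y\<in>b j. {x, y} \<in> snd ?H" using bags(5)[OF i j] mem i j(1) by meson
      qed
    qed
    with step show ?thesis by (rule is_minor_step)
  next
    case 2
    let ?r = "\<lambda>x. if x = v then u else x"
    let ?F = "(\<lambda>e. ?r ` e) ` (F - {{u, v}})"
    let ?H = "(V - {v}, ?F)" and ?b = "\<lambda>i. b i - {v}"
    have uv: "{u, v} \<in> F" using bags(3) 2 by blast
    have uV: "u \<in> V" "v \<in> V" using bags(2) 2 by blast+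
    have step: "minor_step H ?H" unfolding H using uv 2(4) by (rule contract_edge)
    have other: "v \<notin> b j" if "j < n" "j \<noteq> i" for j
      using bags(4)[of i j] that 2(1,3) by auto
    have mem: "{?r x, ?r y} \<in> ?F" if "{x, y} \<in> F" "{x, y} \<noteq> {u, v}" for x y
      using that by (intro image_eqI[of _ _ "{x, y}"]) auto
    have rb: "?r x \<in> ?b j" if "x \<in> b j" "j < n" for x j
      using that 2 other by (cases "j = i") auto
    have "is_minor (complete_graph n) ?H"
    proof (rule less.hyps)
      show "card (fst ?H) < card (fst H)" unfolding H fst_conv by (rule card_Diff1_less[OF fin uV(2)])
      show "simple_graph ?H" unfolding simple_graph_def
      proof
        show "snd ?H \<subseteq> nsets (fst ?H) 2"
        proof
          fix e assume "e \<in> snd ?H"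
          then obtain e' where e': "e = ?r ` e'" "e' \<in> F" "e' \<noteq> {u, v}" by auto
          obtain x y where xy: "e' = {x, y}" "x \<in> V" "y \<in> V" "x \<noteq> y"
            using edge[OF e'(2)] by blast
          have "?r x \<noteq> ?r y" using xy(1,4) e'(3) by auto
          moreover have "?r x \<in> V - {v}" "?r y \<in> V - {v}" using xy uV 2(4) by auto
          ultimately have "{?r x, ?r y} \<in> nsets (V - {v}) 2" by (simp only: doubleton_in_nsets_2) simp
          moreover have "e = {?r x, ?r y}" using e' xy by auto
          ultimately show "e \<in> nsets (fst ?H) 2" by (simp only: fst_conv)
        qed
      qed (use fin in simp)
      show "clique_bags ?H n ?b" unfolding clique_bags_def fst_conv snd_conv
      proof (intro conjI allI impI ballI)
        fix j assume j: "j < n"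
        obtain z where "z \<in> b j" using bags(1)[OF j] by blast
        from rb[OF this j] show "?b j \<noteq> {}" by (metis empty_iff)
        show "?b j \<subseteq> V - {v}" using bags(2)[OF j] by blast
        show "{x, y} \<in> ?F" if "x \<in> ?b j" "y \<in> ?b j" "x \<noteq> y" for x y
        proof -
          have "{?r x, ?r y} \<in> ?F" using that bags(3)[OF j, of x y] by (intro mem) auto
          then show ?thesis using that by simp
        qed
        fix k assume k: "k < n" "j \<noteq> k"
        show "?b j \<inter> ?b k = {}" using bags(4)[OF j k] by blast
        obtain x y where xy: "x \<in> b j" "y \<in> b k" "{x, y} \<in> F" using bags(5)[OF j k] by blast
        \<comment> \<open>The edge that joins two bags survives the contraction, because the
          contracted edge lies within the single bag \<open>i\<close>.\<close>
        have "{x, y} \<noteq> {u, v}"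
        proof
          assume "{x, y} = {u, v}"
          then have "x \<in> b i" "y \<in> b i" using 2 by (auto simp: doubleton_eq_iff)
          then have "j = i" "k = i" using bags(4)[OF j 2(1)] bags(4)[OF k(1) 2(1)] xy by auto
          then show False using k by simp
        qed
        from mem[OF xy(3) this] show "\<exists>x\<in>?b j. \<exists>y\<in>?b k. {x, y} \<in> ?F"
          using rb[OF xy(1) j] rb[OF xy(2) k(1)] by blast
      qed
    qed
    with step show ?thesis by (rule is_minor_step)
  next
    case 3
    have "\<exists>f. \<forall>i<n. b i = {f i}"
    proof -
      have "\<exists>x. b i = {x}" if "i < n" for i using bags(1)[OF that] 3(2)[OF that] by blast
      then show ?thesis by metis
    qed
    then obtain f where f: "\<And>i. i < n \<Longrightarrow> b i = {f i}" by blast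
    have "inj_on f {..<n}"
    proof (rule inj_onI)
      fix i j assume "i \<in> {..<n}" "j \<in> {..<n}" "f i = f j"
      then show "i = j" using bags(4)[of i j] f by (cases "i = j") auto
    qed
    moreover have "f ` {..<n} = V" using 3(1) f bags(2) by fastforce
    ultimately have bij: "bij_betw f {..<n} V" by (simp add: bij_betw_def)
    have "F = (\<lambda>e. f ` e) ` nsets {..<n} 2"
    proof
      show "F \<subseteq> (\<lambda>e. f ` e) ` nsets {..<n} 2"
        using FV bij_betw_nsets[OF bij, of 2] by (simp add: bij_betw_def)
      show "(\<lambda>e. f ` e) ` nsets {..<n} 2 \<subseteq> F"
      proof
        fix e assume "e \<in> (\<lambda>e. f ` e) ` nsets {..<n} 2"
        then obtain e' where e': "e' \<in> nsets {..<n} 2" "e = f ` e'" by blast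
        then obtain i j where "e' = {i, j}" "i < n" "j < n" "i \<noteq> j"
          using nsets2_E[OF e'(1)] by (metis lessThan_iff)
        then show "e \<in> F" using bags(5)[of i j] f e'(2) by auto
      qed
    qed
    then have "graph_isomorphic (complete_graph n) H"
      using bij unfolding graph_isomorphic_def complete_graph_def H by auto
    then obtain g where g: "bij_betw g {..<n} V" "F = (\<lambda>e. g ` e) ` nsets {..<n} 2"
      unfolding graph_isomorphic_def complete_graph_def H by auto
    let ?g = "inv_into {..<n} g"
    have "bij_betw ?g V {..<n}" using g(1) by (rule bij_betw_inv_into)
    moreover have "nsets {..<n} 2 = (\<lambda>e. ?g ` e) ` F"
    proof -
      have "?g ` g ` e = e" if "e \<in> nsets {..<n} 2" for e
        using that g(1) by (intro inv_into_image_cancel) (auto simp: bij_betw_def nsets_def)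
      then show ?thesis unfolding g(2) image_image by simp
    qed
    ultimately have "graph_isomorphic H (complete_graph n)"
      unfolding graph_isomorphic_def complete_graph_def H by auto
    then show ?thesis unfolding is_minor_def by blast
  qed
qed

lemma complement_minor_of_model:
  assumes G: "simple_graph (V, E)" and B: "clique_model (\<lambda>x y. {x, y} \<in> E) V B" and card: "card B = n" "n > 0"
  shows "is_minor (complete_graph n) (complement_graph (V, E))"
proof -
  have "finite B" using card by (metis card.infinite less_irrefl)
  then obtain b where b: "bij_betw b {..<n} B"
    using ex_bij_betw_nat_finite[of B] card by (metis atLeast0LessThan)
  have bB: "b i \<in> B" if "i < n" for i using b that by (auto simp: bij_betw_def)
  have bne: "b i \<noteq> b j" if "i < n" "j < n" "i \<noteq> j" for i j
    using b that by (auto simp: bij_betw_def dest: inj_onD)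
  have B1: "X \<noteq> {}" "X \<subseteq> V" "x \<in> X \<Longrightarrow> y \<in> X \<Longrightarrow> {x, y} \<notin> E" if "X \<in> B" for X x y
    using B that by (simp_all add: clique_model_def)
  have B2: "X \<inter> Y = {}" "\<exists>x\<in>X. \<exists>y\<in>Y. {x, y} \<notin> E" if "X \<in> B" "Y \<in> B" "X \<noteq> Y" for X Y
    using B that by (simp_all add: clique_model_def)
  have "clique_bags (complement_graph (V, E)) n b"
    unfolding clique_bags_def complement_graph_def fst_conv snd_conv
  proof (intro conjI allI impI ballI)
    fix i assume i: "i < n"
    show "b i \<noteq> {}" "b i \<subseteq> V" using B1(1,2)[OF bB[OF i]] .
    show "{x, y} \<in> nsets V 2 - E" if "x \<in> b i" "y \<in> b i" "x \<noteq> y" for x y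
      using B1(2)[OF bB[OF i]] B1(3)[OF bB[OF i] that(1,2)] that by (auto simp: doubleton_in_nsets_2)
    fix j assume j: "j < n" "i \<noteq> j"
    show dis: "b i \<inter> b j = {}" using B2(1)[OF bB[OF i] bB[OF j(1)] bne[OF i j]] .
    obtain x y where xy: "x \<in> b i" "y \<in> b j" "{x, y} \<notin> E"
      using B2(2)[OF bB[OF i] bB[OF j(1)] bne[OF i j]] by blast
    then have "{x, y} \<in> nsets V 2 - E"
      using dis B1(2)[OF bB[OF i]] B1(2)[OF bB[OF j(1)]] by (auto simp: doubleton_in_nsets_2)
    then show "\<exists>x\<in>b i. \<exists>y\<in>b j. {x, y} \<in> nsets V 2 - E" using xy by blast
  qed
  moreover have "simple_graph (complement_graph (V, E))"
    using G by (auto simp: simple_graph_def complement_graph_def)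
  ultimately show ?thesis by (rule complete_minor_of_bags[rotated])
qed

section \<open>Combination of the spanning and the outerplanar case\<close>

context plane_graph
begin

lemma clique_model_exists:
  assumes n: "n \<ge> 7" "card V = 2 * n - 3"
  shows "\<exists>B. card B = n \<and> clique_model adj V B"
proof -
  have E: "symp adj" "irreflp adj" using adj_sym adjD by (auto simp: symp_def irreflp_def)
  have fin: "finite V" using simple by (simp add: simple_graph_def)
  interpret spanning_thetas V adj
    using E theta_spans theta_no_edge by unfold_locales
  show ?thesis
  proof (cases "\<exists>a b P Q R. proper_theta a b P Q R")
    case True
    then show ?thesis using theta_model n by blast
  next
    case False
    have "outerplanar_on V adj"
    proof (rule outerplanar_onI)
      show "P = [] \<or> Q = [] \<or> R = []" if "theta adj a b P Q R" for a b P Q R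
        using False that unfolding proper_theta_def by blast
      fix p q r s :: 'a
      have "card {p, q, r, s} \<le> 4" by (simp add: card_insert_if)
      \<comment> \<open>There are at least 11 vertices, so some vertex lies off the four and
        \<open>no_K4\<close> applies.\<close>
      then have "\<not> V \<subseteq> {p, q, r, s}" using n card_mono[of "{p, q, r, s}" V] by auto
      then obtain w where "w \<in> V - {p, q, r, s}" by blast
      then show "\<not> (adj p q \<and> adj p r \<and> adj p s \<and> adj q r \<and> adj q s \<and> adj r s)"
        using no_K4 by blast
    qed
    then show ?thesis using outerplanar_model[OF fin _ E n] by blast
  qed
qed

end

theorem theorem1:
  fixes G :: "'a graph" and n :: nat
  assumes "n \<ge> 7"
    and "simple_graph G"
    and "nonseparating_planar G"
    and "card (fst G) = 2 * n - 3"
  shows "is_minor (complete_graph n) (complement_graph G)"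
proof -
  obtain V E where G: "G = (V, E)" by (cases G)
  obtain \<phi> :: "'a \<Rightarrow> real^2" and \<gamma> where "graph_embedding G \<phi> \<gamma>"
    and "\<And>p. is_cycle G p \<Longrightarrow> \<not> cycle_separates G \<phi> \<gamma> p"
    using assms(3) unfolding nonseparating_planar_def by blast
  then interpret plane_graph V E \<phi> \<gamma>
    using assms(2) unfolding G by unfold_locales
  obtain B where "card B = n" "clique_model adj V B"
    using clique_model_exists assms(1,4) unfolding G by auto
  then show ?thesis
    using complement_minor_of_model[of V E B n] simple assms(1) unfolding G adj_def[abs_def] by simp
qed

end
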